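(* Let $G$ be a compact connected abelian Lie group and let $\Gamma\subset SO(3)$ be a finite subgroup, acting on $S^2$ by rotations. Then a $\Gamma$-equivariant principal $G$-bundle $\xi=(E,S^2,p,G,\Gamma)$ over $S^2$ is determined, up to isomorphism of $\Gamma$-equivariant principal $G$-bundles, by its collection of isotropy representations together with its Chern class $c(\xi)\in\pi_2(BG)$. That is, if $\xi_1,\xi_2$ are two $\Gamma$-equivariant principal $G$-bundles over $S^2$ with the same isotropy representations and with $c(\xi_1)=c(\xi_2)$ in $\pi_2(BG)$, then $\xi_1$ and $\xi_2$ are isomorphic as $\Gamma$-equivariant principal $G$-bundles.
   Context: A $\Gamma$-equivariant principal $G$-bundle $\xi=(E,X,p,G,\Gamma)$ over a left $\Gamma$-space $X$ is a locally trivial principal (right) $G$-bundle $p:E\to X$ such that $E$ is a left $\Gamma$-space, $p$ is $\Gamma$-equivariant and $\gamma(e\cdot g)=(\gamma e)\cdot g$ for all $\gamma\in\Gamma$, $g\in G$, $e\in E$. An isomorphism of such bundles over $X$ is a homeomorphism of total spaces covering $\mathrm{id}_X$ that commutes with the actions of $\Gamma$ and $G$. Isotropy representations: for $x\in X$ with stabilizer $\Gamma_x$ and $e\in p^{-1}(x)$, let $\alpha_x:\Gamma_x\to G$ be the homomorphism defined by $\gamma e=e\cdot\alpha_x(\gamma)$ for $\gamma\in\Gamma_x$. It is independent of the choice of $e$ up to conjugation in $G$. Two bundles $\xi_1,\xi_2$ over $X$ have the same isotropy representations if for every $x\in X$ the homomorphisms $\Gamma_x\to G$ attached to $\xi_1$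 and to $\xi_2$ are conjugate in $G$. Chern class: $c(\xi)\in[S^2,BG]=\pi_2(BG)=\pi_1(G)$ is the class of the classifying map of the underlying (non-equivariant) principal $G$-bundle of $\xi$ over $S^2$. *)

theory Defs
  imports "HOL-Analysis.Analysis" "HOL-Algebra.Group_Action"
begin

section \<open>Topological groups and Lie groups\<close>

record 'g topgroup = "'g monoid" +
  gtop :: "'g topology"

definition topological_group :: "('g, 'm) topgroup_scheme \<Rightarrow> bool" where
  "topological_group G \<longleftrightarrow>
     group G \<and> topspace (gtop G) = carrier G \<and>
     continuous_map (prod_topology (gtop G) (gtop G)) (gtop G) (\<lambda>(g, h). g \<otimes>\<^bsub>G\<^esub> h) \<and>
     continuous_map (gtop G) (gtop G) (\<lambda>g. inv\<^bsub>G\<^esub> g)"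

text \<open>For open \<open>S\<close> and finite-dimensional \<open>'a\<close> this is the usual \<open>C\<^sup>k\<close>: all
  iterated directional derivatives up to order \<open>k\<close> exist and are continuous.\<close>

primrec Ck_on :: "nat \<Rightarrow> 'a::real_normed_vector set \<Rightarrow> ('a \<Rightarrow> 'b::real_normed_vector) \<Rightarrow> bool" where
  "Ck_on 0 S f \<longleftrightarrow> continuous_on S f"
| "Ck_on (Suc k) S f \<longleftrightarrow>
     (\<forall>x\<in>S. f differentiable (at x)) \<and> (\<forall>v. Ck_on k S (\<lambda>x. frechet_derivative f (at x) v))"

definition smooth_on :: "'a::real_normed_vector set \<Rightarrow> ('a \<Rightarrow> 'b::real_normed_vector) \<Rightarrow> bool" where
  "smooth_on S f \<longleftrightarrow> open S \<and> (\<forall>k. Ck_on k S f)"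

text \<open>The model space is an arbitrary finite-dimensional real inner product space. It is not taken
  in class \<open>euclidean_space\<close> because that class excludes dimension 0.\<close>

type_synonym ('g, 'v) chart = "'g set \<times> ('g \<Rightarrow> 'v)"

definition smooth_atlas :: "'g topology \<Rightarrow> ('g, 'v::real_inner) chart set \<Rightarrow> bool" where
  "smooth_atlas T \<A> \<longleftrightarrow>
     (\<exists>B::'v set. finite B \<and> span B = UNIV) \<and>
     (\<Union>(U, \<phi>)\<in>\<A>. U) = topspace T \<and>
     (\<forall>(U, \<phi>)\<in>\<A>. openin T U \<and> open (\<phi> ` U) \<and>
        homeomorphic_map (subtopology T U) (top_of_set (\<phi> ` U)) \<phi>) \<and>
     (\<forall>(U, \<phi>)\<in>\<A>. \<forall>(V, \<psi>)\<in>\<A>. smooth_on (\<phi> ` (U \<inter> V)) (\<lambda>a. \<psi> (inv_into U \<phi> a)))"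

record ('g, 'v) lie_group = "'g topgroup" +
  atlas :: "('g, 'v) chart set"

definition lie_group :: "('g, 'v::real_inner, 'm) lie_group_scheme \<Rightarrow> bool" where
  "lie_group G \<longleftrightarrow>
     topological_group G \<and> Hausdorff_space (gtop G) \<and> second_countable (gtop G) \<and>
     smooth_atlas (gtop G) (atlas G) \<and>
     (\<forall>(U, \<phi>)\<in>atlas G. \<forall>(V, \<psi>)\<in>atlas G. \<forall>(W, \<theta>)\<in>atlas G.
        smooth_on {(\<phi> g, \<psi> h) | g h. g \<in> U \<and> h \<in> V \<and> g \<otimes>\<^bsub>G\<^esub> h \<in> W}
          (\<lambda>(a, b). \<theta> (inv_into U \<phi> a \<otimes>\<^bsub>G\<^esub> inv_into V \<psi> b))) \<and>
     (\<forall>(U, \<phi>)\<in>atlas G. \<forall>(W, \<theta>)\<in>atlas G.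
        smooth_on {\<phi> g | g. g \<in> U \<and> inv\<^bsub>G\<^esub> g \<in> W} (\<lambda>a. \<theta> (inv\<^bsub>G\<^esub> (inv_into U \<phi> a))))"

section \<open>The rotation group and the sphere\<close>

definition SO3 :: "(real^3^3) monoid" where
  "SO3 = \<lparr>carrier = {A. rotation_matrix A}, mult = (**), one = mat 1\<rparr>"

lemma group_SO3: "group SO3"
proof (rule groupI)
  fix A assume "A \<in> carrier SO3"
  then have A: "orthogonal_matrix A" "det A = 1"
    by (auto simp: SO3_def rotation_matrix_def)
  then have "transpose A \<in> carrier SO3"
    by (simp add: SO3_def rotation_matrix_def orthogonal_matrix_transpose det_transpose)
  moreover have "transpose A \<otimes>\<^bsub>SO3\<^esub> A = \<one>\<^bsub>SO3\<^esub>"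
    using A by (simp add: SO3_def orthogonal_matrix_def)
  ultimately show "\<exists>B\<in>carrier SO3. B \<otimes>\<^bsub>SO3\<^esub> A = \<one>\<^bsub>SO3\<^esub>" by blast
qed (auto simp: SO3_def rotation_matrix_def orthogonal_matrix_mul orthogonal_matrix_id det_mul
       matrix_mul_assoc)

abbreviation S2 :: "(real^3) topology" where
  "S2 \<equiv> top_of_set (sphere 0 1)"

section \<open>Equivariant principal bundles\<close>

text \<open>The group \<open>\<Gamma>\<close> carries the discrete topology.\<close>

definition left_space :: "('c, 'm) monoid_scheme \<Rightarrow> 'x topology \<Rightarrow> ('c \<Rightarrow> 'x \<Rightarrow> 'x) \<Rightarrow> bool" where
  "left_space \<Gamma> X a \<longleftrightarrow>
     group \<Gamma> \<and>
     (\<forall>\<gamma>\<in>carrier \<Gamma>. continuous_map X X (a \<gamma>)) \<and>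
     (\<forall>x\<in>topspace X. a \<one>\<^bsub>\<Gamma>\<^esub> x = x) \<and>
     (\<forall>\<gamma>\<in>carrier \<Gamma>. \<forall>\<delta>\<in>carrier \<Gamma>. \<forall>x\<in>topspace X. a (\<gamma> \<otimes>\<^bsub>\<Gamma>\<^esub> \<delta>) x = a \<gamma> (a \<delta> x))"

record ('e, 'x, 'g) principal_bundle =
  total :: "'e topology"
  proj :: "'e \<Rightarrow> 'x"
  ract :: "'e \<Rightarrow> 'g \<Rightarrow> 'e"

definition principal_bundle ::
  "('g, 'm) topgroup_scheme \<Rightarrow> 'x topology \<Rightarrow> ('e, 'x, 'g, 'n) principal_bundle_scheme \<Rightarrow> bool" where
  "principal_bundle G X \<xi> \<longleftrightarrow>
     topological_group G \<and>
     continuous_map (total \<xi>) X (proj \<xi>) \<and>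
     continuous_map (prod_topology (total \<xi>) (gtop G)) (total \<xi>) (\<lambda>(e, g). ract \<xi> e g) \<and>
     (\<forall>e\<in>topspace (total \<xi>). ract \<xi> e \<one>\<^bsub>G\<^esub> = e) \<and>
     (\<forall>e\<in>topspace (total \<xi>). \<forall>g\<in>carrier G. \<forall>h\<in>carrier G.
        ract \<xi> e (g \<otimes>\<^bsub>G\<^esub> h) = ract \<xi> (ract \<xi> e g) h) \<and>
     (\<forall>x\<in>topspace X. \<exists>U \<Phi>. openin X U \<and> x \<in> U \<and>
        homeomorphic_map (prod_topology (subtopology X U) (gtop G))
          (subtopology (total \<xi>) {e \<in> topspace (total \<xi>). proj \<xi> e \<in> U}) \<Phi> \<and>
        (\<forall>y\<in>U. \<forall>g\<in>carrier G. proj \<xi> (\<Phi> (y, g)) = y \<and>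
           (\<forall>h\<in>carrier G. \<Phi> (y, g \<otimes>\<^bsub>G\<^esub> h) = ract \<xi> (\<Phi> (y, g)) h)))"

definition principal_bundle_iso ::
  "('g, 'm) topgroup_scheme \<Rightarrow> ('e1, 'x, 'g, 'n1) principal_bundle_scheme \<Rightarrow>
   ('e2, 'x, 'g, 'n2) principal_bundle_scheme \<Rightarrow> ('e1 \<Rightarrow> 'e2) \<Rightarrow> bool" where
  "principal_bundle_iso G \<xi>1 \<xi>2 F \<longleftrightarrow>
     homeomorphic_map (total \<xi>1) (total \<xi>2) F \<and>
     (\<forall>e\<in>topspace (total \<xi>1). proj \<xi>2 (F e) = proj \<xi>1 e) \<and>
     (\<forall>e\<in>topspace (total \<xi>1). \<forall>g\<in>carrier G. F (ract \<xi>1 e g) = ract \<xi>2 (F e) g)"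

record ('e, 'x, 'g, 'c) equivariant_bundle = "('e, 'x, 'g) principal_bundle" +
  lact :: "'c \<Rightarrow> 'e \<Rightarrow> 'e"

definition equivariant_principal_bundle ::
  "('g, 'm) topgroup_scheme \<Rightarrow> ('c, 'k) monoid_scheme \<Rightarrow> 'x topology \<Rightarrow> ('c \<Rightarrow> 'x \<Rightarrow> 'x) \<Rightarrow>
   ('e, 'x, 'g, 'c, 'n) equivariant_bundle_scheme \<Rightarrow> bool" where
  "equivariant_principal_bundle G \<Gamma> X a \<xi> \<longleftrightarrow>
     left_space \<Gamma> X a \<and>
     principal_bundle G X \<xi> \<and>
     left_space \<Gamma> (total \<xi>) (lact \<xi>) \<and>
     (\<forall>\<gamma>\<in>carrier \<Gamma>. \<forall>e\<in>topspace (total \<xi>). proj \<xi> (lact \<xi> \<gamma> e) = a \<gamma> (proj \<xi> e)) \<and>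
     (\<forall>\<gamma>\<in>carrier \<Gamma>. \<forall>g\<in>carrier G. \<forall>e\<in>topspace (total \<xi>).
        lact \<xi> \<gamma> (ract \<xi> e g) = ract \<xi> (lact \<xi> \<gamma> e) g)"

definition equivariantly_isomorphic ::
  "('g, 'm) topgroup_scheme \<Rightarrow> ('c, 'k) monoid_scheme \<Rightarrow>
   ('e1, 'x, 'g, 'c, 'n1) equivariant_bundle_scheme \<Rightarrow>
   ('e2, 'x, 'g, 'c, 'n2) equivariant_bundle_scheme \<Rightarrow> bool" where
  "equivariantly_isomorphic G \<Gamma> \<xi>1 \<xi>2 \<longleftrightarrow>
     (\<exists>F. principal_bundle_iso G \<xi>1 \<xi>2 F \<and>
        (\<forall>\<gamma>\<in>carrier \<Gamma>. \<forall>e\<in>topspace (total \<xi>1). F (lact \<xi>1 \<gamma> e) = lact \<xi>2 \<gamma> (F e)))"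

section \<open>Isotropy representations\<close>

text \<open>Meaningful for \<open>\<gamma>\<close> in the stabilizer of \<open>proj \<xi> e\<close>, where existence and uniqueness of
  \<open>g\<close> hold because \<open>G\<close> acts simply transitively on the fibres.\<close>

definition isotropy_rep ::
  "('g, 'm) topgroup_scheme \<Rightarrow> ('e, 'x, 'g, 'c, 'n) equivariant_bundle_scheme \<Rightarrow> 'e \<Rightarrow> 'c \<Rightarrow> 'g" where
  "isotropy_rep G \<xi> e \<gamma> = (THE g. g \<in> carrier G \<and> lact \<xi> \<gamma> e = ract \<xi> e g)"

text \<open>Another choice of \<open>e1\<close>, \<open>e2\<close> in the fibres changes the homomorphisms by conjugation, so the
  existential choice below is equivalent to the universal one.\<close>

definition same_isotropy_representations ::
  "('g, 'm) topgroup_scheme \<Rightarrow> ('c, 'k) monoid_scheme \<Rightarrow> 'x topology \<Rightarrow> ('c \<Rightarrow> 'x \<Rightarrow> 'x) \<Rightarrow>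
   ('e1, 'x, 'g, 'c, 'n1) equivariant_bundle_scheme \<Rightarrow>
   ('e2, 'x, 'g, 'c, 'n2) equivariant_bundle_scheme \<Rightarrow> bool" where
  "same_isotropy_representations G \<Gamma> X a \<xi>1 \<xi>2 \<longleftrightarrow>
     (\<forall>x\<in>topspace X. \<exists>e1\<in>topspace (total \<xi>1). \<exists>e2\<in>topspace (total \<xi>2).
        proj \<xi>1 e1 = x \<and> proj \<xi>2 e2 = x \<and>
        (\<exists>g\<in>carrier G. \<forall>\<gamma>\<in>stabilizer \<Gamma> a x.
           isotropy_rep G \<xi>2 e2 \<gamma> = g \<otimes>\<^bsub>G\<^esub> isotropy_rep G \<xi>1 e1 \<gamma> \<otimes>\<^bsub>G\<^esub> inv\<^bsub>G\<^esub> g))"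

section \<open>The universal bundle and the Chern class\<close>

definition quotient_topology :: "'a topology \<Rightarrow> ('a \<Rightarrow> 'b) \<Rightarrow> 'b topology" where
  "quotient_topology X q =
     topology (\<lambda>U. U \<subseteq> q ` topspace X \<and> openin X {x \<in> topspace X. q x \<in> U})"

lemma openin_quotient_topology:
  "openin (quotient_topology X q) U \<longleftrightarrow> U \<subseteq> q ` topspace X \<and> openin X {x \<in> topspace X. q x \<in> U}"
proof -
  have "istopology (\<lambda>U. U \<subseteq> q ` topspace X \<and> openin X {x \<in> topspace X. q x \<in> U})"
    unfolding istopology_def
  proof (intro conjI allI impI; (elim conjE)?)
    fix S T
    assume "openin X {x \<in> topspace X. q x \<in> S}" "openin X {x \<in> topspace X. q x \<in> T}"
    then have "openin X ({x \<in> topspace X. q x \<in> S} \<inter> {x \<in> topspace X. q x \<in> T})" by blast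
    also have "\<dots> = {x \<in> topspace X. q x \<in> S \<inter> T}" by blast
    finally show "openin X {x \<in> topspace X. q x \<in> S \<inter> T}" .
  next
    fix \<K>
    assume "\<forall>K\<in>\<K>. K \<subseteq> q ` topspace X \<and> openin X {x \<in> topspace X. q x \<in> K}"
    then have "openin X (\<Union>K\<in>\<K>. {x \<in> topspace X. q x \<in> K})" by blast
    also have "\<dots> = {x \<in> topspace X. q x \<in> \<Union>\<K>}" by blast
    finally show "openin X {x \<in> topspace X. q x \<in> \<Union>\<K>}" .
  qed blast+
  then show ?thesis
    by (simp add: quotient_topology_def topology_inverse')
qed

lemma topspace_quotient_topology [simp]:
  "topspace (quotient_topology X q) = q ` topspace X"
proof
  show "topspace (quotient_topology X q) \<subseteq> q ` topspace X"
    by (metis openin_quotient_topology openin_topspace)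
  have "{x \<in> topspace X. q x \<in> q ` topspace X} = topspace X" by blast
  then have "openin (quotient_topology X q) (q ` topspace X)"
    by (simp add: openin_quotient_topology)
  then show "q ` topspace X \<subseteq> topspace (quotient_topology X q)"
    by (rule openin_subset)
qed

lemma quotient_map_quotient_topology: "quotient_map X (quotient_topology X q) q"
  by (auto simp: quotient_map_def openin_quotient_topology)

text \<open>Milnor's infinite join \<open>EG = G * G * \<dots>\<close>. A point \<open>t\<^sub>0g\<^sub>0 \<oplus> t\<^sub>1g\<^sub>1 \<oplus> \<dots>\<close> is encoded by the sequence of
  pairs \<open>(t\<^sub>i, g\<^sub>i)\<close>; since \<open>g\<^sub>i\<close> is irrelevant when \<open>t\<^sub>i = 0\<close>, it is then normalised to \<open>\<one>\<close>. The topology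
  is the coarsest one for which all \<open>t\<^sub>i\<close> and all \<open>g\<^sub>i : {t\<^sub>i \<noteq> 0} \<rightarrow> G\<close> are continuous.\<close>

type_synonym 'g join = "nat \<Rightarrow> real \<times> 'g"

definition milnor_join :: "('g, 'm) topgroup_scheme \<Rightarrow> 'g join set" where
  "milnor_join G =
     {u. (\<forall>i. 0 \<le> fst (u i) \<and> snd (u i) \<in> carrier G \<and> (fst (u i) = 0 \<longrightarrow> snd (u i) = \<one>\<^bsub>G\<^esub>)) \<and>
         finite {i. fst (u i) \<noteq> 0} \<and> (\<Sum>i | fst (u i) \<noteq> 0. fst (u i)) = 1}"

definition EG_topology :: "('g, 'm) topgroup_scheme \<Rightarrow> 'g join topology" where
  "EG_topology G = topology_generated_by
     ({{u \<in> milnor_join G. fst (u i) \<in> A} | i A. open A} \<union>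
      {{u \<in> milnor_join G. fst (u i) \<noteq> 0 \<and> snd (u i) \<in> W} | i W. openin (gtop G) W})"

definition EG_act :: "('g, 'm) topgroup_scheme \<Rightarrow> 'g join \<Rightarrow> 'g \<Rightarrow> 'g join" where
  "EG_act G u g =
     (\<lambda>i. (fst (u i), if fst (u i) = 0 then \<one>\<^bsub>G\<^esub> else snd (u i) \<otimes>\<^bsub>G\<^esub> g))"

definition EG_orbit :: "('g, 'm) topgroup_scheme \<Rightarrow> 'g join \<Rightarrow> 'g join set" where
  "EG_orbit G u = EG_act G u ` carrier G"

definition classifying_space :: "('g, 'm) topgroup_scheme \<Rightarrow> 'g join set topology" where
  "classifying_space G = quotient_topology (EG_topology G) (EG_orbit G)"

definition universal_bundle ::
  "('g, 'm) topgroup_scheme \<Rightarrow> ('g join, 'g join set, 'g) principal_bundle" where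
  "universal_bundle G = \<lparr>total = EG_topology G, proj = EG_orbit G, ract = EG_act G\<rparr>"

definition pullback_bundle ::
  "'x topology \<Rightarrow> ('x \<Rightarrow> 'b) \<Rightarrow> ('e, 'b, 'g) principal_bundle \<Rightarrow>
   ('x \<times> 'e, 'x, 'g) principal_bundle" where
  "pullback_bundle X f \<zeta> =
     \<lparr>total = subtopology (prod_topology X (total \<zeta>)) {(x, e). f x = proj \<zeta> e},
      proj = fst,
      ract = (\<lambda>(x, e) g. (x, ract \<zeta> e g))\<rparr>"

definition classifying_map ::
  "('g, 'm) topgroup_scheme \<Rightarrow> 'x topology \<Rightarrow> ('e, 'x, 'g, 'n) principal_bundle_scheme \<Rightarrow>
   ('x \<Rightarrow> 'g join set) \<Rightarrow> bool" where
  "classifying_map G X \<xi> f \<longleftrightarrow>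
     continuous_map X (classifying_space G) f \<and>
     (\<exists>F. principal_bundle_iso G \<xi> (pullback_bundle X f (universal_bundle G)) F)"

text \<open>An element of \<open>[X, BG]\<close> as a set of maps: the (free) homotopy class of a classifying map.\<close>

definition chern_class ::
  "('g, 'm) topgroup_scheme \<Rightarrow> 'x topology \<Rightarrow> ('e, 'x, 'g, 'n) principal_bundle_scheme \<Rightarrow>
   ('x \<Rightarrow> 'g join set) set" where
  "chern_class G X \<xi> =
     {h. \<exists>f. classifying_map G X \<xi> f \<and> homotopic_with (\<lambda>_. True) X (classifying_space G) f h}"

end

theory Submission
  imports Defs "HOL-Algebra.FiniteProduct"
begin

text \<open>Bundle maps out of a compact base can be carried along homotopies of the classifying map, so equal
  Chern classes give an isomorphism \<open>\<Phi>\<close> of the underlying \<open>G\<close>-bundles. As \<open>G\<close> is abelian, the failure of \<open>\<Phi>\<close> to be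
  equivariant is a 1-cocycle \<open>c\<^sub>\<gamma> : S\<^sup>2 \<rightarrow> G\<close>, and it has to be written as a coboundary \<open>c\<^sub>\<gamma>(x) = b(x) b(\<gamma>x)\<^sup>-\<^sup>1\<close>.
  With \<open>n = |\<Gamma>|\<close> and \<open>P = \<Prod>\<^sub>\<gamma> c\<^sub>\<gamma>\<close> the cocycle identity reads \<open>c\<^sub>\<gamma>(x)\<^sup>n = P(x) P(\<gamma>x)\<^sup>-\<^sup>1\<close>. The power map \<open>g \<mapsto> g\<^sup>n\<close> is a local
  homeomorphism of \<open>G\<close>, so \<open>P = b\<^sup>n\<close> can be solved on the two contractible hemispheres and, the equator being
  connected, on \<open>S\<^sup>2\<close>. Then \<open>b(x) b(\<gamma>x)\<^sup>-\<^sup>1 c\<^sub>\<gamma>(x)\<^sup>-\<^sup>1\<close> takes values in the discrete \<open>n\<close>-torsion of \<open>G\<close>, hence is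
  constant. The rotation \<open>\<gamma>\<close> fixes a point of the sphere, and there the value is \<open>1\<close> because the
  isotropy representations agree.\<close>

section \<open>Topological groups\<close>

text \<open>Dividing by n is the averaging that makes the first cohomology of a finite group vanish
  for uniquely divisible coefficients. In G the quotient exists only up to n-torsion, and this
  ambiguity is exactly what the isotropy representations control. The obstacle is to divide
  continuously. G is an abstract Lie group with charts in a finite-dimensional inner product space,
  so roots near the identity come from a contraction in a single chart; connectedness of G spreads
  them to single elements and compactness to maps along a homotopy. Chern classes are sets of maps,
  so their equality says something only once a classifying map is known to exist; it is built into
  Milnor's join from a partition of unity. The sign conventions follow from G acting on the right:
  the cocycle is fixed by \<Phi>(\<gamma>e) = \<gamma>\<Phi>(e) c_\<gamma>(x) for e over x, so
  c_{\<gamma>\<delta>}(x) = c_\<delta>(x) c_\<gamma>(\<delta>x), and the corrected isomorphism is e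
  \<mapsto> \<Phi>(e) b(p(e)).\<close>

lemma continuous_map_comp:
  assumes "continuous_map X Y f" "continuous_map Y Z g"
  shows "continuous_map X Z (\<lambda>x. g (f x))"
  using continuous_map_compose[OF assms] by (simp add: o_def)

lemma continuous_map_comp_subtopology:
  assumes "continuous_map X Y f" "\<And>x. x \<in> topspace X \<Longrightarrow> f x \<in> A"
    and "continuous_map (subtopology Y A) Z g"
  shows "continuous_map X Z (\<lambda>x. g (f x))"
  by (rule continuous_map_comp[OF _ assms(3)]) (use assms in \<open>auto simp: continuous_map_in_subtopology\<close>)

text \<open>Pasting over open pieces. The local formula \<open>g\<close> may depend on the point,
  which suits maps defined by a choice or as an inverse that become explicit only in a local
  trivialization.\<close>

lemma continuous_map_locally_eq:
  assumes "\<And>y. y \<in> topspace Y \<Longrightarrow>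
    \<exists>U g. openin Y U \<and> y \<in> U \<and> continuous_map (subtopology Y U) Z g \<and> (\<forall>z\<in>U. f z = g z)"
  shows "continuous_map Y Z f"
proof -
  have "\<exists>U. openin Y U \<and> y \<in> U \<and> continuous_map (subtopology Y U) Z f" if y: "y \<in> topspace Y" for y
  proof -
    obtain U g where "openin Y U" "y \<in> U" and g: "continuous_map (subtopology Y U) Z g" "\<forall>z\<in>U. f z = g z"
      using assms[OF y] by blast
    moreover have "continuous_map (subtopology Y U) Z f"
      by (rule continuous_map_eq[OF g(1)]) (use g(2) in auto)
    ultimately show ?thesis by blast
  qed
  then obtain U where U: "\<And>y. y \<in> topspace Y \<Longrightarrow> openin Y (U y) \<and> y \<in> U y \<and> continuous_map (subtopology Y (U y)) Z f"
    by metis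
  show ?thesis
    by (rule pasting_lemma[where I = "topspace Y" and T = U and f = "\<lambda>_. f"]) (use U in auto)
qed

locale top_group =
  fixes G :: "('g, 'm) topgroup_scheme" (structure)
  assumes topological_group: "topological_group G"

sublocale top_group \<subseteq> group G
  using topological_group by (simp add: topological_group_def)

context top_group
begin

lemma topspace_gtop [simp]: "topspace (gtop G) = carrier G"
  using topological_group by (simp add: topological_group_def)

lemma continuous_map_closed: "continuous_map Y (gtop G) a \<Longrightarrow> y \<in> topspace Y \<Longrightarrow> a y \<in> carrier G"
  using continuous_map_image_subset_topspace by fastforce

lemma continuous_map_mult:
  assumes "continuous_map Y (gtop G) a" "continuous_map Y (gtop G) b"
  shows "continuous_map Y (gtop G) (\<lambda>y. a y \<otimes> b y)"
proof -
  have "continuous_map (prod_topology (gtop G) (gtop G)) (gtop G) (\<lambda>(g, h). g \<otimes> h)"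
    using topological_group by (simp add: topological_group_def)
  from continuous_map_comp[OF continuous_map_pairedI[OF assms] this] show ?thesis by simp
qed

lemma continuous_map_inv:
  assumes "continuous_map Y (gtop G) a"
  shows "continuous_map Y (gtop G) (\<lambda>y. inv (a y))"
proof -
  have "continuous_map (gtop G) (gtop G) (\<lambda>g. inv g)"
    using topological_group by (simp add: topological_group_def)
  from continuous_map_comp[OF assms this] show ?thesis .
qed

end

section \<open>Principal bundles\<close>

text \<open>Corresponds to the trivialization \<open>\<Phi> (y, g) = s y \<cdot> g\<close>, where \<open>\<kappa>\<close> is the second component of \<open>\<Phi>\<^sup>-\<^sup>1\<close>.\<close>

definition local_triv ::
  "('g, 'm) topgroup_scheme \<Rightarrow> 'x topology \<Rightarrow> ('e, 'x, 'g, 'n) principal_bundle_scheme \<Rightarrow>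
   'x set \<Rightarrow> ('x \<Rightarrow> 'e) \<Rightarrow> ('e \<Rightarrow> 'g) \<Rightarrow> bool" where
  "local_triv G X \<xi> U s \<kappa> \<longleftrightarrow>
     openin X U \<and> continuous_map (subtopology X U) (total \<xi>) s \<and>
     continuous_map (subtopology (total \<xi>) {e \<in> topspace (total \<xi>). proj \<xi> e \<in> U}) (gtop G) \<kappa> \<and>
     (\<forall>y\<in>U. proj \<xi> (s y) = y \<and> \<kappa> (s y) = \<one>\<^bsub>G\<^esub>) \<and>
     (\<forall>e\<in>topspace (total \<xi>). proj \<xi> e \<in> U \<longrightarrow>
        ract \<xi> (s (proj \<xi> e)) (\<kappa> e) = e \<and>
        (\<forall>g\<in>carrier G. proj \<xi> (ract \<xi> e g) = proj \<xi> e \<and> \<kappa> (ract \<xi> e g) = \<kappa> e \<otimes>\<^bsub>G\<^esub> g))"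

lemma local_triv_closed:
  assumes "local_triv G X \<xi> U s \<kappa>"
  shows "\<And>y. y \<in> U \<Longrightarrow> s y \<in> topspace (total \<xi>)"
    and "\<And>e. topological_group G \<Longrightarrow> e \<in> topspace (total \<xi>) \<Longrightarrow> proj \<xi> e \<in> U \<Longrightarrow> \<kappa> e \<in> carrier G"
proof -
  have U: "U \<subseteq> topspace X" and s: "continuous_map (subtopology X U) (total \<xi>) s"
    and k: "continuous_map (subtopology (total \<xi>) {e \<in> topspace (total \<xi>). proj \<xi> e \<in> U}) (gtop G) \<kappa>"
    using assms by (auto simp: local_triv_def openin_subset)
  show "s y \<in> topspace (total \<xi>)" if "y \<in> U" for y
    using that U continuous_map_image_subset_topspace[OF s] by auto
  show "\<kappa> e \<in> carrier G" if "topological_group G" "e \<in> topspace (total \<xi>)" "proj \<xi> e \<in> U" for e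
    using that continuous_map_image_subset_topspace[OF k] by (auto simp: topological_group_def)
qed

locale principal =
  fixes G :: "('g, 'm) topgroup_scheme" (structure) and X :: "'x topology"
    and \<xi> :: "('e, 'x, 'g, 'n) principal_bundle_scheme"
  assumes principal_bundle: "principal_bundle G X \<xi>"

sublocale principal \<subseteq> top_group G
  by unfold_locales (use principal_bundle in \<open>simp add: principal_bundle_def\<close>)

context principal
begin

abbreviation "E \<equiv> topspace (total \<xi>)"

lemma continuous_map_proj: "continuous_map (total \<xi>) X (proj \<xi>)"
  using principal_bundle by (simp add: principal_bundle_def)

lemma proj_closed: "e \<in> E \<Longrightarrow> proj \<xi> e \<in> topspace X"
  using continuous_map_image_subset_topspace[OF continuous_map_proj] by auto

lemma continuous_map_ract:
  assumes "continuous_map Y (total \<xi>) a" "continuous_map Y (gtop G) b"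
  shows "continuous_map Y (total \<xi>) (\<lambda>y. ract \<xi> (a y) (b y))"
proof -
  have "continuous_map (prod_topology (total \<xi>) (gtop G)) (total \<xi>) (\<lambda>(e, g). ract \<xi> e g)"
    using principal_bundle by (simp add: principal_bundle_def)
  from continuous_map_comp[OF continuous_map_pairedI[OF assms] this] show ?thesis by simp
qed

lemma ract_closed: "e \<in> E \<Longrightarrow> g \<in> carrier G \<Longrightarrow> ract \<xi> e g \<in> E"
proof -
  assume "e \<in> E" "g \<in> carrier G"
  moreover have "continuous_map (prod_topology (total \<xi>) (gtop G)) (total \<xi>) (\<lambda>(e, g). ract \<xi> e g)"
    using principal_bundle by (simp add: principal_bundle_def)
  ultimately show ?thesis
    using continuous_map_image_subset_topspace by fastforce
qed

lemma ract_one: "e \<in> E \<Longrightarrow> ract \<xi> e \<one> = e"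
  using principal_bundle by (simp add: principal_bundle_def)

lemma ract_mult: "e \<in> E \<Longrightarrow> g \<in> carrier G \<Longrightarrow> h \<in> carrier G \<Longrightarrow> ract \<xi> e (g \<otimes> h) = ract \<xi> (ract \<xi> e g) h"
  using principal_bundle by (simp add: principal_bundle_def)

lemma local_triv_exists:
  assumes "x \<in> topspace X"
  obtains U s \<kappa> where "x \<in> U" "local_triv G X \<xi> U s \<kappa>"
proof -
  have "\<forall>x\<in>topspace X. \<exists>U \<Phi>. openin X U \<and> x \<in> U \<and>
        homeomorphic_map (prod_topology (subtopology X U) (gtop G))
          (subtopology (total \<xi>) {e \<in> E. proj \<xi> e \<in> U}) \<Phi> \<and>
        (\<forall>y\<in>U. \<forall>g\<in>carrier G. proj \<xi> (\<Phi> (y, g)) = y \<and>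
           (\<forall>h\<in>carrier G. \<Phi> (y, g \<otimes> h) = ract \<xi> (\<Phi> (y, g)) h))"
    using principal_bundle[unfolded principal_bundle_def] by (elim conjE)
  from bspec[OF this assms] obtain U \<Phi> where U: "openin X U" "x \<in> U"
    and hom: "homeomorphic_map (prod_topology (subtopology X U) (gtop G))
          (subtopology (total \<xi>) {e \<in> E. proj \<xi> e \<in> U}) \<Phi>"
    and \<Phi>: "\<And>y g. y \<in> U \<Longrightarrow> g \<in> carrier G \<Longrightarrow> proj \<xi> (\<Phi> (y, g)) = y"
    "\<And>y g h. y \<in> U \<Longrightarrow> g \<in> carrier G \<Longrightarrow> h \<in> carrier G \<Longrightarrow> \<Phi> (y, g \<otimes> h) = ract \<xi> (\<Phi> (y, g)) h"
    by (elim exE conjE) blast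
  obtain \<Psi> where hm: "homeomorphic_maps (prod_topology (subtopology X U) (gtop G))
          (subtopology (total \<xi>) {e \<in> E. proj \<xi> e \<in> U}) \<Phi> \<Psi>"
    using hom by (auto simp: homeomorphic_map_maps)
  have UX: "U \<subseteq> topspace X" using U openin_subset by blast
  have c\<Phi>: "continuous_map (prod_topology (subtopology X U) (gtop G)) (total \<xi>) \<Phi>"
    and c\<Psi>: "continuous_map (subtopology (total \<xi>) {e \<in> E. proj \<xi> e \<in> U}) (prod_topology (subtopology X U) (gtop G)) \<Psi>"
    and \<Psi>\<Phi>: "\<And>y g. y \<in> U \<Longrightarrow> g \<in> carrier G \<Longrightarrow> \<Psi> (\<Phi> (y, g)) = (y, g)"
    and \<Phi>\<Psi>: "\<And>e. e \<in> E \<Longrightarrow> proj \<xi> e \<in> U \<Longrightarrow> \<Phi> (\<Psi> e) = e"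
    using hm UX by (auto simp: homeomorphic_maps_def continuous_map_in_subtopology)
  define s where "s y = \<Phi> (y, \<one>)" for y
  define \<kappa> where "\<kappa> e = snd (\<Psi> e)" for e
  have \<Psi>: "\<exists>g\<in>carrier G. \<Psi> e = (proj \<xi> e, g) \<and> \<Phi> (proj \<xi> e, g) = e" if e: "e \<in> E" "proj \<xi> e \<in> U" for e
  proof -
    have "\<Psi> e \<in> U \<times> carrier G"
      using continuous_map_image_subset_topspace[OF c\<Psi>] e by auto
    then obtain y g where yg: "\<Psi> e = (y, g)" "y \<in> U" "g \<in> carrier G" by auto
    then have "\<Phi> (y, g) = e" using \<Phi>\<Psi>[OF e] by simp
    moreover from this have "y = proj \<xi> e" using \<Phi>(1)[OF yg(2,3)] by simp
    ultimately show ?thesis using yg by auto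
  qed
  have "local_triv G X \<xi> U s \<kappa>"
    unfolding local_triv_def
  proof (intro conjI ballI impI)
    show "openin X U" by fact
    show "continuous_map (subtopology X U) (total \<xi>) s"
      unfolding s_def
      by (rule continuous_map_comp[OF _ c\<Phi>]) (auto intro!: continuous_map_pairedI)
    show "continuous_map (subtopology (total \<xi>) {e \<in> E. proj \<xi> e \<in> U}) (gtop G) \<kappa>"
      unfolding \<kappa>_def using continuous_map_comp[OF c\<Psi> continuous_map_snd] .
    show "proj \<xi> (s y) = y" "\<kappa> (s y) = \<one>" if "y \<in> U" for y
      using that by (auto simp: s_def \<kappa>_def \<Phi> \<Psi>\<Phi>)
    fix e assume e: "e \<in> E" "proj \<xi> e \<in> U"
    then obtain g where g: "g \<in> carrier G" "\<Psi> e = (proj \<xi> e, g)" "\<Phi> (proj \<xi> e, g) = e"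
      using \<Psi> by blast
    show "ract \<xi> (s (proj \<xi> e)) (\<kappa> e) = e"
      using \<Phi>(2)[OF e(2) one_closed g(1)] g by (simp add: s_def \<kappa>_def)
    fix h assume h: "h \<in> carrier G"
    have eq: "ract \<xi> e h = \<Phi> (proj \<xi> e, g \<otimes> h)"
      using \<Phi>(2)[OF e(2) g(1) h] g by simp
    show "proj \<xi> (ract \<xi> e h) = proj \<xi> e" unfolding eq using \<Phi>(1) e g h by simp
    show "\<kappa> (ract \<xi> e h) = \<kappa> e \<otimes> h" unfolding eq \<kappa>_def using \<Psi>\<Phi> e g h by simp
  qed
  with U(2) show thesis by (rule that)
qed

lemma fibre_nonempty:
  assumes "x \<in> topspace X"
  obtains e where "e \<in> E" "proj \<xi> e = x"
proof -
  obtain U s \<kappa> where U: "x \<in> U" "local_triv G X \<xi> U s \<kappa>" using local_triv_exists[OF assms] .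
  show thesis
    by (rule that[OF local_triv_closed(1)[OF U(2,1)]]) (use U in \<open>simp add: local_triv_def\<close>)
qed

lemma proj_ract: "e \<in> E \<Longrightarrow> g \<in> carrier G \<Longrightarrow> proj \<xi> (ract \<xi> e g) = proj \<xi> e"
  by (rule local_triv_exists[OF proj_closed]) (auto simp: local_triv_def)

text \<open>Freeness is visible in a trivialization, where acting by \<open>g\<close> multiplies the
  coordinate \<open>\<kappa>\<close> by \<open>g\<close> on the right.\<close>

lemma ract_cancel:
  assumes "e \<in> E" "g \<in> carrier G" "h \<in> carrier G" "ract \<xi> e g = ract \<xi> e h"
  shows "g = h"
proof -
  obtain U s \<kappa> where U: "proj \<xi> e \<in> U" "local_triv G X \<xi> U s \<kappa>"
    using local_triv_exists[OF proj_closed[OF assms(1)]] .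
  then have "\<kappa> (ract \<xi> e g) = \<kappa> e \<otimes> g" "\<kappa> (ract \<xi> e h) = \<kappa> e \<otimes> h"
    using assms(1-3) by (auto simp: local_triv_def)
  then have "\<kappa> e \<otimes> g = \<kappa> e \<otimes> h" using assms(4) by metis
  moreover have "\<kappa> e \<in> carrier G" using U assms local_triv_closed(2)[OF U(2) topological_group] by auto
  ultimately show ?thesis using assms by simp
qed

text \<open>The division function of the bundle. It is meaningful only for two points of one fibre,
  where the action is simply transitive.\<close>

definition translation :: "'e \<Rightarrow> 'e \<Rightarrow> 'g" where
  "translation e e' = (THE g. g \<in> carrier G \<and> ract \<xi> e g = e')"

lemma translation_ract: "e \<in> E \<Longrightarrow> g \<in> carrier G \<Longrightarrow> translation e (ract \<xi> e g) = g"
  unfolding translation_def by (rule the_equality) (auto intro: ract_cancel)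

lemma translation:
  assumes "e \<in> E" "e' \<in> E" "proj \<xi> e = proj \<xi> e'"
  shows "translation e e' \<in> carrier G" and "ract \<xi> e (translation e e') = e'"
proof -
  obtain U s \<kappa> where U: "proj \<xi> e \<in> U" "local_triv G X \<xi> U s \<kappa>"
    using local_triv_exists[OF proj_closed[OF assms(1)]] .
  define g where "g = inv (\<kappa> e) \<otimes> \<kappa> e'"
  have k: "\<kappa> e \<in> carrier G" "\<kappa> e' \<in> carrier G"
    using U assms local_triv_closed(2)[OF U(2) topological_group] by auto
  have s: "s (proj \<xi> e) \<in> E" using local_triv_closed(1)[OF U(2,1)] .
  have r: "ract \<xi> (s (proj \<xi> e)) (\<kappa> e) = e" "ract \<xi> (s (proj \<xi> e)) (\<kappa> e') = e'"
    using U assms by (auto simp: local_triv_def)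
  have "ract \<xi> e g = ract \<xi> (s (proj \<xi> e)) (\<kappa> e \<otimes> g)"
    using ract_mult[OF s k(1), of g] r k by (simp add: g_def)
  also have "\<kappa> e \<otimes> g = \<kappa> e'" using k by (simp add: g_def m_assoc[symmetric])
  finally have g: "g \<in> carrier G" "ract \<xi> e g = e'" using r k by (auto simp: g_def)
  then have "translation e e' = g" using translation_ract assms by blast
  with g show "translation e e' \<in> carrier G" "ract \<xi> e (translation e e') = e'" by auto
qed

text \<open>In a trivialization the division function is
  \<open>inv (\<kappa> (a z)) \<otimes> \<kappa> (b z)\<close>, hence continuous. Inverses of bundle
  maps and the equivariance cocycle owe their continuity to this.\<close>

lemma continuous_map_translation:
  assumes a: "continuous_map Y (total \<xi>) a" and b: "continuous_map Y (total \<xi>) b"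
    and eq: "\<And>y. y \<in> topspace Y \<Longrightarrow> proj \<xi> (a y) = proj \<xi> (b y)"
  shows "continuous_map Y (gtop G) (\<lambda>y. translation (a y) (b y))"
proof (rule continuous_map_locally_eq)
  fix y assume y: "y \<in> topspace Y"
  have aE: "a z \<in> E" and bE: "b z \<in> E" if "z \<in> topspace Y" for z
    using that continuous_map_image_subset_topspace[OF a] continuous_map_image_subset_topspace[OF b] by auto
  obtain U s \<kappa> where U: "proj \<xi> (a y) \<in> U" "local_triv G X \<xi> U s \<kappa>"
    using local_triv_exists[OF proj_closed[OF aE[OF y]]] .
  let ?W = "{z \<in> topspace Y. proj \<xi> (a z) \<in> U}"
  have W: "openin Y ?W"
    by (rule openin_continuous_map_preimage[OF continuous_map_comp[OF a continuous_map_proj]])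
       (use U in \<open>simp add: local_triv_def\<close>)
  have \<kappa>: "continuous_map (subtopology (total \<xi>) {e \<in> E. proj \<xi> e \<in> U}) (gtop G) \<kappa>"
    using U by (simp add: local_triv_def)
  have ca: "continuous_map (subtopology Y ?W) (gtop G) (\<lambda>z. \<kappa> (a z))"
    by (rule continuous_map_comp_subtopology[OF continuous_map_from_subtopology[OF a] _ \<kappa>]) (use aE in auto)
  have cb: "continuous_map (subtopology Y ?W) (gtop G) (\<lambda>z. \<kappa> (b z))"
    by (rule continuous_map_comp_subtopology[OF continuous_map_from_subtopology[OF b] _ \<kappa>]) (use bE eq in auto)
  have "translation (a z) (b z) = inv (\<kappa> (a z)) \<otimes> \<kappa> (b z)" if z: "z \<in> ?W" for z
  proof -
    let ?g = "translation (a z) (b z)"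
    have g: "?g \<in> carrier G" "ract \<xi> (a z) ?g = b z"
      using translation[OF aE bE eq] z by auto
    have k: "\<kappa> (a z) \<in> carrier G"
      using local_triv_closed(2)[OF U(2) topological_group] aE z by auto
    have "\<kappa> (b z) = \<kappa> (a z) \<otimes> ?g"
    proof -
      have "\<kappa> (ract \<xi> (a z) ?g) = \<kappa> (a z) \<otimes> ?g"
        using U(2) g(1) aE z by (auto simp: local_triv_def)
      then show ?thesis using g by simp
    qed
    then show ?thesis using k g by (simp add: m_assoc[symmetric])
  qed
  then show "\<exists>U g. openin Y U \<and> y \<in> U \<and> continuous_map (subtopology Y U) (gtop G) g \<and>
      (\<forall>z\<in>U. translation (a z) (b z) = g z)"
    using W y U continuous_map_mult[OF continuous_map_inv[OF ca] cb] by blast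
qed

end

text \<open>A section \<open>s\<close> and a fibre coordinate \<open>\<kappa>\<close> give back the
  trivializing homeomorphism: it sends (y, g) to s(y) g, and its inverse sends e to the pair of
  \<open>proj \<xi> e\<close> and \<open>\<kappa> e\<close>.\<close>

lemma principal_bundleI:
  assumes G: "topological_group G"
    and p: "continuous_map (total \<xi>) X (proj \<xi>)"
    and act: "continuous_map (prod_topology (total \<xi>) (gtop G)) (total \<xi>) (\<lambda>(e, g). ract \<xi> e g)"
    and one: "\<And>e. e \<in> topspace (total \<xi>) \<Longrightarrow> ract \<xi> e \<one>\<^bsub>G\<^esub> = e"
    and mult: "\<And>e g h. e \<in> topspace (total \<xi>) \<Longrightarrow> g \<in> carrier G \<Longrightarrow> h \<in> carrier G \<Longrightarrow>
        ract \<xi> e (g \<otimes>\<^bsub>G\<^esub> h) = ract \<xi> (ract \<xi> e g) h"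
    and triv: "\<And>x. x \<in> topspace X \<Longrightarrow> \<exists>U s \<kappa>. x \<in> U \<and> local_triv G X \<xi> U s \<kappa>"
  shows "principal_bundle G X \<xi>"
  unfolding principal_bundle_def
proof (intro conjI ballI)
  interpret top_group G by (rule top_group.intro[OF G])
  fix x assume "x \<in> topspace X"
  then obtain U s \<kappa> where x: "x \<in> U" and t: "local_triv G X \<xi> U s \<kappa>" using triv by blast
  have s: "continuous_map (subtopology X U) (total \<xi>) s"
    and k: "continuous_map (subtopology (total \<xi>) {e \<in> topspace (total \<xi>). proj \<xi> e \<in> U}) (gtop G) \<kappa>"
    and U: "openin X U"
    and s': "\<And>y. y \<in> U \<Longrightarrow> proj \<xi> (s y) = y \<and> \<kappa> (s y) = \<one>\<^bsub>G\<^esub>"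
    and k': "\<And>e. e\<in>topspace (total \<xi>) \<Longrightarrow> proj \<xi> e \<in> U \<Longrightarrow> ract \<xi> (s (proj \<xi> e)) (\<kappa> e) = e"
    and k'': "\<And>e g. e\<in>topspace (total \<xi>) \<Longrightarrow> proj \<xi> e \<in> U \<Longrightarrow> g\<in>carrier G \<Longrightarrow> proj \<xi> (ract \<xi> e g) = proj \<xi> e \<and> \<kappa> (ract \<xi> e g) = \<kappa> e \<otimes>\<^bsub>G\<^esub> g"
    using t unfolding local_triv_def by blast+
  have sE: "s y \<in> topspace (total \<xi>)" if "y \<in> U" for y
    using local_triv_closed(1)[OF t that] .
  have kG: "\<kappa> e \<in> carrier G" if "e\<in>topspace (total \<xi>)" "proj \<xi> e \<in> U" for e
    using that local_triv_closed(2)[OF t G] by blast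
  let ?\<Phi> = "\<lambda>(y, g). ract \<xi> (s y) g" and ?\<Psi> = "\<lambda>e. (proj \<xi> e, \<kappa> e)"
  let ?A = "prod_topology (subtopology X U) (gtop G)"
  let ?B = "subtopology (total \<xi>) {e \<in> topspace (total \<xi>). proj \<xi> e \<in> U}"
  have actE: "ract \<xi> e g \<in> topspace (total \<xi>)" if "e \<in> topspace (total \<xi>)" "g \<in> carrier G" for e g
    using that continuous_map_image_subset_topspace[OF act] by fastforce
  have c1: "continuous_map ?A ?B ?\<Phi>"
    unfolding continuous_map_in_subtopology
  proof
    have "continuous_map ?A (prod_topology (total \<xi>) (gtop G)) (\<lambda>z. (s (fst z), snd z))"
      by (intro continuous_map_pairedI continuous_map_comp[OF continuous_map_fst s] continuous_map_snd)
    from continuous_map_comp[OF this act] show "continuous_map ?A (total \<xi>) ?\<Phi>"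
      by (simp add: case_prod_unfold)
    show "?\<Phi> \<in> topspace ?A \<rightarrow> {e \<in> topspace (total \<xi>). proj \<xi> e \<in> U}"
      using actE sE s' k'' by auto
  qed
  have "continuous_map ?B (subtopology X U) (proj \<xi>)"
    using continuous_map_from_subtopology[OF p] by (auto simp: continuous_map_in_subtopology)
  then have c2: "continuous_map ?B ?A ?\<Psi>" using k by (rule continuous_map_pairedI)
  have "homeomorphic_maps ?A ?B ?\<Phi> ?\<Psi>"
    unfolding homeomorphic_maps_def using c1 c2 sE s' k' k'' by auto
  then have "homeomorphic_map ?A ?B ?\<Phi>" by (auto simp: homeomorphic_map_maps)
  moreover have "\<forall>y\<in>U. \<forall>g\<in>carrier G. proj \<xi> (?\<Phi> (y, g)) = y \<and>
           (\<forall>h\<in>carrier G. ?\<Phi> (y, g \<otimes>\<^bsub>G\<^esub> h) = ract \<xi> (?\<Phi> (y, g)) h)"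
    using sE s' k'' mult by auto
  ultimately show "\<exists>U \<Phi>. openin X U \<and> x \<in> U \<and>
        homeomorphic_map (prod_topology (subtopology X U) (gtop G))
          (subtopology (total \<xi>) {e \<in> topspace (total \<xi>). proj \<xi> e \<in> U}) \<Phi> \<and>
        (\<forall>y\<in>U. \<forall>g\<in>carrier G. proj \<xi> (\<Phi> (y, g)) = y \<and>
           (\<forall>h\<in>carrier G. \<Phi> (y, g \<otimes>\<^bsub>G\<^esub> h) = ract \<xi> (\<Phi> (y, g)) h))"
    using U x by blast
qed (use assms in auto)

section \<open>Bundle maps over a map of base spaces\<close>

text \<open>The base map is a parameter because the covering homotopy changes it step by step.
  Bijectivity is not demanded; over the identity of the base it is automatic.\<close>

definition bundle_map ::
  "('g, 'm) topgroup_scheme \<Rightarrow> ('e1, 'x, 'g, 'n1) principal_bundle_scheme \<Rightarrow>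
   ('e2, 'b, 'g, 'n2) principal_bundle_scheme \<Rightarrow> ('x \<Rightarrow> 'b) \<Rightarrow> ('e1 \<Rightarrow> 'e2) \<Rightarrow> bool" where
  "bundle_map G \<xi> \<zeta> f h \<longleftrightarrow>
     continuous_map (total \<xi>) (total \<zeta>) h \<and>
     (\<forall>e\<in>topspace (total \<xi>). proj \<zeta> (h e) = f (proj \<xi> e)) \<and>
     (\<forall>e\<in>topspace (total \<xi>). \<forall>g\<in>carrier G. h (ract \<xi> e g) = ract \<zeta> (h e) g)"

lemma bundle_map_closed:
  "bundle_map G \<xi> \<zeta> f h \<Longrightarrow> e \<in> topspace (total \<xi>) \<Longrightarrow> h e \<in> topspace (total \<zeta>)"
  using continuous_map_image_subset_topspace unfolding bundle_map_def by blast

text \<open>On each fibre \<open>F\<close> is an equivariant map between simply transitive G-sets,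
  hence bijective. Continuity of the inverse is local: starting from a section \<open>s\<close> of
  the first bundle, the preimage of a point is written with the division function of the
  second.\<close>

lemma bundle_map_imp_iso:
  assumes "principal_bundle G X \<xi>1" "principal_bundle G X \<xi>2" "bundle_map G \<xi>1 \<xi>2 (\<lambda>x. x) F"
  shows "principal_bundle_iso G \<xi>1 \<xi>2 F"
proof -
  interpret P1: principal G X \<xi>1 by (rule principal.intro) fact
  interpret P2: principal G X \<xi>2 by (rule principal.intro) fact
  have F: "continuous_map (total \<xi>1) (total \<xi>2) F"
    and Fp: "\<And>e. e \<in> P1.E \<Longrightarrow> proj \<xi>2 (F e) = proj \<xi>1 e"
    and Fg: "\<And>e g. e \<in> P1.E \<Longrightarrow> g \<in> carrier G \<Longrightarrow> F (ract \<xi>1 e g) = ract \<xi>2 (F e) g"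
    using assms(3) by (auto simp: bundle_map_def)
  have FE: "F e \<in> P2.E" if "e \<in> P1.E" for e
    using bundle_map_closed[OF assms(3) that] .
  have inj: "inj_on F P1.E"
  proof (rule inj_onI)
    fix e e' assume e: "e \<in> P1.E" "e' \<in> P1.E" "F e = F e'"
    have p: "proj \<xi>1 e = proj \<xi>1 e'" using Fp e by metis
    let ?g = "P1.translation e e'"
    have g: "?g \<in> carrier G" "ract \<xi>1 e ?g = e'" using P1.translation e p by auto
    have "ract \<xi>2 (F e) ?g = F e" using Fg[OF e(1) g(1)] g e by simp
    then have "?g = \<one>\<^bsub>G\<^esub>"
      using P2.ract_cancel[OF FE[OF e(1)] g(1)] P2.ract_one[OF FE[OF e(1)]] by simp
    then show "e = e'" using g P1.ract_one e by simp
  qed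
  define F' where "F' = inv_into P1.E F"
  \<comment> \<open>Any point \<open>a\<close> of the right fibre yields the preimage of
    \<open>e\<close>: move \<open>a\<close> by the element that carries \<open>F a\<close> to
    \<open>e\<close>.\<close>
  have lift: "ract \<xi>1 a (P2.translation (F a) e) \<in> P1.E \<and> F (ract \<xi>1 a (P2.translation (F a) e)) = e"
    if "a \<in> P1.E" "e \<in> P2.E" "proj \<xi>1 a = proj \<xi>2 e" for a e
    using that P2.translation[of "F a" e] FE Fp Fg P1.ract_closed by simp
  have img: "F ` P1.E = P2.E"
  proof (intro subset_antisym subsetI)
    fix e assume e: "e \<in> P2.E"
    obtain a where "a \<in> P1.E" "proj \<xi>1 a = proj \<xi>2 e"
      using P1.fibre_nonempty[OF P2.proj_closed[OF e]] .
    then show "e \<in> F ` P1.E" using lift e by (metis imageI)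
  qed (use FE in auto)
  have F'F: "F' (F e) = e" if "e \<in> P1.E" for e
    using that inj by (simp add: F'_def)
  have FF': "F (F' e) = e" "F' e \<in> P1.E" if "e \<in> P2.E" for e
    using that img by (auto simp: F'_def f_inv_into_f inv_into_into)
  have cF': "continuous_map (total \<xi>2) (total \<xi>1) F'"
  proof (rule continuous_map_locally_eq)
    fix e assume e: "e \<in> P2.E"
    obtain U s \<kappa> where U: "proj \<xi>2 e \<in> U" "local_triv G X \<xi>1 U s \<kappa>"
      using P1.local_triv_exists[OF P2.proj_closed[OF e]] .
    let ?W = "{e \<in> P2.E. proj \<xi>2 e \<in> U}"
    let ?s = "\<lambda>e. s (proj \<xi>2 e)"
    have W: "openin (total \<xi>2) ?W"
      by (rule openin_continuous_map_preimage[OF P2.continuous_map_proj])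
         (use U in \<open>simp add: local_triv_def\<close>)
    have s: "continuous_map (subtopology X U) (total \<xi>1) s" "\<And>y. y \<in> U \<Longrightarrow> proj \<xi>1 (s y) = y"
      using U by (auto simp: local_triv_def)
    have sE: "s y \<in> P1.E" if "y \<in> U" for y using local_triv_closed(1)[OF U(2) that] .
    have cs: "continuous_map (subtopology (total \<xi>2) ?W) (total \<xi>1) ?s"
      by (rule continuous_map_comp_subtopology[OF continuous_map_from_subtopology[OF P2.continuous_map_proj] _ s(1)]) auto
    have "continuous_map (subtopology (total \<xi>2) ?W) (gtop G) (\<lambda>e. P2.translation (F (?s e)) e)"
      by (rule P2.continuous_map_translation[OF continuous_map_comp[OF cs F]])
         (use sE s Fp in \<open>auto intro: continuous_map_from_subtopology\<close>)
    from P1.continuous_map_ract[OF cs this]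
    have "continuous_map (subtopology (total \<xi>2) ?W) (total \<xi>1) (\<lambda>e. ract \<xi>1 (?s e) (P2.translation (F (?s e)) e))" .
    moreover have "F' e = ract \<xi>1 (?s e) (P2.translation (F (?s e)) e)" if "e \<in> ?W" for e
      using lift[of "?s e" e] sE s(2) that F'F by (metis (no_types, lifting) mem_Collect_eq)
    ultimately show "\<exists>U g. openin (total \<xi>2) U \<and> e \<in> U \<and> continuous_map (subtopology (total \<xi>2) U) (total \<xi>1) g \<and>
      (\<forall>z\<in>U. F' z = g z)" using W e U by blast
  qed
  have "homeomorphic_maps (total \<xi>1) (total \<xi>2) F F'"
    using F cF' F'F FF' by (simp add: homeomorphic_maps_def)
  then have "homeomorphic_map (total \<xi>1) (total \<xi>2) F" by (auto simp: homeomorphic_map_maps)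
  then show ?thesis using Fp Fg by (simp add: principal_bundle_iso_def)
qed

section \<open>Milnor's universal bundle\<close>

context top_group
begin

lemma topspace_EG [simp]: "topspace (EG_topology G) = milnor_join G"
proof -
  have "{u \<in> milnor_join G. fst (u 0) \<in> (UNIV :: real set)} = milnor_join G" by simp
  then have "milnor_join G \<in> {{u \<in> milnor_join G. fst (u i) \<in> A} | i A. open A}"
    using open_UNIV by blast
  then show ?thesis unfolding EG_topology_def by auto
qed

lemma milnor_joinD: "u \<in> milnor_join G \<Longrightarrow> snd (u i) \<in> carrier G"
  "u \<in> milnor_join G \<Longrightarrow> fst (u i) = 0 \<Longrightarrow> snd (u i) = \<one>"
  by (auto simp: milnor_join_def)

text \<open>Only preimages of the generating sets have to be open. The sets that test the i-th group
  coordinate lie where the i-th weight is nonzero; this locus is open by the continuity of the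
  weight, so continuity of the group coordinate on it is enough.\<close>

lemma continuous_map_into_EG:
  assumes "\<And>y. y \<in> topspace Y \<Longrightarrow> f y \<in> milnor_join G"
    and 1: "\<And>i. continuous_map Y euclideanreal (\<lambda>y. fst (f y i))"
    and 2: "\<And>i. continuous_map (subtopology Y {y \<in> topspace Y. fst (f y i) \<noteq> 0}) (gtop G) (\<lambda>y. snd (f y i))"
  shows "continuous_map Y (EG_topology G) f"
  unfolding EG_topology_def
proof (rule continuous_on_generated_topo)
  have supp: "openin Y {y \<in> topspace Y. fst (f y i) \<noteq> 0}" for i
    using openin_continuous_map_preimage[OF 1[of i], of "- {0}"] by (simp add: open_Compl)
  fix U assume "U \<in> {{u \<in> milnor_join G. fst (u i) \<in> A} | i A. open A} \<union>
      {{u \<in> milnor_join G. fst (u i) \<noteq> 0 \<and> snd (u i) \<in> W} | i W. openin (gtop G) W}"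
  then consider i A where "open A" "U = {u \<in> milnor_join G. fst (u i) \<in> A}"
    | i W where "openin (gtop G) W" "U = {u \<in> milnor_join G. fst (u i) \<noteq> 0 \<and> snd (u i) \<in> W}"
    by blast
  then show "openin Y (f -` U \<inter> topspace Y)"
  proof cases
    case 1
    then have "f -` U \<inter> topspace Y = {y \<in> topspace Y. fst (f y i) \<in> A}" using assms(1) by auto
    then show ?thesis using openin_continuous_map_preimage[OF assms(2)] 1 by simp
  next
    case 2
    let ?Y = "{y \<in> topspace Y. fst (f y i) \<noteq> 0}"
    have "f -` U \<inter> topspace Y = {y \<in> topspace (subtopology Y ?Y). snd (f y i) \<in> W}"
      using assms(1) 2 by auto
    moreover have "openin (subtopology Y ?Y) {y \<in> topspace (subtopology Y ?Y). snd (f y i) \<in> W}"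
      by (rule openin_continuous_map_preimage[OF assms(3)]) (use 2 in simp)
    ultimately have "openin (subtopology Y ?Y) (f -` U \<inter> topspace Y)" by simp
    then show ?thesis using openin_trans_full supp by blast
  qed
next
  have "f ` topspace Y \<subseteq> topspace (EG_topology G)" using assms(1) by auto
  then show "f ` topspace Y \<subseteq> \<Union>({{u \<in> milnor_join G. fst (u i) \<in> A} | i A. open A} \<union>
      {{u \<in> milnor_join G. fst (u i) \<noteq> 0 \<and> snd (u i) \<in> W} | i W. openin (gtop G) W})"
    by (simp only: EG_topology_def topology_generated_by_topspace)
qed

lemma continuous_map_EG_fst: "continuous_map (EG_topology G) euclideanreal (\<lambda>u. fst (u i))"
  unfolding continuous_map_def
proof (intro conjI allI impI)
  fix A :: "real set" assume "openin euclideanreal A"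
  then have "{u \<in> milnor_join G. fst (u i) \<in> A} \<in> {{u \<in> milnor_join G. fst (u i) \<in> A} | i A. open A}"
    by auto
  then show "openin (EG_topology G) {u \<in> topspace (EG_topology G). fst (u i) \<in> A}"
    unfolding topspace_EG unfolding EG_topology_def by (intro topology_generated_by_Basis) blast
qed simp

lemma openin_EG_support: "openin (EG_topology G) {u \<in> milnor_join G. fst (u i) \<noteq> 0}"
  using openin_continuous_map_preimage[OF continuous_map_EG_fst[of i], of "- {0}"]
  by (simp add: open_Compl)

lemma continuous_map_EG_snd:
  "continuous_map (subtopology (EG_topology G) {u \<in> milnor_join G. fst (u i) \<noteq> 0}) (gtop G) (\<lambda>u. snd (u i))"
  unfolding continuous_map_def
proof (intro conjI allI impI)
  let ?U = "{u \<in> milnor_join G. fst (u i) \<noteq> 0}"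
  fix W assume "openin (gtop G) W"
  then have "{u \<in> milnor_join G. fst (u i) \<noteq> 0 \<and> snd (u i) \<in> W} \<in>
      {{u \<in> milnor_join G. fst (u i) \<noteq> 0 \<and> snd (u i) \<in> W} | i W. openin (gtop G) W}"
    by blast
  then have "openin (EG_topology G) {u \<in> milnor_join G. fst (u i) \<noteq> 0 \<and> snd (u i) \<in> W}"
    unfolding EG_topology_def by (intro topology_generated_by_Basis) blast
  moreover have "{u \<in> topspace (subtopology (EG_topology G) ?U). snd (u i) \<in> W} =
      {u \<in> milnor_join G. fst (u i) \<noteq> 0 \<and> snd (u i) \<in> W}" by auto
  ultimately show "openin (subtopology (EG_topology G) ?U) {u \<in> topspace (subtopology (EG_topology G) ?U). snd (u i) \<in> W}"
    using openin_open_subtopology[OF openin_EG_support] by auto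
qed (auto simp: milnor_joinD)

lemma fst_EG_act [simp]: "fst (EG_act G u g i) = fst (u i)"
  by (simp add: EG_act_def)

lemma snd_EG_act: "fst (u i) \<noteq> 0 \<Longrightarrow> snd (EG_act G u g i) = snd (u i) \<otimes> g"
  by (simp add: EG_act_def)

lemma EG_act_closed: "u \<in> milnor_join G \<Longrightarrow> g \<in> carrier G \<Longrightarrow> EG_act G u g \<in> milnor_join G"
  by (auto simp: milnor_join_def EG_act_def)

lemma EG_act_one: "u \<in> milnor_join G \<Longrightarrow> EG_act G u \<one> = u"
  by (rule ext) (auto simp: EG_act_def milnor_joinD prod_eq_iff)

lemma EG_act_mult: "u \<in> milnor_join G \<Longrightarrow> g \<in> carrier G \<Longrightarrow> h \<in> carrier G \<Longrightarrow>
    EG_act G u (g \<otimes> h) = EG_act G (EG_act G u g) h"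
  by (rule ext) (auto simp: EG_act_def milnor_joinD m_assoc)

lemma EG_orbit_act:
  assumes "u \<in> milnor_join G" "g \<in> carrier G"
  shows "EG_orbit G (EG_act G u g) = EG_orbit G u"
proof -
  have 1: "EG_act G u h = EG_act G (EG_act G u g) (inv g \<otimes> h)" if "h \<in> carrier G" for h
    using EG_act_mult[OF assms(1), of g "inv g \<otimes> h"] assms that by (simp add: m_assoc[symmetric])
  have 2: "EG_act G (EG_act G u g) h = EG_act G u (g \<otimes> h)" if "h \<in> carrier G" for h
    using EG_act_mult[OF assms that] by simp
  show ?thesis
    unfolding EG_orbit_def
  proof (intro subset_antisym image_subsetI)
    fix h assume h: "h \<in> carrier G"
    then show "EG_act G (EG_act G u g) h \<in> EG_act G u ` carrier G"
      unfolding 2[OF h] using assms(2) by (intro imageI) simp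
    show "EG_act G u h \<in> EG_act G (EG_act G u g) ` carrier G"
      unfolding 1[OF h] using assms(2) h by (intro imageI) simp
  qed
qed

lemma EG_orbit_eqD:
  assumes "u \<in> milnor_join G" "v \<in> milnor_join G" "EG_orbit G u = EG_orbit G v"
  obtains g where "g \<in> carrier G" "v = EG_act G u g"
proof -
  have "v \<in> EG_orbit G v"
    using EG_act_one[OF assms(2)] one_closed unfolding EG_orbit_def by (metis imageI)
  then show thesis using assms(3) that unfolding EG_orbit_def by auto
qed

lemma continuous_map_EG_act:
  "continuous_map (prod_topology (EG_topology G) (gtop G)) (EG_topology G) (\<lambda>(u, g). EG_act G u g)"
proof (rule continuous_map_into_EG)
  let ?Y = "prod_topology (EG_topology G) (gtop G)"
  show "(case y of (u, g) \<Rightarrow> EG_act G u g) \<in> milnor_join G" if "y \<in> topspace ?Y" for y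
    using that by (auto intro: EG_act_closed)
  show "continuous_map ?Y euclideanreal (\<lambda>y. fst ((case y of (u, g) \<Rightarrow> EG_act G u g) i))" for i
    using continuous_map_comp[OF continuous_map_fst continuous_map_EG_fst] by (simp add: case_prod_unfold)
  fix i
  let ?W = "{y \<in> topspace ?Y. fst ((case y of (u, g) \<Rightarrow> EG_act G u g) i) \<noteq> 0}"
  have "continuous_map (subtopology ?Y ?W) (gtop G) (\<lambda>y. snd (fst y i))"
    by (rule continuous_map_comp_subtopology[OF continuous_map_from_subtopology[OF continuous_map_fst] _
          continuous_map_EG_snd]) auto
  from continuous_map_mult[OF this continuous_map_from_subtopology[OF continuous_map_snd]]
  show "continuous_map (subtopology ?Y ?W) (gtop G) (\<lambda>y. snd ((case y of (u, g) \<Rightarrow> EG_act G u g) i))"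
    by (rule continuous_map_eq) (auto simp: snd_EG_act)
qed

lemma universal_bundle_simps [simp]:
  "total (universal_bundle G) = EG_topology G" "proj (universal_bundle G) = EG_orbit G"
  "ract (universal_bundle G) = EG_act G"
  by (auto simp: universal_bundle_def)

lemma quotient_map_EG_orbit: "quotient_map (EG_topology G) (classifying_space G) (EG_orbit G)"
  by (simp add: classifying_space_def quotient_map_quotient_topology)

text \<open>Where the k-th weight is nonzero, every orbit has exactly one point whose k-th group
  coordinate is 1. This point is the local section, and the k-th group coordinate is the fibre
  coordinate. These open sets cover because the weights sum to 1.\<close>

lemma principal_universal_bundle: "principal_bundle G (classifying_space G) (universal_bundle G)"
proof (rule principal_bundleI)
  fix x assume "x \<in> topspace (classifying_space G)"
  then obtain v where v: "v \<in> milnor_join G" "x = EG_orbit G v"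
    by (auto simp: classifying_space_def)
  have "\<exists>k. fst (v k) \<noteq> 0"
  proof (rule ccontr)
    assume "\<nexists>k. fst (v k) \<noteq> 0"
    then show False using v(1) by (simp add: milnor_join_def)
  qed
  then obtain k where k: "fst (v k) \<noteq> 0" ..
  let ?S = "{u \<in> milnor_join G. fst (u k) \<noteq> 0}"
  define U where "U = EG_orbit G ` ?S"
  \<comment> \<open>Weights are invariant under the action, so \<open>?S\<close> is a union of
    orbits and its image in the quotient is open.\<close>
  have mem_U: "EG_orbit G u \<in> U \<longleftrightarrow> fst (u k) \<noteq> 0" if u: "u \<in> milnor_join G" for u
  proof
    assume "EG_orbit G u \<in> U"
    then obtain w where w: "w \<in> ?S" "EG_orbit G w = EG_orbit G u" by (auto simp: U_def)
    then obtain g where "u = EG_act G w g" using EG_orbit_eqD u by blast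
    then show "fst (u k) \<noteq> 0" using w by simp
  qed (use u in \<open>auto simp: U_def\<close>)
  have pre: "{u \<in> topspace (EG_topology G). EG_orbit G u \<in> U} = ?S"
    using mem_U by auto
  have oU: "openin (classifying_space G) U"
    unfolding classifying_space_def openin_quotient_topology pre
    using openin_EG_support by (auto simp: U_def)
  \<comment> \<open>An arbitrary representative of the orbit is renormalised by the inverse of its
    k-th coordinate; the next fact shows that the choice cancels, which makes continuity through the
    quotient map accessible.\<close>
  define s where "s y = (let w = SOME w. w \<in> ?S \<and> EG_orbit G w = y in EG_act G w (inv (snd (w k))))" for y
  have s: "s (EG_orbit G u) = EG_act G u (inv (snd (u k)))" if u: "u \<in> ?S" for u
  proof -
    define w where "w = (SOME w. w \<in> ?S \<and> EG_orbit G w = EG_orbit G u)"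
    have "w \<in> ?S \<and> EG_orbit G w = EG_orbit G u" unfolding w_def by (rule someI[of _ u]) (use u in auto)
    then have w: "w \<in> ?S" "EG_orbit G u = EG_orbit G w" by auto
    obtain g where g: "g \<in> carrier G" "w = EG_act G u g" using EG_orbit_eqD u w by blast
    have uk: "snd (u k) \<in> carrier G" using u by (auto simp: milnor_joinD)
    have "snd (w k) = snd (u k) \<otimes> g" using g u by (simp add: snd_EG_act)
    then have "s (EG_orbit G u) = EG_act G (EG_act G u g) (inv (snd (u k) \<otimes> g))"
      unfolding s_def Let_def w_def[symmetric] using g by simp
    also have "\<dots> = EG_act G u (g \<otimes> inv (snd (u k) \<otimes> g))"
      using u g uk by (intro EG_act_mult[symmetric]) auto
    also have "g \<otimes> inv (snd (u k) \<otimes> g) = inv (snd (u k))"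
      using g uk by (simp add: inv_mult_group m_assoc[symmetric])
    finally show ?thesis .
  qed
  have cs: "continuous_map (subtopology (classifying_space G) U) (EG_topology G) s"
  proof (rule continuous_compose_quotient_map)
    show "quotient_map (subtopology (EG_topology G) ?S) (subtopology (classifying_space G) U) (EG_orbit G)"
      by (rule quotient_map_restriction[OF quotient_map_EG_orbit pre]) (use oU in blast)
    have "continuous_map (subtopology (EG_topology G) ?S) (prod_topology (EG_topology G) (gtop G))
        (\<lambda>u. (u, inv (snd (u k))))"
      by (intro continuous_map_pairedI continuous_map_from_subtopology continuous_map_inv continuous_map_EG_snd) simp
    from continuous_map_comp[OF this continuous_map_EG_act]
    show "continuous_map (subtopology (EG_topology G) ?S) (EG_topology G) (s \<circ> EG_orbit G)"
      by (rule continuous_map_eq) (auto simp: s)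
  qed
  have "local_triv G (classifying_space G) (universal_bundle G) U s (\<lambda>u. snd (u k))"
    unfolding local_triv_def universal_bundle_simps pre
  proof (intro conjI ballI impI)
    show "continuous_map (subtopology (EG_topology G) ?S) (gtop G) (\<lambda>u. snd (u k))"
      by (rule continuous_map_EG_snd)
    show "EG_orbit G (s y) = y" "snd (s y k) = \<one>" if "y \<in> U" for y
      using that by (auto simp: U_def s EG_orbit_act milnor_joinD snd_EG_act)
    fix u assume "u \<in> topspace (EG_topology G)" "EG_orbit G u \<in> U"
    then have u: "u \<in> ?S" using mem_U by auto
    then show "EG_act G (s (EG_orbit G u)) (snd (u k)) = u"
      by (simp add: s EG_act_mult[symmetric] EG_act_one milnor_joinD)
    show "EG_orbit G (EG_act G u g) = EG_orbit G u" "snd (EG_act G u g k) = snd (u k) \<otimes> g"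
      if "g \<in> carrier G" for g
      using u that by (auto simp: EG_orbit_act snd_EG_act)
  qed (use oU cs in auto)
  then show "\<exists>U s \<kappa>. x \<in> U \<and> local_triv G (classifying_space G) (universal_bundle G) U s \<kappa>"
    using mem_U v k by blast
next
  show "continuous_map (total (universal_bundle G)) (classifying_space G) (proj (universal_bundle G))"
    using quotient_map_EG_orbit quotient_imp_continuous_map by auto
qed (use continuous_map_EG_act in \<open>auto simp: topological_group EG_act_one EG_act_mult\<close>)

end

section \<open>Pullbacks and bundle maps\<close>

lemma pullback_bundle_simps [simp]:
  "total (pullback_bundle X f \<zeta>) = subtopology (prod_topology X (total \<zeta>)) {(x, e). f x = proj \<zeta> e}"
  "proj (pullback_bundle X f \<zeta>) = fst"
  "ract (pullback_bundle X f \<zeta>) (x, e) g = (x, ract \<zeta> e g)"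
  by (auto simp: pullback_bundle_def)

text \<open>A trivialization over \<open>U\<close> pulls back to the preimage of \<open>U\<close>:
  the section is \<open>s\<close> after \<open>f\<close>, and \<open>\<kappa>\<close> is read on the
  second component.\<close>

lemma principal_pullback_bundle:
  assumes \<zeta>: "principal_bundle G B \<zeta>" and f: "continuous_map X B f"
  shows "principal_bundle G X (pullback_bundle X f \<zeta>)"
proof -
  interpret principal G B \<zeta> by (rule principal.intro) fact
  let ?P = "pullback_bundle X f \<zeta>"
  let ?T = "prod_topology X (total \<zeta>)"
  let ?D = "{(x, e). f x = proj \<zeta> e}"
  show ?thesis
  proof (rule principal_bundleI)
    show "topological_group G" by (rule topological_group)
    show "continuous_map (total ?P) X (proj ?P)"
      by (simp add: continuous_map_from_subtopology continuous_map_fst)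
    show "continuous_map (prod_topology (total ?P) (gtop G)) (total ?P) (\<lambda>(e, g). ract ?P e g)"
    proof -
      let ?Y = "prod_topology (subtopology ?T ?D) (gtop G)"
      have a: "continuous_map ?Y ?T fst"
        using continuous_map_fst[of "subtopology ?T ?D" "gtop G"] continuous_map_in_subtopology by blast
      have "continuous_map ?Y ?T (\<lambda>y. (fst (fst y), ract \<zeta> (snd (fst y)) (snd y)))"
        by (intro continuous_map_pairedI continuous_map_ract continuous_map_snd
            continuous_map_comp[OF a continuous_map_fst] continuous_map_comp[OF a continuous_map_snd])
      then have "continuous_map ?Y (subtopology ?T ?D) (\<lambda>y. (fst (fst y), ract \<zeta> (snd (fst y)) (snd y)))"
        by (auto simp: continuous_map_in_subtopology proj_ract)
      then show ?thesis
        unfolding pullback_bundle_simps(1) by (rule continuous_map_eq) auto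
    qed
    show "ract ?P e \<one>\<^bsub>G\<^esub> = e" if "e \<in> topspace (total ?P)" for e
      using that by (cases e) (simp add: ract_one)
    show "ract ?P e (g \<otimes>\<^bsub>G\<^esub> h) = ract ?P (ract ?P e g) h"
      if "e \<in> topspace (total ?P)" "g \<in> carrier G" "h \<in> carrier G" for e g h
      using that by (cases e) (simp add: ract_mult)
  next
    fix x assume x: "x \<in> topspace X"
    have fx: "f y \<in> topspace B" if "y \<in> topspace X" for y
      using continuous_map_image_subset_topspace[OF f] that by auto
    obtain U s \<kappa> where U: "f x \<in> U" "local_triv G B \<zeta> U s \<kappa>"
      using local_triv_exists[OF fx[OF x]] .
    have oU: "openin B U" and s: "continuous_map (subtopology B U) (total \<zeta>) s"
      and \<kappa>: "continuous_map (subtopology (total \<zeta>) {e \<in> E. proj \<zeta> e \<in> U}) (gtop G) \<kappa>"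
      and s': "\<And>y. y \<in> U \<Longrightarrow> proj \<zeta> (s y) = y \<and> \<kappa> (s y) = \<one>\<^bsub>G\<^esub>"
      and \<kappa>': "\<And>e. e \<in> E \<Longrightarrow> proj \<zeta> e \<in> U \<Longrightarrow> ract \<zeta> (s (proj \<zeta> e)) (\<kappa> e) = e"
        "\<And>e g. e \<in> E \<Longrightarrow> proj \<zeta> e \<in> U \<Longrightarrow> g \<in> carrier G \<Longrightarrow> \<kappa> (ract \<zeta> e g) = \<kappa> e \<otimes>\<^bsub>G\<^esub> g"
      using U(2) by (auto simp: local_triv_def)
    let ?V = "{y \<in> topspace X. f y \<in> U}"
    have oV: "openin X ?V" using openin_continuous_map_preimage[OF f oU] .
    have "local_triv G X ?P ?V (\<lambda>y. (y, s (f y))) (\<lambda>e. \<kappa> (snd e))"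
      unfolding local_triv_def
    proof (intro conjI ballI impI)
      show "openin X ?V" by fact
      have "continuous_map (subtopology X ?V) (total \<zeta>) (\<lambda>y. s (f y))"
        by (rule continuous_map_comp_subtopology[OF continuous_map_from_subtopology[OF f] _ s]) auto
      then have "continuous_map (subtopology X ?V) ?T (\<lambda>y. (y, s (f y)))"
        by (intro continuous_map_pairedI) (simp add: continuous_map_from_subtopology)
      then show "continuous_map (subtopology X ?V) (total ?P) (\<lambda>y. (y, s (f y)))"
        using s' by (auto simp: continuous_map_in_subtopology)
      have "continuous_map (total ?P) (total \<zeta>) snd"
        by (simp add: continuous_map_from_subtopology continuous_map_snd)
      then show "continuous_map (subtopology (total ?P) {e \<in> topspace (total ?P). proj ?P e \<in> ?V}) (gtop G) (\<lambda>e. \<kappa> (snd e))"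
        by (intro continuous_map_comp_subtopology[OF continuous_map_from_subtopology _ \<kappa>]) auto
      show "proj ?P (y, s (f y)) = y" "\<kappa> (snd (y, s (f y))) = \<one>\<^bsub>G\<^esub>" if "y \<in> ?V" for y
        using that s' by auto
      fix e assume e: "e \<in> topspace (total ?P)" "proj ?P e \<in> ?V"
      then obtain y u where yu: "e = (y, u)" "y \<in> topspace X" "u \<in> E" "f y = proj \<zeta> u" "f y \<in> U"
        by auto
      show "ract ?P (proj ?P e, s (f (proj ?P e))) (\<kappa> (snd e)) = e"
        using yu \<kappa>'(1)[of u] by simp
      show "proj ?P (ract ?P e g) = proj ?P e" "\<kappa> (snd (ract ?P e g)) = \<kappa> (snd e) \<otimes>\<^bsub>G\<^esub> g"
        if "g \<in> carrier G" for g
        using yu \<kappa>'(2)[of u] that by auto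
    qed
    moreover have "x \<in> ?V" using x U(1) by simp
    ultimately show "\<exists>U s \<kappa>. x \<in> U \<and> local_triv G X ?P U s \<kappa>" by (intro exI conjI)
  qed
qed

lemma bundle_map_cong:
  assumes "principal_bundle G X \<xi>" "bundle_map G \<xi> \<zeta> f h" "\<And>x. x \<in> topspace X \<Longrightarrow> f x = f' x"
  shows "bundle_map G \<xi> \<zeta> f' h"
  using assms(2,3) principal.proj_closed[OF principal.intro[OF assms(1)]]
  by (auto simp: bundle_map_def)

lemma bundle_map_compose:
  assumes "bundle_map G \<xi> \<eta> (\<lambda>x. x) h" "bundle_map G \<eta> \<zeta> f k"
  shows "bundle_map G \<xi> \<zeta> f (\<lambda>e. k (h e))"
  using assms continuous_map_comp[of "total \<xi>" "total \<eta>" h "total \<zeta>" k] bundle_map_closed[OF assms(1)]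
  by (auto simp: bundle_map_def)

text \<open>Equivariance forces fibres into fibres because G is transitive on them, so the base map
  comes for free. Locally it is the projection of \<open>h\<close> along a section, hence
  continuous.\<close>

lemma bundle_map_covers_continuous:
  assumes "principal_bundle G X \<xi>" "principal_bundle G B \<zeta>"
    and h: "continuous_map (total \<xi>) (total \<zeta>) h"
    and hg: "\<And>e g. e \<in> topspace (total \<xi>) \<Longrightarrow> g \<in> carrier G \<Longrightarrow> h (ract \<xi> e g) = ract \<zeta> (h e) g"
  obtains f where "continuous_map X B f" "bundle_map G \<xi> \<zeta> f h"
proof -
  interpret P: principal G X \<xi> by (rule principal.intro) fact
  interpret Q: principal G B \<zeta> by (rule principal.intro) fact
  have hE: "h e \<in> Q.E" if "e \<in> P.E" for e
    using continuous_map_image_subset_topspace[OF h] that by auto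
  define f where "f x = proj \<zeta> (h (SOME e. e \<in> P.E \<and> proj \<xi> e = x))" for x
  have f: "proj \<zeta> (h e) = f (proj \<xi> e)" if e: "e \<in> P.E" for e
  proof -
    define a where "a = (SOME a. a \<in> P.E \<and> proj \<xi> a = proj \<xi> e)"
    have a: "a \<in> P.E \<and> proj \<xi> a = proj \<xi> e" unfolding a_def by (rule someI[of _ e]) (use e in simp)
    then obtain g where "g \<in> carrier G" "ract \<xi> a g = e"
      using P.translation[of a e] e by blast
    then have "h e = ract \<zeta> (h a) g" "g \<in> carrier G" using hg a by auto
    then have "proj \<zeta> (h e) = proj \<zeta> (h a)" using Q.proj_ract hE a by simp
    then show ?thesis by (simp add: f_def a_def)
  qed
  have "continuous_map X B f"
  proof (rule continuous_map_locally_eq)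
    fix x assume "x \<in> topspace X"
    then obtain U s \<kappa> where U: "x \<in> U" "local_triv G X \<xi> U s \<kappa>"
      using P.local_triv_exists by blast
    have "continuous_map (subtopology X U) (total \<xi>) s" and o: "openin X U"
      and s: "\<And>y. y \<in> U \<Longrightarrow> proj \<xi> (s y) = y"
      using U by (auto simp: local_triv_def)
    then have "continuous_map (subtopology X U) B (\<lambda>y. proj \<zeta> (h (s y)))"
      by (intro continuous_map_comp[OF _ Q.continuous_map_proj] continuous_map_comp[OF _ h])
    moreover have "\<forall>y\<in>U. f y = proj \<zeta> (h (s y))"
      using f[OF local_triv_closed(1)[OF U(2)]] s by simp
    ultimately show "\<exists>U g. openin X U \<and> x \<in> U \<and> continuous_map (subtopology X U) B g \<and> (\<forall>z\<in>U. f z = g z)"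
      using o U(1) by blast
  qed
  moreover have "bundle_map G \<xi> \<zeta> f h" using h hg f by (simp add: bundle_map_def)
  ultimately show thesis by (rule that)
qed

text \<open>Pairing \<open>h\<close> with the projection gives a bundle map over the identity, and
  such a map is an isomorphism. Thus isomorphisms with a pullback and bundle maps over
  \<open>f\<close> carry the same information.\<close>

lemma bundle_map_imp_pullback_iso:
  assumes "principal_bundle G X \<xi>" "principal_bundle G B \<zeta>" "continuous_map X B f" "bundle_map G \<xi> \<zeta> f h"
  shows "principal_bundle_iso G \<xi> (pullback_bundle X f \<zeta>) (\<lambda>e. (proj \<xi> e, h e))"
proof (rule bundle_map_imp_iso[OF assms(1) principal_pullback_bundle[OF assms(2,3)]])
  interpret P: principal G X \<xi> by (rule principal.intro) fact
  have "continuous_map (total \<xi>) (prod_topology X (total \<zeta>)) (\<lambda>e. (proj \<xi> e, h e))"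
    by (rule continuous_map_pairedI[OF P.continuous_map_proj]) (use assms(4) in \<open>simp add: bundle_map_def\<close>)
  then show "bundle_map G \<xi> (pullback_bundle X f \<zeta>) (\<lambda>x. x) (\<lambda>e. (proj \<xi> e, h e))"
    using assms(4) by (auto simp: bundle_map_def continuous_map_in_subtopology P.proj_ract)
qed

lemma pullback_iso_imp_bundle_map:
  assumes "principal_bundle_iso G \<xi> (pullback_bundle X f \<zeta>) F"
  shows "bundle_map G \<xi> \<zeta> f (\<lambda>e. snd (F e))"
proof -
  let ?T = "subtopology (prod_topology X (total \<zeta>)) {(x, e). f x = proj \<zeta> e}"
  have F: "continuous_map (total \<xi>) ?T F"
    and Fp: "\<And>e. e \<in> topspace (total \<xi>) \<Longrightarrow> fst (F e) = proj \<xi> e"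
    and Fg: "\<And>e g. e \<in> topspace (total \<xi>) \<Longrightarrow> g \<in> carrier G \<Longrightarrow> F (ract \<xi> e g) = ract (pullback_bundle X f \<zeta>) (F e) g"
    using assms by (auto simp: principal_bundle_iso_def homeomorphic_imp_continuous_map)
  have "continuous_map (total \<xi>) (total \<zeta>) (\<lambda>e. snd (F e))"
    by (rule continuous_map_comp[OF F]) (simp add: continuous_map_from_subtopology continuous_map_snd)
  moreover have "f (proj \<xi> e) = proj \<zeta> (snd (F e))" if "e \<in> topspace (total \<xi>)" for e
    using continuous_map_image_subset_topspace[OF F] Fp[OF that] that by (auto simp: image_subset_iff split: prod.splits)
  moreover have "snd (F (ract \<xi> e g)) = ract \<zeta> (snd (F e)) g" if "e \<in> topspace (total \<xi>)" "g \<in> carrier G" for e g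
    using Fg[OF that] by (cases "F e") simp
  ultimately show ?thesis by (simp add: bundle_map_def)
qed

lemma principal_bundle_iso_inverse:
  assumes "principal_bundle G X \<xi>" "principal_bundle G X \<zeta>" "principal_bundle_iso G \<xi> \<zeta> F"
  obtains F' where "bundle_map G \<zeta> \<xi> (\<lambda>x. x) F'"
proof -
  interpret P: principal G X \<xi> by (rule principal.intro) fact
  interpret Q: principal G X \<zeta> by (rule principal.intro) fact
  obtain F' where "homeomorphic_maps (total \<xi>) (total \<zeta>) F F'"
    using assms(3) by (auto simp: principal_bundle_iso_def homeomorphic_map_maps)
  then have c: "continuous_map (total \<zeta>) (total \<xi>) F'"
    and F'F: "\<And>e. e \<in> P.E \<Longrightarrow> F' (F e) = e" and FF': "\<And>e. e \<in> Q.E \<Longrightarrow> F (F' e) = e"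
    by (auto simp: homeomorphic_maps_def)
  have F'E: "F' e \<in> P.E" if "e \<in> Q.E" for e
    using continuous_map_image_subset_topspace[OF c] that by auto
  have Fp: "proj \<zeta> (F e) = proj \<xi> e" and Fg: "\<And>g. g \<in> carrier G \<Longrightarrow> F (ract \<xi> e g) = ract \<zeta> (F e) g"
    if "e \<in> P.E" for e
    using assms(3) that by (auto simp: principal_bundle_iso_def)
  have "proj \<xi> (F' e) = proj \<zeta> e" if "e \<in> Q.E" for e
    using Fp[OF F'E[OF that]] FF' that by simp
  moreover have "F' (ract \<zeta> e g) = ract \<xi> (F' e) g" if "e \<in> Q.E" "g \<in> carrier G" for e g
    using Fg[OF F'E[OF that(1)] that(2)] FF' F'F[OF P.ract_closed[OF F'E[OF that(1)] that(2)]] that by simp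
  ultimately have "bundle_map G \<zeta> \<xi> (\<lambda>x. x) F'" using c by (simp add: bundle_map_def)
  then show thesis by (rule that)
qed

section \<open>Covering homotopies and classifying maps\<close>

text \<open>Over \<open>N\<close> both base maps stay in one trivializing set, so the fibre
  coordinate of \<open>h\<close> can be kept while the base point is moved from \<open>f x\<close>
  to \<open>f' x\<close>. Off \<open>K\<close> nothing moves and the result is \<open>h\<close>
  itself; the open sets \<open>N\<close> and the complement of \<open>K\<close> cover the base, so
  the two definitions glue.\<close>

lemma bundle_map_step:
  assumes "principal_bundle G X \<xi>" "principal_bundle G B \<zeta>"
    and h: "bundle_map G \<xi> \<zeta> f h" and f': "continuous_map X B f'"
    and N: "openin X N" and K: "closedin X K" and "K \<subseteq> N"
    and eq: "\<And>x. x \<in> topspace X - K \<Longrightarrow> f' x = f x"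
    and U: "local_triv G B \<zeta> U s \<kappa>" and fU: "\<And>x. x \<in> N \<Longrightarrow> f x \<in> U \<and> f' x \<in> U"
  obtains h' where "bundle_map G \<xi> \<zeta> f' h'"
proof -
  interpret P: principal G X \<xi> by (rule principal.intro) fact
  interpret Q: principal G B \<zeta> by (rule principal.intro) fact
  have ch: "continuous_map (total \<xi>) (total \<zeta>) h"
    and hp: "\<And>e. e \<in> P.E \<Longrightarrow> proj \<zeta> (h e) = f (proj \<xi> e)"
    and hg: "\<And>e g. e \<in> P.E \<Longrightarrow> g \<in> carrier G \<Longrightarrow> h (ract \<xi> e g) = ract \<zeta> (h e) g"
    using h by (auto simp: bundle_map_def)
  have hE: "h e \<in> Q.E" if "e \<in> P.E" for e using bundle_map_closed[OF h that] .
  have s: "continuous_map (subtopology B U) (total \<zeta>) s"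
    and \<kappa>: "continuous_map (subtopology (total \<zeta>) {e \<in> Q.E. proj \<zeta> e \<in> U}) (gtop G) \<kappa>"
    and s': "\<And>y. y \<in> U \<Longrightarrow> proj \<zeta> (s y) = y"
    and \<kappa>': "\<And>e. e \<in> Q.E \<Longrightarrow> proj \<zeta> e \<in> U \<Longrightarrow> ract \<zeta> (s (proj \<zeta> e)) (\<kappa> e) = e"
      "\<And>e g. e \<in> Q.E \<Longrightarrow> proj \<zeta> e \<in> U \<Longrightarrow> g \<in> carrier G \<Longrightarrow> \<kappa> (ract \<zeta> e g) = \<kappa> e \<otimes>\<^bsub>G\<^esub> g"
    using U by (auto simp: local_triv_def)
  have sE: "s y \<in> Q.E" if "y \<in> U" for y using local_triv_closed(1)[OF U that] .
  have kG: "\<kappa> (h e) \<in> carrier G" if "e \<in> P.E" "proj \<xi> e \<in> N" for e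
    using local_triv_closed(2)[OF U P.topological_group hE] that fU hp by simp
  define a where "a e = ract \<zeta> (s (f' (proj \<xi> e))) (\<kappa> (h e))" for e
  define h' where "h' e = (if proj \<xi> e \<in> N then a e else h e)" for e
  \<comment> \<open>On the overlap \<open>f'\<close> agrees with \<open>f\<close>, and reassembling
    a point from its own base point and fibre coordinate returns it.\<close>
  have h'h: "h' e = h e" if "e \<in> P.E" "proj \<xi> e \<notin> K" for e
  proof (cases "proj \<xi> e \<in> N")
    case True
    then have "f' (proj \<xi> e) = proj \<zeta> (h e)" "f (proj \<xi> e) \<in> U"
      using that eq P.proj_closed hp fU by auto
    then have "a e = h e" using \<kappa>'(1)[OF hE] hp that by (simp add: a_def)
    then show ?thesis using True by (simp add: h'_def)
  qed (simp add: h'_def)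
  let ?W = "{e \<in> P.E. proj \<xi> e \<in> N}" and ?W' = "{e \<in> P.E. proj \<xi> e \<in> topspace X - K}"
  have W: "openin (total \<xi>) ?W" "openin (total \<xi>) ?W'"
    using openin_continuous_map_preimage[OF P.continuous_map_proj] N K by blast+
  have "continuous_map (total \<xi>) (total \<zeta>) h'"
  proof (rule continuous_map_locally_eq)
    fix e assume e: "e \<in> P.E"
    show "\<exists>U g. openin (total \<xi>) U \<and> e \<in> U \<and> continuous_map (subtopology (total \<xi>) U) (total \<zeta>) g \<and> (\<forall>z\<in>U. h' z = g z)"
    proof (cases "proj \<xi> e \<in> N")
      case True
      have "continuous_map (subtopology (total \<xi>) ?W) B (\<lambda>e. f' (proj \<xi> e))"
        by (intro continuous_map_from_subtopology continuous_map_comp[OF P.continuous_map_proj f'])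
      then have 1: "continuous_map (subtopology (total \<xi>) ?W) (total \<zeta>) (\<lambda>e. s (f' (proj \<xi> e)))"
        by (rule continuous_map_comp_subtopology[OF _ _ s]) (use fU in auto)
      have 2: "continuous_map (subtopology (total \<xi>) ?W) (gtop G) (\<lambda>e. \<kappa> (h e))"
        by (rule continuous_map_comp_subtopology[OF continuous_map_from_subtopology[OF ch] _ \<kappa>])
           (use fU hE hp in auto)
      have "continuous_map (subtopology (total \<xi>) ?W) (total \<zeta>) a"
        unfolding a_def by (rule Q.continuous_map_ract[OF 1 2])
      moreover have "\<forall>z\<in>?W. h' z = a z" by (simp add: h'_def)
      ultimately show ?thesis using W(1) e True by blast
    next
      case False
      then have "e \<in> ?W'" using e \<open>K \<subseteq> N\<close> P.proj_closed by auto
      moreover have "\<forall>z\<in>?W'. h' z = h z" using h'h by auto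
      ultimately show ?thesis using W(2) continuous_map_from_subtopology[OF ch] by blast
    qed
  qed
  moreover have "proj \<zeta> (h' e) = f' (proj \<xi> e)" if e: "e \<in> P.E" for e
  proof (cases "proj \<xi> e \<in> N")
    case True
    then show ?thesis using Q.proj_ract[OF sE kG[OF e True]] fU s' by (simp add: h'_def a_def)
  next
    case False
    then have "proj \<xi> e \<in> topspace X - K" using \<open>K \<subseteq> N\<close> P.proj_closed[OF e] by blast
    then show ?thesis using False eq hp[OF e] by (simp add: h'_def)
  qed
  moreover have "h' (ract \<xi> e g) = ract \<zeta> (h' e) g" if e: "e \<in> P.E" and g: "g \<in> carrier G" for e g
  proof (cases "proj \<xi> e \<in> N")
    case True
    have "\<kappa> (h (ract \<xi> e g)) = \<kappa> (h e) \<otimes>\<^bsub>G\<^esub> g"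
      using \<kappa>'(2)[OF hE[OF e] _ g] hg[OF e g] hp[OF e] fU True by simp
    then show ?thesis
      using Q.ract_mult[OF sE kG[OF e True] g] True P.proj_ract[OF e g] fU by (simp add: h'_def a_def)
  next
    case False
    then show ?thesis using P.proj_ract[OF e g] hg[OF e g] by (simp add: h'_def)
  qed
  ultimately have "bundle_map G \<xi> \<zeta> f' h'" by (simp add: bundle_map_def)
  then show thesis by (rule that)
qed

section \<open>Partitions of unity and Lebesgue numbers on a compact base\<close>

text \<open>Tent functions around the centres of a finite cover, divided by their sum. The indexing
  by natural numbers matters: the covering homotopy uses partial sums, and the join has coordinates
  numbered by \<open>nat\<close>.\<close>

lemma compact_partition_of_unity:
  fixes S :: "'a::metric_space set"
  assumes "compact S" "e > 0"
  obtains m :: nat and c :: "nat \<Rightarrow> 'a" and l :: "nat \<Rightarrow> 'a \<Rightarrow> real"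
  where "\<And>i. i < m \<Longrightarrow> c i \<in> S" "\<And>i. continuous_on S (l i)" "\<And>i y. 0 \<le> l i y"
    "\<And>i y. l i y \<noteq> 0 \<Longrightarrow> dist (c i) y < e" "\<And>y. y \<in> S \<Longrightarrow> (\<Sum>i<m. l i y) = 1"
proof -
  have "S \<subseteq> (\<Union>x\<in>S. ball x e)" using assms(2) by force
  then obtain C where C: "C \<subseteq> S" "finite C" "S \<subseteq> (\<Union>x\<in>C. ball x e)"
    using compactE_image[OF assms(1), of S "\<lambda>x. ball x e"] by blast
  obtain c where c: "bij_betw c {0..<card C} C" using ex_bij_betw_nat_finite[OF C(2)] by blast
  define m where "m = card C"
  define b where "b i y = max 0 (e - dist (c i) y)" for i y
  define B where "B y = (\<Sum>i<m. b i y)" for y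
  have Bpos: "B y > 0" if "y \<in> S" for y
  proof -
    obtain x where "x \<in> C" "dist x y < e" using C(3) \<open>y \<in> S\<close> by auto
    then obtain i where "i < m" "dist (c i) y < e"
      using c unfolding m_def bij_betw_def by (metis atLeastLessThan_iff imageE)
    then show ?thesis unfolding B_def
      by (intro sum_pos2[of _ i]) (auto simp: b_def)
  qed
  show thesis
  proof (rule that[of m c "\<lambda>i y. b i y / B y"])
    show "c i \<in> S" if "i < m" for i
      using that c C(1) unfolding m_def bij_betw_def by auto
    show "continuous_on S (\<lambda>y. b i y / B y)" for i
      unfolding b_def B_def by (intro continuous_intros) (use Bpos in \<open>force simp: B_def b_def\<close>)
    show "0 \<le> b i y / B y" for i y by (auto simp: b_def B_def intro!: divide_nonneg_nonneg sum_nonneg)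
    show "dist (c i) y < e" if "b i y / B y \<noteq> 0" for i y
      using that by (auto simp: b_def max_def split: if_splits)
    show "(\<Sum>i<m. b i y / B y) = 1" if "y \<in> S" for y
      using Bpos[OF that] by (simp add: sum_divide_distrib[symmetric] B_def)
  qed
qed

text \<open>A Lebesgue number for the cover of \<open>K\<close> by preimages of trivializing
  sets.\<close>

lemma lebesgue_local_triv:
  fixes K :: "'k::metric_space set"
  assumes "principal_bundle G B \<zeta>" "compact K" and f: "continuous_map (top_of_set K) B f"
  obtains e where "e > 0"
    "\<And>z. z \<in> K \<Longrightarrow> \<exists>U s \<kappa>. local_triv G B \<zeta> U s \<kappa> \<and> (\<forall>z'\<in>K. dist z z' < e \<longrightarrow> f z' \<in> U)"
proof -
  interpret principal G B \<zeta> by (rule principal.intro) fact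
  have "\<exists>T. open T \<and> z \<in> T \<and> (\<exists>U s \<kappa>. local_triv G B \<zeta> U s \<kappa> \<and> (\<forall>z'\<in>K \<inter> T. f z' \<in> U))" if z: "z \<in> K" for z
  proof -
    have "f z \<in> topspace B" using continuous_map_image_subset_topspace[OF f] z by auto
    then obtain U s \<kappa> where U: "f z \<in> U" "local_triv G B \<zeta> U s \<kappa>" by (rule local_triv_exists)
    then have "openin (top_of_set K) {y \<in> topspace (top_of_set K). f y \<in> U}"
      by (intro openin_continuous_map_preimage[OF f]) (simp add: local_triv_def)
    then obtain T where T: "open T" "{y \<in> K. f y \<in> U} = K \<inter> T"
      by (auto simp: openin_open)
    moreover have "z \<in> T" using T z U by blast
    ultimately show ?thesis using U(2) by blast
  qed
  then obtain T where T: "\<And>z. z \<in> K \<Longrightarrow> open (T z) \<and> z \<in> T z \<and> (\<exists>U s \<kappa>. local_triv G B \<zeta> U s \<kappa> \<and> (\<forall>z'\<in>K \<inter> T z. f z' \<in> U))"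
    by metis
  obtain e where e: "e > 0" "\<And>z. z \<in> K \<Longrightarrow> \<exists>V\<in>T ` K. ball z e \<subseteq> V"
    by (rule Heine_Borel_lemma[OF assms(2), of "T ` K"]) (use T in auto)
  show thesis
  proof (rule that[OF e(1)])
    fix z assume "z \<in> K"
    then obtain y where y: "y \<in> K" "ball z e \<subseteq> T y" using e(2) by blast
    then obtain U s \<kappa> where "local_triv G B \<zeta> U s \<kappa>" "\<forall>z'\<in>K \<inter> T y. f z' \<in> U"
      using T by blast
    then show "\<exists>U s \<kappa>. local_triv G B \<zeta> U s \<kappa> \<and> (\<forall>z'\<in>K. dist z z' < e \<longrightarrow> f z' \<in> U)"
      using y(2) by (intro exI[of _ U] exI[of _ s] exI[of _ \<kappa>]) auto
  qed
qed

text \<open>The homotopy parameter is raised from \<open>0\<close> to \<open>1\<close> along a chain of functions of the base point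
  in which neighbours differ only inside a small ball, where a local trivialization carries the map along.\<close>

lemma covering_homotopy:
  fixes S :: "'a::metric_space set"
  assumes \<xi>: "principal_bundle G (top_of_set S) \<xi>" and \<zeta>: "principal_bundle G B \<zeta>" and S: "compact S"
    and H: "continuous_map (prod_topology (top_of_set {0..1::real}) (top_of_set S)) B H"
    and h0: "bundle_map G \<xi> \<zeta> (\<lambda>x. H (0, x)) h0"
  obtains h1 where "bundle_map G \<xi> \<zeta> (\<lambda>x. H (1, x)) h1"
proof -
  let ?K = "{0..1::real} \<times> S"
  have H': "continuous_map (top_of_set ?K) B H" using H by simp
  have "compact ?K" using S by (intro compact_Times) auto
  then obtain e where e: "e > 0"
    "\<And>z. z \<in> ?K \<Longrightarrow> \<exists>U s \<kappa>. local_triv G B \<zeta> U s \<kappa> \<and> (\<forall>z'\<in>?K. dist z z' < e \<longrightarrow> H z' \<in> U)"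
    using lebesgue_local_triv[OF \<zeta> _ H'] by metis
  \<comment> \<open>A move of at most \<open>1 / N < e / 2\<close> in time and of less than
    \<open>e / 2\<close> in space stays within the Lebesgue number \<open>e\<close> of the
    product.\<close>
  have "e / 2 > 0" using e by simp
  then obtain M where M: "1 / real (Suc M) < e / 2" by (rule nat_approx_posE)
  define N where "N = Suc M"
  have N: "N > 0" "1 / real N < e / 2" using M by (auto simp: N_def)
  have "e / 4 > 0" using e by simp
  then obtain m c l where c: "\<And>i. i < m \<Longrightarrow> c i \<in> S" and lc: "\<And>i::nat. continuous_on S (l i)"
    and l0: "\<And>i y. (0::real) \<le> l i y"
    and lb: "\<And>i y. l i y \<noteq> 0 \<Longrightarrow> dist (c i) y < e / 4" and l1: "\<And>y. y \<in> S \<Longrightarrow> (\<Sum>i<m. l i y) = 1"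
    using compact_partition_of_unity[OF S] by metis
  \<comment> \<open>The chain of time functions: within row \<open>j\<close> the time rises from
    \<open>j / N\<close> to \<open>(j + 1) / N\<close>, one weight at a time, so passing from
    \<open>i\<close> to \<open>Suc i\<close> changes it only where \<open>l i\<close> is
    nonzero.\<close>
  define t where "t j i x = (real j + (\<Sum>k<i. l k x)) / real N" for j i x
  define f where "f j i x = H (t j i x, x)" for j i x
  have sum01: "0 \<le> (\<Sum>k<i. l k x)" "(\<Sum>k<i. l k x) \<le> 1" if "x \<in> S" "i \<le> m" for x i
  proof -
    show "0 \<le> (\<Sum>k<i. l k x)" by (intro sum_nonneg l0)
    have "(\<Sum>k<i. l k x) \<le> (\<Sum>k<m. l k x)" using that by (intro sum_mono2) (auto simp: l0)
    then show "(\<Sum>k<i. l k x) \<le> 1" using l1 that by simp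
  qed
  have t_bounds: "real j / N \<le> t j i x" "t j i x \<le> real (Suc j) / N" if "x \<in> S" "i \<le> m" for j i x
    using sum01[OF that] by (auto simp: t_def intro!: divide_right_mono)
  have t01: "t j i x \<in> {0..1}" if "x \<in> S" "i \<le> m" "j < N" for j i x
  proof -
    have "real (Suc j) / N \<le> 1" using that(3) by (simp add: divide_simps)
    moreover have "0 \<le> real j / N" by simp
    ultimately show ?thesis
      using order_trans[OF _ t_bounds(1)[OF that(1,2), of j]] order_trans[OF t_bounds(2)[OF that(1,2), of j]]
      by (simp only: atLeastAtMost_iff)
  qed
  have f_cont: "continuous_map (top_of_set S) B (f j i)" if "i \<le> m" "j < N" for j i
    unfolding f_def
  proof (rule continuous_map_comp[OF _ H'])
    have "continuous_on S (\<lambda>x. (t j i x, x))"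
      unfolding t_def using N(1) by (intro continuous_intros lc) auto
    then show "continuous_map (top_of_set S) (top_of_set ?K) (\<lambda>x. (t j i x, x))"
      using t01 that by auto
  qed
  have step: "\<exists>h. bundle_map G \<xi> \<zeta> (f j (Suc i)) h"
    if h: "\<exists>h. bundle_map G \<xi> \<zeta> (f j i) h" and ij: "Suc i \<le> m" "j < N" for i j
  proof -
    obtain h where h: "bundle_map G \<xi> \<zeta> (f j i) h" using h by blast
    have ci: "c i \<in> S" using c ij by simp
    have "(real j / N, c i) \<in> ?K" using ci ij by (auto simp: divide_simps)
    then obtain U s \<kappa> where U: "local_triv G B \<zeta> U s \<kappa>"
      and HU: "\<And>z'. z' \<in> ?K \<Longrightarrow> dist (real j / N, c i) z' < e \<Longrightarrow> H z' \<in> U"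
      using e(2) by blast
    have fU: "f j k x \<in> U" if "x \<in> S" "dist (c i) x < e / 2" "k \<le> m" for k x
      unfolding f_def
    proof (rule HU)
      show "(t j k x, x) \<in> ?K" using t01 that ij by auto
      have "dist (real j / N) (t j k x) \<le> 1 / N"
        using t_bounds[OF that(1,3), of j] by (simp add: dist_real_def add_divide_distrib)
      moreover have "dist (real j / N, c i) (t j k x, x) \<le> dist (real j / N) (t j k x) + dist (c i) x"
        unfolding dist_Pair_Pair by (rule sqrt_sum_squares_le_sum) auto
      ultimately show "dist (real j / N, c i) (t j k x, x) < e" using that(2) N(2) by linarith
    qed
    \<comment> \<open>The support of \<open>l i\<close> lies in the closed ball of radius
      \<open>e / 4\<close>, and both maps stay in \<open>U\<close> over the open ball of radius
      \<open>e / 2\<close>; the gap between the radii is the collar on which the old and the new map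
      are glued.\<close>
    obtain h' where "bundle_map G \<xi> \<zeta> (f j (Suc i)) h'"
    proof (rule bundle_map_step[OF \<xi> \<zeta> h f_cont[OF ij] _ _ _ _ U])
      show "openin (top_of_set S) (S \<inter> ball (c i) (e / 2))" by (simp add: openin_open_Int)
      show "closedin (top_of_set S) (S \<inter> cball (c i) (e / 4))" by (simp add: closedin_closed_Int)
      show "S \<inter> cball (c i) (e / 4) \<subseteq> S \<inter> ball (c i) (e / 2)" using e(1) by auto
      show "f j (Suc i) x = f j i x" if "x \<in> topspace (top_of_set S) - S \<inter> cball (c i) (e / 4)" for x
      proof -
        have "l i x = 0" using that lb[of i x] by fastforce
        then show ?thesis by (simp add: f_def t_def)
      qed
      show "f j i x \<in> U \<and> f j (Suc i) x \<in> U" if "x \<in> S \<inter> ball (c i) (e / 2)" for x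
        using that fU ij by auto
    qed
    then show ?thesis by blast
  qed
  have row: "\<exists>h. bundle_map G \<xi> \<zeta> (f j i) h"
    if "\<exists>h. bundle_map G \<xi> \<zeta> (f j 0) h" "i \<le> m" "j < N" for i j
    using that(2) by (induction i) (use step that in auto)
  have all: "\<exists>h. bundle_map G \<xi> \<zeta> (f j 0) h" if "j \<le> N" for j
    using that
  proof (induction j)
    case 0
    then show ?case using h0 by (auto simp: f_def t_def)
  next
    case (Suc j)
    then obtain h where h: "bundle_map G \<xi> \<zeta> (f j m) h" using row by (meson Suc_leD Suc_le_lessD order_refl)
    \<comment> \<open>Since the weights sum to 1, the end of row \<open>j\<close> is the start of
      row \<open>j + 1\<close>. The base maps agree on \<open>S\<close> only, hence the
      congruence.\<close>
    have "bundle_map G \<xi> \<zeta> (f (Suc j) 0) h"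
      by (rule bundle_map_cong[OF \<xi> h]) (simp add: f_def t_def l1 add.commute)
    then show ?case by blast
  qed
  obtain h where h: "bundle_map G \<xi> \<zeta> (f N 0) h" using all by blast
  have "bundle_map G \<xi> \<zeta> (\<lambda>x. H (1, x)) h"
    by (rule bundle_map_cong[OF \<xi> h]) (use N(1) in \<open>simp add: f_def t_def\<close>)
  then show thesis by (rule that)
qed

section \<open>Classifying maps and comparison of Chern classes\<close>

text \<open>Milnor's construction: a partition of unity subordinate to trivializing sets gives the
  weights, and the fibre coordinates \<open>\<kappa> i\<close> give the group entries. The resulting
  map of total spaces is equivariant because each \<open>\<kappa> i\<close> is. In particular Chern
  classes are nonempty.\<close>

lemma classifying_map_exists:
  fixes S :: "'a::metric_space set"
  assumes \<xi>: "principal_bundle G (top_of_set S) \<xi>" and S: "compact S"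
  obtains f where "classifying_map G (top_of_set S) \<xi> f"
proof -
  interpret principal G "top_of_set S" \<xi> by (rule principal.intro) fact
  have pS: "proj \<xi> e \<in> S" if "e \<in> E" for e using proj_closed[OF that] by simp
  have "continuous_map (top_of_set S) (top_of_set S) (\<lambda>x. x)" by simp
  then obtain e where e: "e > 0"
    "\<And>z. z \<in> S \<Longrightarrow> \<exists>U s \<kappa>. local_triv G (top_of_set S) \<xi> U s \<kappa> \<and> (\<forall>z'\<in>S. dist z z' < e \<longrightarrow> z' \<in> U)"
    using lebesgue_local_triv[OF \<xi> S] by metis
  obtain m c l where c: "\<And>i. i < m \<Longrightarrow> c i \<in> S" and lc: "\<And>i::nat. continuous_on S (l i)"
    and l0: "\<And>i y. (0::real) \<le> l i y"
    and lb: "\<And>i y. l i y \<noteq> 0 \<Longrightarrow> dist (c i) y < e" and l1: "\<And>y. y \<in> S \<Longrightarrow> (\<Sum>i<m. l i y) = 1"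
    using compact_partition_of_unity[OF S e(1)] by metis
  have "\<exists>U s \<kappa>. local_triv G (top_of_set S) \<xi> U s \<kappa> \<and> (\<forall>z'\<in>S. dist (c i) z' < e \<longrightarrow> z' \<in> U)" if "i < m" for i
    using e(2)[OF c[OF that]] .
  then obtain U s \<kappa> where U: "\<And>i. i < m \<Longrightarrow> local_triv G (top_of_set S) \<xi> (U i) (s i) (\<kappa> i)"
    and inU: "\<And>i z. i < m \<Longrightarrow> z \<in> S \<Longrightarrow> dist (c i) z < e \<Longrightarrow> z \<in> U i"
    by metis
  \<comment> \<open>The default (0, 1) is the normal form that the join prescribes for a vanishing
    weight; where the weight is nonzero the point lies in the domain of
    \<open>\<kappa> i\<close>.\<close>
  define F where "F a i = (if i < m \<and> l i (proj \<xi> a) \<noteq> 0 then (l i (proj \<xi> a), \<kappa> i a) else (0, \<one>\<^bsub>G\<^esub>))" for a i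
  have pU: "proj \<xi> a \<in> U i" if "a \<in> E" "i < m" "l i (proj \<xi> a) \<noteq> 0" for a i
    using inU[OF that(2) pS[OF that(1)] lb[OF that(3)]] .
  have kG: "\<kappa> i a \<in> carrier G" if "a \<in> E" "i < m" "l i (proj \<xi> a) \<noteq> 0" for a i
    using local_triv_closed(2)[OF U[OF that(2)] topological_group that(1) pU[OF that]] .
  have fstF: "fst (F a i) = (if i < m then l i (proj \<xi> a) else 0)" for a i by (simp add: F_def)
  have FE: "F a \<in> milnor_join G" if a: "a \<in> E" for a
  proof -
    have "{i. fst (F a i) \<noteq> 0} \<subseteq> {..<m}" by (auto simp: fstF)
    moreover from this have "(\<Sum>i | fst (F a i) \<noteq> 0. fst (F a i)) = (\<Sum>i<m. fst (F a i))"
      by (intro sum.mono_neutral_left) auto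
    moreover have "(\<Sum>i<m. fst (F a i)) = 1" using l1[OF pS[OF a]] by (simp add: fstF)
    ultimately show ?thesis
      unfolding milnor_join_def using finite_subset kG[OF a] by (auto simp: F_def l0)
  qed
  have lp: "continuous_map (total \<xi>) euclideanreal (\<lambda>a. l i (proj \<xi> a))" for i
    by (rule continuous_map_comp[OF continuous_map_proj]) (simp add: lc)
  have cF: "continuous_map (total \<xi>) (EG_topology G) F"
  proof (rule continuous_map_into_EG)
    show "continuous_map (total \<xi>) euclideanreal (\<lambda>a. fst (F a i))" for i
      by (cases "i < m") (auto simp: fstF lp)
    fix i
    let ?W = "{a \<in> E. fst (F a i) \<noteq> 0}"
    show "continuous_map (subtopology (total \<xi>) ?W) (gtop G) (\<lambda>a. snd (F a i))"
    proof (cases "i < m")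
      case True
      have "continuous_map (subtopology (total \<xi>) {a \<in> E. proj \<xi> a \<in> U i}) (gtop G) (\<kappa> i)"
        using U[OF True] by (simp add: local_triv_def)
      then have "continuous_map (subtopology (total \<xi>) ?W) (gtop G) (\<kappa> i)"
        by (rule continuous_map_from_subtopology_mono) (use True pU in \<open>auto simp: fstF\<close>)
      then show ?thesis by (rule continuous_map_eq) (auto simp: F_def)
    next
      case False
      then have W: "?W = {}" by (simp add: fstF)
      show ?thesis unfolding W by (auto simp: continuous_map_def)
    qed
  qed (use FE in auto)
  have Fg: "F (ract \<xi> a g) = EG_act G (F a) g" if "a \<in> E" "g \<in> carrier G" for a g
  proof
    fix i
    have "\<kappa> i (ract \<xi> a g) = \<kappa> i a \<otimes>\<^bsub>G\<^esub> g" if "i < m" "l i (proj \<xi> a) \<noteq> 0"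
      using U[OF that(1)] pU[OF \<open>a \<in> E\<close> that] \<open>a \<in> E\<close> \<open>g \<in> carrier G\<close> by (simp add: local_triv_def)
    then show "F (ract \<xi> a g) i = EG_act G (F a) g i"
      using proj_ract[OF that] by (auto simp: F_def EG_act_def)
  qed
  obtain f where f: "continuous_map (top_of_set S) (classifying_space G) f"
    "bundle_map G \<xi> (universal_bundle G) f F"
    by (rule bundle_map_covers_continuous[OF \<xi> principal_universal_bundle, of F]) (use cF Fg in auto)
  then show thesis
    using that bundle_map_imp_pullback_iso[OF \<xi> principal_universal_bundle f]
    unfolding classifying_map_def by blast
qed

text \<open>A classifying map \<open>f1\<close> of the first bundle lies in its own class by
  reflexivity, hence in the class of the second, so it is homotopic to some classifying map
  \<open>f2\<close> of the second. Carried along this homotopy, the second bundle also maps to the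
  universal one over \<open>f1\<close>, and both bundles are isomorphic to the same
  pullback.\<close>

lemma chern_class_eq_imp_bundle_map:
  fixes S :: "'a::metric_space set"
  assumes \<xi>1: "principal_bundle G (top_of_set S) \<xi>1" and \<xi>2: "principal_bundle G (top_of_set S) \<xi>2"
    and S: "compact S"
    and eq: "chern_class G (top_of_set S) \<xi>1 = chern_class G (top_of_set S) \<xi>2"
  obtains \<Phi> where "bundle_map G \<xi>1 \<xi>2 (\<lambda>x. x) \<Phi>"
proof -
  interpret principal G "top_of_set S" \<xi>1 by (rule principal.intro) fact
  obtain f1 where f1: "classifying_map G (top_of_set S) \<xi>1 f1"
    using classifying_map_exists[OF \<xi>1 S] .
  then have cf1: "continuous_map (top_of_set S) (classifying_space G) f1" by (simp add: classifying_map_def)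
  then have "f1 \<in> chern_class G (top_of_set S) \<xi>1"
    unfolding chern_class_def using f1 by auto
  then obtain f2 where f2: "classifying_map G (top_of_set S) \<xi>2 f2"
    and hom: "homotopic_with (\<lambda>_. True) (top_of_set S) (classifying_space G) f2 f1"
    unfolding eq by (auto simp: chern_class_def)
  obtain H where H: "continuous_map (prod_topology (top_of_set {0..1::real}) (top_of_set S)) (classifying_space G) H"
    and H0: "\<And>x. H (0, x) = f2 x" and H1: "\<And>x. H (1, x) = f1 x"
    using hom unfolding homotopic_with_def by blast
  let ?P = "pullback_bundle (top_of_set S) f1 (universal_bundle G)"
  have P: "principal_bundle G (top_of_set S) ?P"
    by (rule principal_pullback_bundle[OF principal_universal_bundle cf1])
  obtain F1 where F1: "principal_bundle_iso G \<xi>1 ?P F1" using f1 by (auto simp: classifying_map_def)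
  obtain F2 where "principal_bundle_iso G \<xi>2 (pullback_bundle (top_of_set S) f2 (universal_bundle G)) F2"
    using f2 by (auto simp: classifying_map_def)
  then have "bundle_map G \<xi>2 (universal_bundle G) (\<lambda>x. H (0, x)) (\<lambda>e. snd (F2 e))"
    using pullback_iso_imp_bundle_map by (simp add: H0)
  then obtain h where "bundle_map G \<xi>2 (universal_bundle G) (\<lambda>x. H (1, x)) h"
    using covering_homotopy[OF \<xi>2 principal_universal_bundle S H] by blast
  then have "bundle_map G \<xi>2 (universal_bundle G) f1 h" by (simp add: H1)
  from bundle_map_imp_pullback_iso[OF \<xi>2 principal_universal_bundle cf1 this]
  obtain F2' where F2': "bundle_map G ?P \<xi>2 (\<lambda>x. x) F2'"
    using principal_bundle_iso_inverse[OF \<xi>2 P] by blast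
  have "bundle_map G \<xi>1 ?P (\<lambda>x. x) F1"
    using F1 by (auto simp: principal_bundle_iso_def bundle_map_def homeomorphic_imp_continuous_map)
  from bundle_map_compose[OF this F2'] show thesis by (rule that)
qed

section \<open>Powers near the identity of a Lie group\<close>

text \<open>Gram-Schmidt, where a vector already in the span of its predecessors is dropped.\<close>

lemma orthonormal_spanning_set:
  fixes B :: "'v::real_inner set"
  assumes "finite B"
  shows "\<exists>C. finite C \<and> (\<forall>x\<in>C. \<forall>y\<in>C. x \<bullet> y = (if x = y then 1 else 0)) \<and> B \<subseteq> span C"
  using assms
proof induction
  case empty
  show ?case by (intro exI[of _ "{}"]) auto
next
  case (insert b B)
  then obtain C where C: "finite C" "\<And>x y. x \<in> C \<Longrightarrow> y \<in> C \<Longrightarrow> x \<bullet> y = (if x = y then 1 else 0)"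
    "B \<subseteq> span C" by blast
  define p where "p = (\<Sum>c\<in>C. (b \<bullet> c) *\<^sub>R c)"
  define v where "v = b - p"
  have p: "p \<in> span C" unfolding p_def by (intro span_sum span_scale span_base)
  have vC: "v \<bullet> c = 0" if "c \<in> C" for c
  proof -
    have "p \<bullet> c = (\<Sum>d\<in>C. if d = c then b \<bullet> c else 0)"
      unfolding p_def inner_sum_left using C(2) that by (intro sum.cong) auto
    then show ?thesis using C(1) that by (simp add: v_def inner_diff_left)
  qed
  show ?case
  proof (cases "v = 0")
    case True
    then have "b \<in> span C" using p by (simp add: v_def)
    then show ?thesis using C by (intro exI[of _ C]) auto
  next
    case False
    define w where "w = v /\<^sub>R norm v"
    have w: "w \<bullet> w = 1" "\<And>c. c \<in> C \<Longrightarrow> w \<bullet> c = 0"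
      using False vC by (auto simp: w_def dot_square_norm power2_eq_square)
    have sub: "span C \<subseteq> span (insert w C)" by (rule span_mono) auto
    have "v = norm v *\<^sub>R w" using False by (simp add: w_def)
    then have "v \<in> span (insert w C)" by (metis insertI1 span_base span_scale)
    then have "v + p \<in> span (insert w C)" using p sub by (intro span_add) auto
    then have "b \<in> span (insert w C)" by (simp add: v_def)
    moreover have "w \<notin> C" using w by force
    ultimately show ?thesis
      using C w sub by (intro exI[of _ "insert w C"]) (auto simp: inner_commute)
  qed
qed

text \<open>A predicate on the type, so that it can be stated for the model space of the charts as
  well as for its square and allows dimension 0.\<close>

definition finite_dimensional :: "'v::real_inner itself \<Rightarrow> bool" where
  "finite_dimensional _ \<longleftrightarrow> (\<exists>B::'v set. finite B \<and> span B = UNIV)"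

text \<open>The difference between \<open>x\<close> and its projection is orthogonal to an
  orthonormal family that spans everything, hence to itself. The family serves as a basis in which
  limits and linear maps are handled coordinatewise.\<close>

lemma finite_dimensional_coordinates:
  assumes "finite_dimensional TYPE('v::real_inner)"
  shows "\<exists>C :: 'v::real_inner set. finite C \<and> (\<forall>c\<in>C. norm c = 1) \<and> (\<forall>x. x = (\<Sum>c\<in>C. (x \<bullet> c) *\<^sub>R c))"
proof -
  obtain B :: "'v set" where B: "finite B" "span B = UNIV"
    using assms by (auto simp: finite_dimensional_def)
  obtain C where C: "finite C" "\<And>x y. x \<in> C \<Longrightarrow> y \<in> C \<Longrightarrow> x \<bullet> y = (if x = y then 1 else 0)" "B \<subseteq> span C"
    using orthonormal_spanning_set[OF B(1)] by blast
  have span: "x \<in> span C" for x using B(2) C(3) by (metis UNIV_I span_minimal subsetD subspace_span)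
  show ?thesis
  proof (intro exI[of _ C] conjI ballI allI C(1))
    show "norm c = 1" if "c \<in> C" for c using C(2)[OF that that] by (simp add: norm_eq_1)
    fix x
    define p where "p = (\<Sum>c\<in>C. (x \<bullet> c) *\<^sub>R c)"
    have 1: "(x - p) \<bullet> c = 0" if "c \<in> C" for c
    proof -
      have "p \<bullet> c = (\<Sum>d\<in>C. if d = c then x \<bullet> c else 0)"
        unfolding p_def inner_sum_left using C(2) that by (intro sum.cong) auto
      then show ?thesis using C(1) that by (simp add: inner_diff_left)
    qed
    have "(x - p) \<bullet> y = 0" for y
      using span[of y] by (induction rule: span_induct_alt) (auto simp: inner_add_right 1)
    then have "x - p = 0" by (metis inner_eq_zero_iff)
    then show "x = (\<Sum>c\<in>C. (x \<bullet> c) *\<^sub>R c)" by (simp add: p_def)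
  qed
qed

text \<open>Group multiplication in a chart is a function of two variables, so its derivative lives
  on the square of the model space.\<close>

lemma finite_dimensional_prod:
  assumes "finite_dimensional TYPE('v::real_inner)"
  shows "finite_dimensional TYPE('v::real_inner \<times> 'v)"
proof -
  obtain B :: "'v set" where B: "finite B" "span B = UNIV"
    using assms by (auto simp: finite_dimensional_def)
  let ?C = "(\<lambda>b. (b, 0)) ` B \<union> (\<lambda>b. (0, b)) ` B"
  have l: "linear (\<lambda>b::'v. (b, 0::'v))" "linear (\<lambda>b::'v. (0::'v, b))"
    by (auto intro!: linearI)
  have "(x, y) \<in> span ?C" for x y
  proof -
    have "(x, 0) \<in> span ((\<lambda>b. (b, 0::'v)) ` B)" "(0, y) \<in> span ((\<lambda>b. (0::'v, b)) ` B)"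
      unfolding linear_span_image[OF l(1)] linear_span_image[OF l(2)] B(2) by auto
    then have "(x, 0) \<in> span ?C" "(0, y) \<in> span ?C" by (meson span_mono subsetD sup_ge1 sup_ge2)+
    from span_add[OF this] show ?thesis by simp
  qed
  then have "span ?C = UNIV" by (intro UNIV_eq_I[symmetric]) (metis surj_pair)
  then show ?thesis unfolding finite_dimensional_def using B(1) by (intro exI[of _ ?C]) auto
qed

text \<open>The finitely many coordinates of a Cauchy sequence converge in the reals. Completeness
  is what the fixed point theorem asks for.\<close>

lemma finite_dimensional_complete:
  assumes "finite_dimensional TYPE('v::real_inner)" "closed (S :: 'v::real_inner set)"
  shows "complete S"
proof -
  obtain C :: "'v set" where C: "finite C" "\<forall>c\<in>C. norm c = 1" "\<forall>x. x = (\<Sum>c\<in>C. (x \<bullet> c) *\<^sub>R c)"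
    using finite_dimensional_coordinates[OF assms(1)] by (elim exE conjE) (rule that)
  show ?thesis
    unfolding complete_def
  proof (intro allI impI)
    fix X :: "nat \<Rightarrow> 'v" assume X: "(\<forall>n. X n \<in> S) \<and> Cauchy X"
    then have CX: "Cauchy X" by simp
    have "convergent (\<lambda>n. X n \<bullet> c)" for c
      by (rule Cauchy_convergent[OF bounded_linear.Cauchy[OF bounded_linear_inner_left CX]])
    then have "(\<lambda>n. X n \<bullet> c) \<longlonglongrightarrow> lim (\<lambda>n. X n \<bullet> c)" for c
      by (simp add: convergent_LIMSEQ_iff)
    then have "(\<lambda>n. \<Sum>c\<in>C. (X n \<bullet> c) *\<^sub>R c) \<longlonglongrightarrow> (\<Sum>c\<in>C. lim (\<lambda>n. X n \<bullet> c) *\<^sub>R c)"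
      by (intro tendsto_sum tendsto_scaleR tendsto_const)
    then have L: "X \<longlonglongrightarrow> (\<Sum>c\<in>C. lim (\<lambda>n. X n \<bullet> c) *\<^sub>R c)"
      using spec[OF C(3), symmetric] by simp
    moreover from L have "(\<Sum>c\<in>C. lim (\<lambda>n. X n \<bullet> c) *\<^sub>R c) \<in> S"
      using closed_sequentially[OF assms(2)] X by blast
    ultimately show "\<exists>l\<in>S. X \<longlonglongrightarrow> l" by blast
  qed
qed

section \<open>Strong differentiability and roots near the identity\<close>

text \<open>Smoothness provides continuity of the derivative in each fixed direction. Finitely many
  basis directions control the operator norm, so the derivative is uniformly close to its value at
  \<open>z\<close> on a small ball, and the mean value inequality turns this into an estimate for
  arbitrary pairs of points.\<close>

lemma C1_strongly_differentiable:
  fixes f :: "'a::real_inner \<Rightarrow> 'b::real_normed_vector"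
  assumes fd: "finite_dimensional TYPE('a)" and f: "smooth_on D f" and z: "z \<in> D" and "\<epsilon> > 0"
  obtains r where "r > 0" "ball z r \<subseteq> D"
    "\<And>x y. x \<in> ball z r \<Longrightarrow> y \<in> ball z r \<Longrightarrow>
      norm (f x - f y - frechet_derivative f (at z) (x - y)) \<le> \<epsilon> * norm (x - y)"
proof -
  obtain C :: "'a set" where C: "finite C" "\<forall>c\<in>C. norm c = 1" "\<forall>x. x = (\<Sum>c\<in>C. (x \<bullet> c) *\<^sub>R c)"
    using finite_dimensional_coordinates[OF fd] by (elim exE conjE) (rule that)
  have D: "open D" and "Ck_on (Suc 0) D f" using f by (auto simp: smooth_on_def)
  then have df: "\<And>x. x \<in> D \<Longrightarrow> f differentiable (at x)"
    and dc: "\<And>v. continuous_on D (\<lambda>x. frechet_derivative f (at x) v)" by auto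
  define f' where "f' x = frechet_derivative f (at x)" for x
  have f': "(f has_derivative f' x) (at x)" if "x \<in> D" for x
    using df[OF that] by (simp add: f'_def frechet_derivative_works)
  \<comment> \<open>The error adds up over \<open>card C\<close> directions; the summand 1 keeps the
    quotient sensible in dimension 0.\<close>
  define \<delta> where "\<delta> = \<epsilon> / (real (card C) + 1)"
  have \<delta>: "\<delta> > 0" "real (card C) * \<delta> \<le> \<epsilon>"
  proof -
    show "\<delta> > 0" using \<open>\<epsilon> > 0\<close> by (simp add: \<delta>_def)
    then show "real (card C) * \<delta> \<le> \<epsilon>"
      using \<open>\<epsilon> > 0\<close> by (simp add: \<delta>_def divide_simps)
  qed
  have "\<forall>\<^sub>F x in nhds z. dist (f' x c) (f' z c) < \<delta>" for c
  proof -
    have "isCont (\<lambda>x. f' x c) z" using dc[of c] D z by (simp add: f'_def continuous_on_eq_continuous_at)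
    then have "((\<lambda>x. f' x c) \<longlongrightarrow> f' z c) (nhds z)" 
      using tendsto_at_iff_tendsto_nhds[of "\<lambda>x. f' x c" z] by (simp add: isCont_def)
    then show ?thesis using \<delta>(1) by (rule tendstoD)
  qed
  then have "\<forall>\<^sub>F x in nhds z. (\<forall>c\<in>C. dist (f' x c) (f' z c) < \<delta>) \<and> x \<in> D"
    using D z C(1) by (intro eventually_conj eventually_ball_finite eventually_nhds_in_open) auto
  then obtain r where r: "r > 0" "\<And>x. dist x z < r \<Longrightarrow> (\<forall>c\<in>C. dist (f' x c) (f' z c) < \<delta>) \<and> x \<in> D"
    by (auto simp: eventually_nhds_metric)
  have bound: "norm (f' x v - f' z v) \<le> \<epsilon> * norm v" if x: "x \<in> ball z r" for x v
  proof -
    have xD: "x \<in> D" and xc: "\<And>c. c \<in> C \<Longrightarrow> norm (f' x c - f' z c) < \<delta>"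
      using r(2)[of x] x by (auto simp: dist_commute dist_norm)
    interpret l1: bounded_linear "f' x" using f'[OF xD] by (rule has_derivative_bounded_linear)
    interpret l2: bounded_linear "f' z" using f'[OF z] by (rule has_derivative_bounded_linear)
    have "f' x v - f' z v = (\<Sum>c\<in>C. (v \<bullet> c) *\<^sub>R (f' x c - f' z c))"
    proof -
      have "f' x v = (\<Sum>c\<in>C. (v \<bullet> c) *\<^sub>R f' x c)" "f' z v = (\<Sum>c\<in>C. (v \<bullet> c) *\<^sub>R f' z c)"
        by (subst spec[OF C(3), of v], simp add: l1.sum l1.scaleR l2.sum l2.scaleR)+
      then show ?thesis by (simp add: sum_subtractf scaleR_diff_right)
    qed
    also have "norm \<dots> \<le> (\<Sum>c\<in>C. norm v * \<delta>)"
    proof (rule order_trans[OF norm_sum sum_mono])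
      fix c assume c: "c \<in> C"
      have "\<bar>v \<bullet> c\<bar> \<le> norm v" using Cauchy_Schwarz_ineq2[of v c] C(2) c by simp
      then show "norm ((v \<bullet> c) *\<^sub>R (f' x c - f' z c)) \<le> norm v * \<delta>"
        using xc[OF c] by (auto intro!: mult_mono)
    qed
    also have "\<dots> = real (card C) * \<delta> * norm v" by simp
    also have "\<dots> \<le> \<epsilon> * norm v" using \<delta>(2) by (rule mult_right_mono) simp
    finally show ?thesis .
  qed
  show thesis
  proof (rule that[OF r(1)])
    show sub: "ball z r \<subseteq> D" using r(2) by (auto simp: dist_commute)
    fix x y assume xy: "x \<in> ball z r" "y \<in> ball z r"
    interpret l2: bounded_linear "f' z" using f'[OF z] by (rule has_derivative_bounded_linear)
    \<comment> \<open>The mean value inequality is applied to \<open>f\<close> minus its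
      linearization at \<open>z\<close>, whose derivative is small on the whole convex ball.\<close>
    have "norm ((f x - f' z x) - (f y - f' z y)) \<le> \<epsilon> * norm (x - y)"
    proof (rule differentiable_bound[OF convex_ball _ _ xy])
      fix w assume w: "w \<in> ball z r"
      show "((\<lambda>x. f x - f' z x) has_derivative (\<lambda>v. f' w v - f' z v)) (at w within ball z r)"
        using f'[OF subsetD[OF sub w]] l2.bounded_linear_axioms
        by (intro has_derivative_diff bounded_linear_imp_has_derivative) (auto intro: has_derivative_at_withinI)
      show "onorm (\<lambda>v. f' w v - f' z v) \<le> \<epsilon>"
        using bound[OF w] \<open>\<epsilon> > 0\<close> by (intro onorm_bound) auto
    qed
    then show "norm (f x - f y - frechet_derivative f (at z) (x - y)) \<le> \<epsilon> * norm (x - y)"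
      by (simp add: f'_def[symmetric] l2.diff algebra_simps)
  qed
qed

text \<open>In a chart around the identity \<open>a \<mapsto> a\<^sup>n\<close> is strongly differentiable with derivative \<open>n \<cdot> id\<close>
  there, by induction on \<open>n\<close> from the multiplication, so Newton's iteration inverts it.\<close>

lemma lie_group_local_root:
  fixes G :: "('g, 'v::real_inner, 'm) lie_group_scheme" (structure) and n :: nat
  assumes G: "lie_group G" and n: "n > 0"
  obtains V \<sigma> W where "openin (gtop G) V" "\<one> \<in> V" "continuous_map (subtopology (gtop G) V) (gtop G) \<sigma>"
    "\<forall>u\<in>V. \<sigma> u [^] n = u"
    "openin (gtop G) W" "\<one> \<in> W" "\<forall>g\<in>W. g [^] n = \<one> \<longrightarrow> g = \<one>"
proof -
  interpret top_group G by (rule top_group.intro) (use G in \<open>simp add: lie_group_def\<close>)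
  have atl: "smooth_atlas (gtop G) (atlas G)"
    and sm: "\<And>U \<phi>. (U, \<phi>) \<in> atlas G \<Longrightarrow>
        smooth_on {(\<phi> g, \<phi> h) | g h. g \<in> U \<and> h \<in> U \<and> g \<otimes> h \<in> U}
          (\<lambda>(a, b). \<phi> (inv_into U \<phi> a \<otimes> inv_into U \<phi> b))"
    using G unfolding lie_group_def by blast+
  have fd: "finite_dimensional TYPE('v)"
    using atl by (simp add: smooth_atlas_def finite_dimensional_def)
  have "\<one> \<in> (\<Union>(U, \<phi>)\<in>atlas G. U)" using atl by (simp add: smooth_atlas_def)
  then obtain U \<phi> where U\<phi>: "(U, \<phi>) \<in> atlas G" "\<one> \<in> U" by auto
  have oU: "openin (gtop G) U" and o\<phi>: "open (\<phi> ` U)"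
    and hom: "homeomorphic_map (subtopology (gtop G) U) (top_of_set (\<phi> ` U)) \<phi>"
    using atl U\<phi>(1) unfolding smooth_atlas_def by blast+
  have UG: "U \<subseteq> carrier G" using openin_subset[OF oU] by simp
  have inj: "inj_on \<phi> U" using homeomorphic_imp_injective_map[OF hom] UG by (simp add: inf.absorb2)
  define \<psi> where "\<psi> = inv_into U \<phi>"
  have \<psi>\<phi>: "\<psi> (\<phi> g) = g" if "g \<in> U" for g using that inj by (simp add: \<psi>_def)
  have \<phi>\<psi>: "\<phi> (\<psi> a) = a" "\<psi> a \<in> U" if "a \<in> \<phi> ` U" for a
    using that by (auto simp: \<psi>_def f_inv_into_f inv_into_into)
  have c\<phi>: "continuous_map (subtopology (gtop G) U) (top_of_set (\<phi> ` U)) \<phi>"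
    using hom by (rule homeomorphic_imp_continuous_map)
  have c\<psi>: "continuous_map (top_of_set (\<phi> ` U)) (gtop G) \<psi>"
  proof -
    obtain \<psi>' where h: "homeomorphic_maps (subtopology (gtop G) U) (top_of_set (\<phi> ` U)) \<phi> \<psi>'"
      using hom by (auto simp: homeomorphic_map_maps)
    then have "continuous_map (top_of_set (\<phi> ` U)) (gtop G) \<psi>'" "\<And>g. g \<in> U \<Longrightarrow> \<psi>' (\<phi> g) = g"
      using UG by (auto simp: homeomorphic_maps_def continuous_map_in_subtopology)
    then show ?thesis by (elim continuous_map_eq) (auto simp: \<psi>\<phi>)
  qed
  define a0 where "a0 = \<phi> \<one>"
  have a0: "a0 \<in> \<phi> ` U" "\<psi> a0 = \<one>" using U\<phi>(2) \<psi>\<phi> by (auto simp: a0_def)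
  define D where "D = {(\<phi> g, \<phi> h) | g h. g \<in> U \<and> h \<in> U \<and> g \<otimes> h \<in> U}"
  define M where "M = (\<lambda>(a, b). \<phi> (\<psi> a \<otimes> \<psi> b))"
  have sM: "smooth_on D M" using sm[OF U\<phi>(1)] by (simp add: D_def M_def \<psi>_def)
  \<comment> \<open>The identity is neutral, so multiplication in the chart restricts to the
    identity map on both axes through \<open>(a0, a0)\<close>. This alone determines its derivative
    there: addition.\<close>
  have axes: "(a, a0) \<in> D" "(a0, a) \<in> D" "M (a, a0) = a" "M (a0, a) = a" if "a \<in> \<phi> ` U" for a
  proof -
    obtain g where g: "g \<in> U" "a = \<phi> g" using \<open>a \<in> \<phi> ` U\<close> by auto
    have gG: "g \<in> carrier G" using g UG by auto
    then show "(a, a0) \<in> D" "(a0, a) \<in> D"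
      unfolding D_def a0_def using g U\<phi>(2) r_one[OF gG] l_one[OF gG] by force+
    show "M (a, a0) = a" "M (a0, a) = a"
      using g gG a0 by (auto simp: M_def \<psi>\<phi>)
  qed
  define M' where "M' = frechet_derivative M (at (a0, a0))"
  have M': "(M has_derivative M') (at (a0, a0))"
  proof -
    have "Ck_on (Suc 0) D M" using sM by (auto simp: smooth_on_def)
    then have "M differentiable (at (a0, a0))" using axes(1)[OF a0(1)] by auto
    then show ?thesis by (simp add: M'_def frechet_derivative_works)
  qed
  interpret M': bounded_linear M' using M' by (rule has_derivative_bounded_linear)
  have M'eq: "M' (v, w) = v + w" for v w
  proof -
    have "((\<lambda>a. M (a, a0)) has_derivative (\<lambda>v. M' (v, 0))) (at a0)"
      using has_derivative_compose[of "\<lambda>a. (a, a0)" "\<lambda>v. (v, 0)" a0 UNIV M M'] M'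
      by (simp add: has_derivative_Pair)
    then have "((\<lambda>a. a) has_derivative (\<lambda>v. M' (v, 0))) (at a0)"
      by (rule has_derivative_transform_within_open[OF _ o\<phi> a0(1)]) (rule axes(3))
    then have 1: "(\<lambda>v. M' (v, 0)) = (\<lambda>v. v)" using has_derivative_ident has_derivative_unique by blast
    have "((\<lambda>a. M (a0, a)) has_derivative (\<lambda>v. M' (0, v))) (at a0)"
      using has_derivative_compose[of "\<lambda>a. (a0, a)" "\<lambda>v. (0, v)" a0 UNIV M M'] M'
      by (simp add: has_derivative_Pair)
    then have "((\<lambda>a. a) has_derivative (\<lambda>v. M' (0, v))) (at a0)"
      by (rule has_derivative_transform_within_open[OF _ o\<phi> a0(1)]) (rule axes(4))
    then have 2: "(\<lambda>v. M' (0, v)) = (\<lambda>v. v)" using has_derivative_ident has_derivative_unique by blast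
    have "M' (v, w) = M' (v, 0) + M' (0, w)" by (simp add: M'.add[symmetric])
    then show ?thesis using fun_cong[OF 1, of v] fun_cong[OF 2, of w] by simp
  qed
  define q where "q k a = \<phi> (\<psi> a [^] (k::nat))" for k a
  have q0: "q k a0 = a0" for k by (simp add: q_def a0 a0_def[symmetric])
  \<comment> \<open>Besides the estimate the induction keeps all k-th powers inside the chart
    domain, since \<open>\<phi>\<close> has meaning only there.\<close>
  have Q: "\<exists>r>0. ball a0 r \<subseteq> \<phi> ` U \<and> (\<forall>a\<in>ball a0 r. \<psi> a [^] k \<in> U) \<and>
      (\<forall>a\<in>ball a0 r. \<forall>b\<in>ball a0 r. norm (q k a - q k b - real k *\<^sub>R (a - b)) \<le> \<epsilon> * norm (a - b))"
    if "\<epsilon> > 0" for k \<epsilon>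
    using that
  proof (induction k arbitrary: \<epsilon>)
    case 0
    obtain r where "r > 0" "ball a0 r \<subseteq> \<phi> ` U" using o\<phi> a0(1) open_contains_ball by blast
    then show ?case using U\<phi>(2) 0 by (intro exI[of _ r]) (auto simp: q_def)
  next
    case (Suc k)
    \<comment> \<open>The bound 1 in \<open>\<epsilon>2\<close> makes \<open>q k\<close> Lipschitz
      with constant \<open>k + 1\<close>, hence the map from \<open>a\<close> to
      \<open>(q k a, a)\<close> Lipschitz with constant \<open>k + 2\<close>. Then
      \<open>\<epsilon>1\<close> times that constant is \<open>\<epsilon> / 2\<close>, and so each
      of the two errors is at most half of \<open>\<epsilon>\<close>.\<close>
    define \<epsilon>2 where "\<epsilon>2 = min 1 (\<epsilon> / 2)"
    define \<epsilon>1 where "\<epsilon>1 = \<epsilon> / (2 * (real k + 2))"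
    have \<epsilon>: "\<epsilon>2 > 0" "\<epsilon>1 > 0" using Suc.prems by (auto simp: \<epsilon>2_def \<epsilon>1_def)
    obtain r where r: "r > 0" "ball a0 r \<subseteq> \<phi> ` U" "\<And>a. a \<in> ball a0 r \<Longrightarrow> \<psi> a [^] k \<in> U"
      "\<And>a b. a \<in> ball a0 r \<Longrightarrow> b \<in> ball a0 r \<Longrightarrow> norm (q k a - q k b - real k *\<^sub>R (a - b)) \<le> \<epsilon>2 * norm (a - b)"
      using Suc.IH[OF \<epsilon>(1)] by blast
    obtain \<rho> where \<rho>: "\<rho> > 0" "ball (a0, a0) \<rho> \<subseteq> D"
      "\<And>x y. x \<in> ball (a0, a0) \<rho> \<Longrightarrow> y \<in> ball (a0, a0) \<rho> \<Longrightarrow> norm (M x - M y - M' (x - y)) \<le> \<epsilon>1 * norm (x - y)"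
      using C1_strongly_differentiable[OF finite_dimensional_prod[OF fd] sM axes(1)[OF a0(1)] \<epsilon>(2)]
      unfolding M'_def by blast
    \<comment> \<open>The same constant \<open>k + 2\<close> guarantees that
      \<open>(q k a, a)\<close> stays in the ball of radius \<open>\<rho>\<close> on which
      multiplication is controlled.\<close>
    define r' where "r' = min r (\<rho> / (real k + 2))"
    have r': "r' > 0" "r' \<le> r" and "r' \<le> \<rho> / (real k + 2)"
      using r(1) \<rho>(1) by (auto simp: r'_def)
    then have r'\<rho>: "r' * (real k + 2) \<le> \<rho>" by (simp add: pos_le_divide_eq)
    have lip: "norm (q k a - q k b) \<le> (real k + 1) * norm (a - b)" if "a \<in> ball a0 r" "b \<in> ball a0 r" for a b
    proof -
      have "norm (q k a - q k b) \<le> norm (q k a - q k b - real k *\<^sub>R (a - b)) + norm (real k *\<^sub>R (a - b))"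
        by (metis diff_add_cancel norm_triangle_ineq)
      also have "\<dots> \<le> \<epsilon>2 * norm (a - b) + real k * norm (a - b)" using r(4)[OF that] by simp
      also have "\<epsilon>2 * norm (a - b) \<le> 1 * norm (a - b)" by (rule mult_right_mono) (auto simp: \<epsilon>2_def)
      finally show ?thesis by (simp add: algebra_simps)
    qed
    have sub: "ball a0 r' \<subseteq> ball a0 r" using r'(2) by auto
    have inball: "(q k a, a) \<in> ball (a0, a0) \<rho>" if a: "a \<in> ball a0 r'" for a
    proof -
      have ar: "a \<in> ball a0 r" using a sub by auto
      have a0r: "a0 \<in> ball a0 r" using r(1) by simp
      have "dist (a0, a0) (q k a, a) \<le> dist a0 (q k a) + dist a0 a"
        unfolding dist_Pair_Pair by (rule sqrt_sum_squares_le_sum) auto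
      also have "dist a0 (q k a) \<le> (real k + 1) * dist a0 a"
        using lip[OF a0r ar] by (simp add: q0 dist_norm)
      also have "(real k + 1) * dist a0 a + dist a0 a = (real k + 2) * dist a0 a" by (simp add: algebra_simps)
      also have "\<dots> < (real k + 2) * r'" using a by (intro mult_strict_left_mono) auto
      also have "\<dots> \<le> \<rho>" using r'\<rho> by (simp add: mult.commute)
      finally show ?thesis by simp
    qed
    have qS: "\<psi> a [^] Suc k \<in> U \<and> M (q k a, a) = q (Suc k) a" if a: "a \<in> ball a0 r'" for a
    proof -
      have kU: "\<psi> a [^] k \<in> U" and aU: "a \<in> \<phi> ` U" using a sub r by auto
      \<comment> \<open>Membership in \<open>D\<close> only yields some group elements with these
        coordinates; injectivity of the chart identifies them with the k-th power and with the
        element itself, so the next power lies in \<open>U\<close>.\<close>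
      obtain g h where gh: "q k a = \<phi> g" "a = \<phi> h" "g \<in> U" "h \<in> U" "g \<otimes> h \<in> U"
        using inball[OF a] \<rho>(2) by (auto simp: D_def)
      have "g = \<psi> a [^] k" using gh(1,3) kU inj by (simp add: q_def inj_on_eq_iff)
      moreover have "h = \<psi> a" using gh \<psi>\<phi> by simp
      ultimately have "\<psi> a [^] Suc k \<in> U" using gh(5) by simp
      moreover have "M (q k a, a) = q (Suc k) a" using kU by (simp add: M_def q_def \<psi>\<phi>)
      ultimately show ?thesis by simp
    qed
    have "norm (q (Suc k) a - q (Suc k) b - real (Suc k) *\<^sub>R (a - b)) \<le> \<epsilon> * norm (a - b)"
      if a: "a \<in> ball a0 r'" and b: "b \<in> ball a0 r'" for a b
    proof -
      have ab: "a \<in> ball a0 r" "b \<in> ball a0 r" using a b sub by auto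
      let ?x = "(q k a, a)" and ?y = "(q k b, b)"
      have "q (Suc k) a - q (Suc k) b - real (Suc k) *\<^sub>R (a - b) =
          (M ?x - M ?y - M' (?x - ?y)) + (q k a - q k b - real k *\<^sub>R (a - b))"
        using qS[OF a] qS[OF b] by (simp add: M'eq algebra_simps)
      also have "norm \<dots> \<le> norm (M ?x - M ?y - M' (?x - ?y)) + norm (q k a - q k b - real k *\<^sub>R (a - b))"
        by (rule norm_triangle_ineq)
      also have "\<dots> \<le> \<epsilon>1 * norm (?x - ?y) + \<epsilon>2 * norm (a - b)"
        by (intro add_mono \<rho>(3) inball a b r(4) ab)
      also have "norm (?x - ?y) \<le> norm (q k a - q k b) + norm (a - b)"
        by (simp add: norm_Pair sqrt_sum_squares_le_sum)
      also have "\<dots> \<le> (real k + 2) * norm (a - b)" using lip[OF ab] by (simp add: algebra_simps)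
      also have "\<epsilon>1 * ((real k + 2) * norm (a - b)) = (\<epsilon> / 2) * norm (a - b)"
        by (simp add: \<epsilon>1_def field_simps)
      also have "\<epsilon>2 * norm (a - b) \<le> (\<epsilon> / 2) * norm (a - b)"
        by (rule mult_right_mono) (auto simp: \<epsilon>2_def)
      finally show ?thesis using \<epsilon>(2) by (simp add: algebra_simps)
    qed
    then show ?case using r'(1) sub r(2) qS by (intro exI[of _ r']) blast
  qed
  \<comment> \<open>The error \<open>n / 2\<close> is half of the derivative \<open>n\<close>: it
    leaves an expansion factor \<open>n / 2\<close>, hence injectivity, and gives the iteration
    below the contraction factor 1/2.\<close>
  obtain r where r: "r > 0" "ball a0 r \<subseteq> \<phi> ` U" "\<And>a. a \<in> ball a0 r \<Longrightarrow> \<psi> a [^] n \<in> U"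
    "\<And>a b. a \<in> ball a0 r \<Longrightarrow> b \<in> ball a0 r \<Longrightarrow>
      norm (q n a - q n b - real n *\<^sub>R (a - b)) \<le> (real n / 2) * norm (a - b)"
    using Q[of "real n / 2" n] n by auto
  have expand: "(real n / 2) * norm (a - b) \<le> norm (q n a - q n b)" if "a \<in> ball a0 r" "b \<in> ball a0 r" for a b
  proof -
    have "real n * norm (a - b) = norm (real n *\<^sub>R (a - b))" by simp
    also have "\<dots> \<le> norm (q n a - q n b) + norm (q n a - q n b - real n *\<^sub>R (a - b))"
      by (metis norm_triangle_sub norm_minus_commute)
    also have "\<dots> \<le> norm (q n a - q n b) + (real n / 2) * norm (a - b)" using r(4)[OF that] by simp
    finally show ?thesis by simp
  qed
  define R where "R = cball a0 (r / 2)"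
  have Rr: "R \<subseteq> ball a0 r" using r(1) by (auto simp: R_def)
  \<comment> \<open>For \<open>y\<close> in this ball the iteration moves the centre
    \<open>a0\<close> by less than \<open>r / 4\<close>; a contraction by 1/2 on a ball of radius
    \<open>r / 2\<close> contributes another \<open>r / 4\<close>, so the ball is mapped into
    itself.\<close>
  define Y where "Y = ball a0 (real n * r / 4)"
  have solve: "\<exists>a\<in>R. q n a = y" if y: "y \<in> Y" for y
  proof -
    \<comment> \<open>Newton's iteration for \<open>q n a = y\<close> with the derivative frozen at
      its value \<open>n\<close> at the identity; its fixed points are the solutions.\<close>
    define T where "T a = a - (q n a - y) /\<^sub>R real n" for a
    have Tdist: "dist (T a) (T b) \<le> (1 / 2) * dist a b" if "a \<in> R" "b \<in> R" for a b
    proof -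
      have "T a - T b = - ((q n a - q n b - real n *\<^sub>R (a - b)) /\<^sub>R real n)"
        using n by (simp add: T_def algebra_simps)
      then have "norm (T a - T b) = norm (q n a - q n b - real n *\<^sub>R (a - b)) / real n"
        by (simp add: divide_inverse_commute)
      also have "\<dots> \<le> ((real n / 2) * norm (a - b)) / real n"
        using r(4)[OF subsetD[OF Rr that(1)] subsetD[OF Rr that(2)]] by (rule divide_right_mono) simp
      finally show ?thesis using n by (simp add: dist_norm)
    qed
    have a0R: "a0 \<in> R" using r(1) by (simp add: R_def)
    have "T ` R \<subseteq> R"
    proof
      fix b assume "b \<in> T ` R"
      then obtain a where a: "a \<in> R" "b = T a" by auto
      have "T a0 - a0 = (y - a0) /\<^sub>R real n" by (simp add: T_def q0 algebra_simps)
      then have "dist (T a0) a0 = dist a0 y / real n"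
        by (simp add: dist_norm divide_inverse_commute norm_minus_commute)
      also have "\<dots> < (real n * r / 4) / real n" using y n by (intro divide_strict_right_mono) (auto simp: Y_def)
      finally have "dist (T a0) a0 < r / 4" using n by simp
      moreover have "dist (T a) (T a0) \<le> r / 4"
        using Tdist[OF a(1) a0R] a(1) by (simp add: R_def dist_commute)
      moreover have "dist (T a) a0 \<le> dist (T a) (T a0) + dist (T a0) a0" by (rule dist_triangle)
      ultimately show "b \<in> R" using a(2) by (simp add: R_def dist_commute)
    qed
    moreover have "complete R" using finite_dimensional_complete[OF fd] by (simp add: R_def)
    ultimately have "\<exists>!a. a \<in> R \<and> T a = a"
      using a0R Tdist by (intro Banach_fix[of R "1/2"]) auto
    then obtain a where "a \<in> R" "T a = a" by blast
    then show ?thesis using n by (intro bexI[of _ a]) (auto simp: T_def)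
  qed
  then obtain s where s: "\<And>y. y \<in> Y \<Longrightarrow> s y \<in> R \<and> q n (s y) = y" by metis
  have "continuous_on Y s"
  proof (rule lipschitz_on_continuous_on)
    show "(2 / real n)-lipschitz_on Y s"
    proof (rule lipschitz_onI)
      fix x y assume xy: "x \<in> Y" "y \<in> Y"
      have "(real n / 2) * dist (s x) (s y) \<le> dist x y"
        using expand[of "s x" "s y"] s[OF xy(1)] s[OF xy(2)] subsetD[OF Rr] unfolding dist_norm by metis
      then show "dist (s x) (s y) \<le> 2 / real n * dist x y" using n by (simp add: field_simps)
    qed simp
  qed
  moreover have "s ` Y \<subseteq> \<phi> ` U" using s Rr r(2) by blast
  ultimately have cs: "continuous_map (top_of_set Y) (top_of_set (\<phi> ` U)) s" by auto
  \<comment> \<open>Solvability gives the root on \<open>?V\<close>; the expansion estimate gives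
    uniqueness on \<open>?W\<close>, hence the triviality of n-torsion there.\<close>
  let ?V = "{g \<in> U. \<phi> g \<in> Y}" and ?W = "{g \<in> U. \<phi> g \<in> ball a0 r}"
  have pre: "openin (gtop G) {g \<in> U. \<phi> g \<in> B}" if "open B" for B
  proof -
    have "openin (subtopology (gtop G) U) {g \<in> topspace (subtopology (gtop G) U). \<phi> g \<in> B \<inter> \<phi> ` U}"
      using openin_open_Int[OF that, of "\<phi> ` U"]
      by (intro openin_continuous_map_preimage[OF c\<phi>]) (simp add: Int_commute)
    also have "{g \<in> topspace (subtopology (gtop G) U). \<phi> g \<in> B \<inter> \<phi> ` U} = {g \<in> U. \<phi> g \<in> B}" using UG by auto
    finally show ?thesis using oU openin_trans_full by blast
  qed
  show thesis
  proof (rule that)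
    show "openin (gtop G) ?V" "openin (gtop G) ?W" by (rule pre, simp add: Y_def, rule pre, simp)
    show "\<one> \<in> ?V" "\<one> \<in> ?W" using U\<phi>(2) r(1) n by (auto simp: Y_def a0_def)
    have "continuous_map (subtopology (gtop G) ?V) (top_of_set Y) \<phi>"
    proof -
      have "continuous_map (subtopology (gtop G) ?V) euclidean \<phi>"
        using c\<phi> by (auto simp: continuous_map_in_subtopology intro: continuous_map_from_subtopology_mono)
      then show ?thesis by (auto simp: continuous_map_in_subtopology)
    qed
    from continuous_map_comp[OF continuous_map_comp[OF this cs] c\<psi>]
    show "continuous_map (subtopology (gtop G) ?V) (gtop G) (\<lambda>g. \<psi> (s (\<phi> g)))" .
    show "\<forall>g\<in>?V. \<psi> (s (\<phi> g)) [^] n = g"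
    proof
      fix g assume g: "g \<in> ?V"
      have "\<phi> (\<psi> (s (\<phi> g)) [^] n) = \<phi> g" using s[of "\<phi> g"] g by (simp add: q_def)
      moreover have "\<psi> (s (\<phi> g)) [^] n \<in> U" using r(3) Rr s[of "\<phi> g"] g by blast
      ultimately show "\<psi> (s (\<phi> g)) [^] n = g" using inj g by (simp add: inj_on_eq_iff)
    qed
    show "\<forall>g\<in>?W. g [^] n = \<one> \<longrightarrow> g = \<one>"
    proof (intro ballI impI)
      fix g assume g: "g \<in> ?W" "g [^] n = \<one>"
      have "q n (\<phi> g) = q n a0" using g \<psi>\<phi> q0 by (simp add: q_def a0_def)
      moreover have "a0 \<in> ball a0 r" using r(1) by simp
      ultimately have "norm (\<phi> g - a0) \<le> 0" using expand[of "\<phi> g" a0] g n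
        by (simp add: mult_le_0_iff)
      then show "g = \<one>" using inj g U\<phi>(2) by (simp add: a0_def inj_on_eq_iff)
    qed
  qed
qed

section \<open>Roots of maps from the sphere to a connected abelian group\<close>

text \<open>Local constancy makes the preimage of every set of values open, so level sets are open
  and closed.\<close>

lemma connected_space_locally_constant:
  assumes X: "connected_space X"
    and loc: "\<And>x. x \<in> topspace X \<Longrightarrow> \<exists>U. openin X U \<and> x \<in> U \<and> (\<forall>y\<in>U. f y = f x)"
    and xy: "x \<in> topspace X" "y \<in> topspace X"
  shows "f x = f y"
proof -
  have op: "openin X {z \<in> topspace X. P (f z)}" for P
  proof (subst openin_subopen, intro ballI)
    fix z assume z: "z \<in> {z \<in> topspace X. P (f z)}"
    then obtain U where "openin X U" "z \<in> U" "\<forall>y\<in>U. f y = f z" using loc by blast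
    then show "\<exists>T. openin X T \<and> z \<in> T \<and> T \<subseteq> {z \<in> topspace X. P (f z)}"
      using z openin_subset by (intro exI[of _ U]) fastforce
  qed
  let ?A = "{z \<in> topspace X. f z = f x}"
  have "topspace X - ?A = {z \<in> topspace X. f z \<noteq> f x}" by auto
  then have "closedin X ?A" using op[of "\<lambda>w. w \<noteq> f x"] by (simp add: closedin_def)
  then have "?A = {} \<or> ?A = topspace X"
    using X op[of "\<lambda>w. w = f x"] unfolding connected_space_clopen_in by blast
  then have "y \<in> ?A" using xy by blast
  then show ?thesis by simp
qed

context top_group
begin

text \<open>The n-torsion of an abelian group is a subgroup, and it meets \<open>W\<close> only in
  1, so it is discrete: near \<open>z\<close> the quotient of \<open>c x\<close> by
  \<open>c z\<close> is torsion and lies in \<open>W\<close>, hence equals 1.\<close>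

lemma torsion_valued_constant:
  fixes n :: nat
  assumes W: "openin (gtop G) W" "\<one> \<in> W" "\<forall>g\<in>W. g [^] n = \<one> \<longrightarrow> g = \<one>"
    and comm: "comm_group G"
    and X: "connected_space X" and c: "continuous_map X (gtop G) c"
    and tors: "\<And>x. x \<in> topspace X \<Longrightarrow> c x [^] n = \<one>"
    and xy: "x \<in> topspace X" "y \<in> topspace X"
  shows "c x = c y"
proof (rule connected_space_locally_constant[OF X _ xy])
  interpret comm_group G by fact
  fix z assume z: "z \<in> topspace X"
  have cG: "c x \<in> carrier G" if "x \<in> topspace X" for x using continuous_map_closed[OF c that] .
  let ?U = "{x \<in> topspace X. inv (c z) \<otimes> c x \<in> W}"
  have "continuous_map X (gtop G) (\<lambda>x. inv (c z) \<otimes> c x)"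
    using cG[OF z] by (intro continuous_map_mult c) simp
  then have "openin X ?U" using W(1) by (rule openin_continuous_map_preimage)
  moreover have "c x = c z" if x: "x \<in> ?U" for x
  proof -
    have xX: "x \<in> topspace X" using x by simp
    have "(inv (c z) \<otimes> c x) [^] n = inv (c z [^] n) \<otimes> c x [^] n"
      using cG[OF z] cG[OF xX] by (simp add: pow_mult_distrib m_comm nat_pow_inv)
    then have "(inv (c z) \<otimes> c x) [^] n = \<one>" using tors z xX by simp
    then have "inv (c z) \<otimes> c x = \<one>" using W(3) x by blast
    then have "c z \<otimes> (inv (c z) \<otimes> c x) = c z \<otimes> \<one>" by simp
    then show ?thesis using cG[OF z] cG[OF xX] by (simp add: m_assoc[symmetric])
  qed
  moreover have "z \<in> ?U" using z cG[OF z] W(2) by simp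
  ultimately show "\<exists>U. openin X U \<and> z \<in> U \<and> (\<forall>y\<in>U. c y = c z)" by (intro exI conjI ballI)
qed

text \<open>The n-th powers form a subgroup because G is abelian, and this subgroup contains the
  neighbourhood \<open>V\<close> of 1. Being an n-th power is therefore locally constant on the
  connected group.\<close>

lemma root_exists:
  fixes n :: nat
  assumes V: "openin (gtop G) V" "\<one> \<in> V" "\<forall>u\<in>V. \<exists>h\<in>carrier G. h [^] n = u"
    and comm: "comm_group G" and conn: "connected_space (gtop G)" and g: "g \<in> carrier G"
  obtains h where "h \<in> carrier G" "h [^] n = g"
proof -
  interpret comm_group G by fact
  let ?P = "\<lambda>g. \<exists>h\<in>carrier G. h [^] n = g"
  have mult: "?P (a \<otimes> b)" if ab: "?P a" "?P b" for a b
  proof -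
    obtain h k where "h \<in> carrier G" "h [^] n = a" "k \<in> carrier G" "k [^] n = b" using ab by blast
    then show ?thesis by (intro bexI[of _ "h \<otimes> k"]) (auto simp: pow_mult_distrib m_comm)
  qed
  have inv: "?P (inv a)" if a: "?P a" for a
  proof -
    obtain h where "h \<in> carrier G" "h [^] n = a" using a by blast
    then show ?thesis by (intro bexI[of _ "inv h"]) (auto simp: nat_pow_inv)
  qed
  have "?P \<one> = ?P g"
  proof (rule connected_space_locally_constant[OF conn])
    fix z assume "z \<in> topspace (gtop G)"
    then have z: "z \<in> carrier G" by simp
    let ?U = "{x \<in> topspace (gtop G). inv z \<otimes> x \<in> V}"
    have "continuous_map (gtop G) (gtop G) (\<lambda>x. inv z \<otimes> x)"
      using z by (intro continuous_map_mult) auto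
    then have "openin (gtop G) ?U" using V(1) by (rule openin_continuous_map_preimage)
    moreover have "?P x = ?P z" if x: "x \<in> ?U" for x
    proof
      have xG: "x \<in> carrier G" and v: "?P (inv z \<otimes> x)" using x V(3) by auto
      { assume "?P z"
        from mult[OF this v] show "?P x" using z xG by (simp add: m_assoc[symmetric]) }
      { assume "?P x"
        moreover have "x \<otimes> inv (inv z \<otimes> x) = z"
        proof -
          have "x \<otimes> inv (inv z \<otimes> x) = x \<otimes> (inv x \<otimes> z)" using z xG by (simp add: inv_mult_group)
          then show ?thesis using z xG by (simp add: m_assoc[symmetric])
        qed
        ultimately show "?P z" using mult[OF _ inv[OF v], of x] by simp }
    qed
    moreover have "z \<in> ?U" using z V(2) by simp
    ultimately show "\<exists>U. openin (gtop G) U \<and> z \<in> U \<and> (\<forall>y\<in>U. ?P y = ?P z)" by (intro exI conjI ballI)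
  qed (use g in auto)
  moreover have "?P \<one>" by (intro bexI[of _ \<one>]) auto
  ultimately show thesis using that by blast
qed

text \<open>The homotopy is cut into steps that stay in the neighbourhood \<open>V\<close> on which roots can be chosen continuously.\<close>

lemma root_of_homotopy:
  fixes n :: nat and K :: "'a::metric_space set"
  assumes V: "openin (gtop G) V" "\<one> \<in> V" "continuous_map (subtopology (gtop G) V) (gtop G) \<sigma>"
      "\<forall>u\<in>V. \<sigma> u [^] n = u"
    and comm: "comm_group G" and K: "compact K"
    and f: "continuous_map (top_of_set ({0..1::real} \<times> K)) (gtop G) f"
    and b0: "continuous_map (top_of_set K) (gtop G) b0" "\<And>x. x \<in> K \<Longrightarrow> b0 x [^] n = f (0, x)"
  obtains b where "continuous_map (top_of_set K) (gtop G) b" "\<And>x. x \<in> K \<Longrightarrow> b x [^] n = f (1, x)"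
proof -
  interpret comm_group G by fact
  let ?I = "{0..1::real}"
  \<comment> \<open>The ratio of \<open>f\<close> at two times over one point. It is 1 on the
    diagonal, so by compactness it lies in \<open>V\<close> as soon as the times are closer than one
    uniform \<open>e\<close>.\<close>
  define d where "d = (\<lambda>(s, t, x). inv (f (s, x)) \<otimes> f (t, x))"
  have fG: "f z \<in> carrier G" if "z \<in> ?I \<times> K" for z using continuous_map_closed[OF f] that by simp
  have "continuous_map (top_of_set (?I \<times> ?I \<times> K)) (gtop G) (\<lambda>z. f (fst z, snd (snd z)))"
    "continuous_map (top_of_set (?I \<times> ?I \<times> K)) (gtop G) (\<lambda>z. f (fst (snd z), snd (snd z)))"
    by (rule continuous_map_comp[OF _ f]; force intro!: continuous_intros)+
  then have cd: "continuous_map (top_of_set (?I \<times> ?I \<times> K)) (gtop G) d"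
    unfolding d_def case_prod_unfold by (intro continuous_map_mult continuous_map_inv)
  obtain T where T: "open T" "{z \<in> ?I \<times> ?I \<times> K. d z \<in> V} = (?I \<times> ?I \<times> K) \<inter> T"
    using openin_continuous_map_preimage[OF cd V(1)] by (auto simp: openin_open)
  let ?\<Delta> = "(\<lambda>(t, x). (t, t, x)) ` (?I \<times> K)"
  have "compact ?\<Delta>"
    unfolding case_prod_unfold by (intro compact_continuous_image continuous_intros compact_Times K) auto
  moreover have "?\<Delta> \<subseteq> T"
  proof
    fix z assume "z \<in> ?\<Delta>"
    then obtain t x where z: "z = (t, t, x)" "t \<in> ?I" "x \<in> K" by auto
    then have "d z = \<one>" using fG[of "(t, x)"] by (simp add: d_def)
    then have "z \<in> {z \<in> ?I \<times> ?I \<times> K. d z \<in> V}" using z V(2) by simp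
    then show "z \<in> T" unfolding T(2) by simp
  qed
  ultimately obtain e where e: "e > 0" "\<And>z. z \<in> ?\<Delta> \<Longrightarrow> ball z e \<subseteq> T"
    using Heine_Borel_lemma[of ?\<Delta> "{T}"] T(1) by auto
  have dV: "inv (f (s, x)) \<otimes> f (t, x) \<in> V" if "s \<in> ?I" "t \<in> ?I" "x \<in> K" "dist s t < e" for s t x
  proof -
    have "(s, s, x) \<in> ?\<Delta>" using that by force
    then have "(s, t, x) \<in> T" using e(2)[of "(s, s, x)"] that by (auto simp: dist_Pair_Pair)
    then show ?thesis using T(2) that by (force simp: d_def)
  qed
  obtain M where M: "1 / real (Suc M) < e" using e(1) by (rule nat_approx_posE)
  define N where "N = Suc M"
  have N: "N > 0" "1 / real N < e" using M by (auto simp: N_def)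
  have "\<exists>b. continuous_map (top_of_set K) (gtop G) b \<and> (\<forall>x\<in>K. b x [^] n = f (real j / N, x))" if "j \<le> N" for j
    using that
  proof (induction j)
    case 0
    then show ?case using b0 by auto
  next
    case (Suc j)
    then obtain b where b: "continuous_map (top_of_set K) (gtop G) b" "\<And>x. x \<in> K \<Longrightarrow> b x [^] n = f (real j / N, x)"
      by auto
    let ?s = "real j / N" and ?t = "real (Suc j) / N"
    have st: "?s \<in> ?I" "?t \<in> ?I" using Suc.prems by (auto simp: divide_simps)
    have "dist ?s ?t = 1 / N" by (simp add: dist_real_def add_divide_distrib)
    then have uV: "inv (f (?s, x)) \<otimes> f (?t, x) \<in> V" if "x \<in> K" for x
      using dV[OF st that] N(2) by simp
    have ft: "continuous_map (top_of_set K) (gtop G) (\<lambda>x. f (t, x))" if "t \<in> ?I" for t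
      by (rule continuous_map_comp[OF _ f]) (use that in \<open>auto intro!: continuous_intros\<close>)
    \<comment> \<open>The root at the next time is the present one times the local root of the
      ratio; commutativity lets the n-th power pass through the product.\<close>
    have cs: "continuous_map (top_of_set K) (gtop G) (\<lambda>x. \<sigma> (inv (f (?s, x)) \<otimes> f (?t, x)))"
      by (rule continuous_map_comp_subtopology[OF
            continuous_map_mult[OF continuous_map_inv[OF ft[OF st(1)]] ft[OF st(2)]] _ V(3)])
         (use uV in simp)
    have "(b x \<otimes> \<sigma> (inv (f (?s, x)) \<otimes> f (?t, x))) [^] n = f (?t, x)" if x: "x \<in> K" for x
    proof -
      have "b x \<in> carrier G" "\<sigma> (inv (f (?s, x)) \<otimes> f (?t, x)) \<in> carrier G"
        using continuous_map_closed[OF b(1)] continuous_map_closed[OF cs] x by auto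
      then have "(b x \<otimes> \<sigma> (inv (f (?s, x)) \<otimes> f (?t, x))) [^] n = f (?s, x) \<otimes> (inv (f (?s, x)) \<otimes> f (?t, x))"
        using b(2)[OF x] bspec[OF V(4) uV[OF x]] by (simp add: pow_mult_distrib m_comm)
      also have "\<dots> = f (?t, x)" using fG[of "(?s, x)"] fG[of "(?t, x)"] st x by (simp add: m_assoc[symmetric])
      finally show ?thesis .
    qed
    then show ?case using continuous_map_mult[OF b(1) cs] by blast
  qed
  from this[of N] show thesis using N(1) that by auto
qed

end

section \<open>Roots on hemispheres and their gluing\<close>

text \<open>The equator is the image of the complex unit circle under the embedding of the plane as
  the first two coordinates.\<close>

lemma connected_equator: "connected {x :: real^3. norm x = 1 \<and> axis 3 1 \<bullet> x = 0}" (is "connected ?Q")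
proof -
  define j :: "complex \<Rightarrow> real^3" where "j z = (\<chi> i. if i = 1 then Re z else if i = 2 then Im z else 0)" for z
  have comp: "j z $ 1 = Re z" "j z $ 2 = Im z" "j z $ 3 = 0" for z by (simp_all add: j_def)
  have norm: "norm x = sqrt ((x $ 1)\<^sup>2 + (x $ 2)\<^sup>2 + (x $ 3)\<^sup>2)" for x :: "real^3"
    by (simp add: norm_vec_def L2_set_def sum_3)
  have "?Q = j ` sphere 0 1"
  proof (intro subset_antisym subsetI)
    fix x assume x: "x \<in> ?Q"
    then have x3: "x $ 3 = 0" by (simp add: inner_axis')
    have "x = j (Complex (x $ 1) (x $ 2))" using x3 by (simp add: vec_eq_iff forall_3 comp)
    moreover have "norm (Complex (x $ 1) (x $ 2)) = 1" using x x3 by (simp add: norm cmod_def)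
    ultimately show "x \<in> j ` sphere 0 1" by auto
  next
    fix x assume "x \<in> j ` sphere 0 1"
    then show "x \<in> ?Q" by (auto simp: inner_axis' comp norm cmod_def)
  qed
  moreover have "continuous_on UNIV j"
    unfolding j_def
  proof (intro continuous_on_vec_lambda)
    fix i :: 3
    show "continuous_on UNIV (\<lambda>z. if i = 1 then Re z else if i = 2 then Im z else 0)"
      by (cases "i = 1"; cases "i = 2") (auto intro!: continuous_intros)
  qed
  moreover have "connected (sphere (0::complex) 1)" by (rule connected_sphere) simp
  ultimately show ?thesis using connected_continuous_image continuous_on_subset by (metis subset_UNIV)
qed

context top_group
begin

text \<open>The hemisphere contracts to its pole \<open>a\<close> along radially normalised
  segments. At time 0 the composite with \<open>P\<close> is constant, where a root of
  \<open>P a\<close> exists; the homotopy carries it to a root of \<open>P\<close> at time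
  1.\<close>

lemma hemisphere_root:
  fixes n :: nat and a :: "'a::euclidean_space"
  assumes V: "openin (gtop G) V" "\<one> \<in> V" "continuous_map (subtopology (gtop G) V) (gtop G) \<sigma>"
      "\<forall>u\<in>V. \<sigma> u [^] n = u"
    and comm: "comm_group G" and conn: "connected_space (gtop G)"
    and P: "continuous_map (top_of_set (sphere 0 1)) (gtop G) P" and a: "norm a = 1"
  obtains b where "continuous_map (top_of_set {x \<in> sphere 0 1. 0 \<le> a \<bullet> x}) (gtop G) b"
    "\<And>x. x \<in> sphere 0 1 \<Longrightarrow> 0 \<le> a \<bullet> x \<Longrightarrow> b x [^] n = P x"
proof -
  let ?K = "{x \<in> sphere 0 1. 0 \<le> a \<bullet> x}" and ?I = "{0..1::real}"
  define p where "p z = (1 - fst z) *\<^sub>R a + fst z *\<^sub>R snd z" for z :: "real \<times> 'a"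
  \<comment> \<open>The inner product with the pole is \<open>(1 - t) + t * (a \<bullet> x)\<close>,
    which vanishes on the closed hemisphere only if \<open>t = 1\<close>; but then the point is
    \<open>x\<close> itself.\<close>
  have p: "p z \<noteq> 0" if z: "z \<in> ?I \<times> ?K" for z
  proof
    assume "p z = 0"
    obtain t x where tx: "z = (t, x)" "0 \<le> t" "t \<le> 1" "norm x = 1" "0 \<le> a \<bullet> x" using z by (cases z) auto
    have "a \<bullet> p z = (1 - t) + t * (a \<bullet> x)" using a by (simp add: p_def tx(1) inner_add_right dot_square_norm)
    then have "(1 - t) + t * (a \<bullet> x) = 0" using \<open>p z = 0\<close> by simp
    moreover have "t * (a \<bullet> x) \<ge> 0" using tx by simp
    ultimately have "t = 1" using tx by linarith
    then show False using \<open>p z = 0\<close> tx by (auto simp: p_def)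
  qed
  define f where "f z = P (sgn (p z))" for z
  have "continuous_on (?I \<times> ?K) (\<lambda>z. sgn (p z))"
  proof (rule continuous_on_sgn)
    show "continuous_on (?I \<times> ?K) p" unfolding p_def by (intro continuous_intros)
  qed (use p in blast)
  moreover have "sgn (p z) \<in> sphere 0 1" if "z \<in> ?I \<times> ?K" for z using p[OF that] by (simp add: norm_sgn)
  ultimately have "continuous_map (top_of_set (?I \<times> ?K)) (top_of_set (sphere 0 1)) (\<lambda>z. sgn (p z))"
    by simp
  then have f: "continuous_map (top_of_set (?I \<times> ?K)) (gtop G) f"
    unfolding f_def using P by (rule continuous_map_comp)
  have "compact ?K"
  proof -
    have "?K = sphere 0 1 \<inter> {x. 0 \<le> a \<bullet> x}" by auto
    then show ?thesis by (simp add: compact_Int_closed closed_halfspace_ge)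
  qed
  have Pa: "P a \<in> carrier G" using continuous_map_closed[OF P] a by simp
  have \<sigma>G: "\<sigma> u \<in> carrier G" if "u \<in> V" for u
    using continuous_map_closed[OF V(3)] that openin_subset[OF V(1)] by auto
  obtain g where g: "g \<in> carrier G" "g [^] n = P a"
    by (rule root_exists[OF V(1,2) _ comm conn Pa]) (use V(4) \<sigma>G in blast)
  have cg: "continuous_map (top_of_set ?K) (gtop G) (\<lambda>_. g)" using g by simp
  show thesis
  proof (rule root_of_homotopy[OF V comm \<open>compact ?K\<close> f cg])
    show "g [^] n = f (0, x)" if "x \<in> ?K" for x using g a by (simp add: f_def p_def sgn_div_norm)
    fix b assume b: "continuous_map (top_of_set ?K) (gtop G) b" "\<And>x. x \<in> ?K \<Longrightarrow> b x [^] n = f (1, x)"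
    show thesis
      by (rule that[OF b(1)]) (use b(2) in \<open>simp add: f_def p_def sgn_div_norm\<close>)
  qed
qed

text \<open>Roots over the two closed hemispheres differ on the equator by an n-torsion element. As
  the equator is connected this element is constant, and multiplying one of the roots by it changes
  no n-th power but makes the two agree.\<close>

lemma sphere_root:
  fixes n :: nat
  assumes V: "openin (gtop G) V" "\<one> \<in> V" "continuous_map (subtopology (gtop G) V) (gtop G) \<sigma>"
      "\<forall>u\<in>V. \<sigma> u [^] n = u"
    and W: "openin (gtop G) W" "\<one> \<in> W" "\<forall>g\<in>W. g [^] n = \<one> \<longrightarrow> g = \<one>"
    and comm: "comm_group G" and conn: "connected_space (gtop G)"
    and P: "continuous_map S2 (gtop G) P"
  obtains b where "continuous_map S2 (gtop G) b" "\<And>x. x \<in> sphere 0 1 \<Longrightarrow> b x [^] n = P x"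
proof -
  interpret comm_group G by fact
  let ?a = "axis 3 1 :: real^3" and ?S = "sphere (0::real^3) 1"
  have na: "norm ?a = 1" "norm (- ?a) = 1" by auto
  obtain b1 where b1: "continuous_map (top_of_set {x \<in> ?S. 0 \<le> ?a \<bullet> x}) (gtop G) b1"
    "\<And>x. x \<in> ?S \<Longrightarrow> 0 \<le> ?a \<bullet> x \<Longrightarrow> b1 x [^] n = P x"
    using hemisphere_root[OF V comm conn P na(1)] by blast
  obtain b2 where b2: "continuous_map (top_of_set {x \<in> ?S. 0 \<le> - ?a \<bullet> x}) (gtop G) b2"
    "\<And>x. x \<in> ?S \<Longrightarrow> 0 \<le> - ?a \<bullet> x \<Longrightarrow> b2 x [^] n = P x"
    using hemisphere_root[OF V comm conn P na(2)] by blast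
  let ?Q = "{x :: real^3. norm x = 1 \<and> ?a \<bullet> x = 0}"
  have PG: "P x \<in> carrier G" if "x \<in> ?S" for x using continuous_map_closed[OF P] that by simp
  have b1G: "b1 x \<in> carrier G" if "x \<in> ?S" "0 \<le> ?a \<bullet> x" for x using continuous_map_closed[OF b1(1)] that by simp
  have b2G: "b2 x \<in> carrier G" if "x \<in> ?S" "?a \<bullet> x \<le> 0" for x using continuous_map_closed[OF b2(1)] that by simp
  define c where "c x = inv (b2 x) \<otimes> b1 x" for x
  have cc: "continuous_map (top_of_set ?Q) (gtop G) c"
    unfolding c_def
    by (intro continuous_map_mult continuous_map_inv continuous_map_from_subtopology_mono[OF b1(1)]
        continuous_map_from_subtopology_mono[OF b2(1)]) auto
  have ctors: "c x [^] n = \<one>" if x: "x \<in> ?Q" for x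
    using b1G[of x] b2G[of x] b1(2)[of x] b2(2)[of x] PG[of x] x
    by (simp add: c_def pow_mult_distrib m_comm nat_pow_inv)
  have connQ: "connected_space (top_of_set ?Q)" using connected_equator by (simp flip: connectedin_iff_connected add: connectedin_def)
  \<comment> \<open>The correction is the value at any point of the equator; the value 1 serves the
    case of an empty equator, so that no point has to be exhibited.\<close>
  obtain t where t: "t \<in> carrier G" "t [^] n = \<one>" "\<And>x. x \<in> ?Q \<Longrightarrow> c x = t"
  proof (cases "?Q = {}")
    case False
    then obtain q where q: "q \<in> ?Q" by blast
    show ?thesis
    proof (rule that)
      show "c q \<in> carrier G" using continuous_map_closed[OF cc] q by simp
      show "c q [^] n = \<one>" using ctors[OF q] .
      show "c x = c q" if "x \<in> ?Q" for x
        by (rule torsion_valued_constant[OF W comm connQ cc]) (use ctors q that in auto)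
    qed
  qed (use that[of \<one>] in auto)
  define b where "b x = (if ?a \<bullet> x \<le> 0 then b2 x \<otimes> t else b1 x)" for x
  have "continuous_map S2 (gtop G) b"
    unfolding b_def
  proof (rule continuous_map_cases_le)
    show "continuous_map S2 euclideanreal (\<lambda>x. ?a \<bullet> x)" "continuous_map S2 euclideanreal (\<lambda>_. 0)"
      by (auto intro!: continuous_intros)
    have eq: "subtopology S2 {x \<in> topspace S2. ?a \<bullet> x \<le> 0} = top_of_set {x \<in> ?S. 0 \<le> - ?a \<bullet> x}"
      "subtopology S2 {x \<in> topspace S2. 0 \<le> ?a \<bullet> x} = top_of_set {x \<in> ?S. 0 \<le> ?a \<bullet> x}"
      by (auto simp: subtopology_subtopology intro: arg_cong[of _ _ "subtopology euclidean"])
    show "continuous_map (subtopology S2 {x \<in> topspace S2. ?a \<bullet> x \<le> 0}) (gtop G) (\<lambda>x. b2 x \<otimes> t)"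
      unfolding eq using t(1) by (intro continuous_map_mult b2(1)) simp
    show "continuous_map (subtopology S2 {x \<in> topspace S2. 0 \<le> ?a \<bullet> x}) (gtop G) b1"
      unfolding eq by (rule b1(1))
    fix x assume "x \<in> topspace S2" "?a \<bullet> x = 0"
    then have x: "x \<in> ?Q" "x \<in> ?S" by auto
    then have "b2 x \<otimes> t = b2 x \<otimes> (inv (b2 x) \<otimes> b1 x)" using t(3)[OF x(1)] by (simp add: c_def)
    also have "\<dots> = b1 x" using b1G[of x] b2G[of x] x by (simp add: m_assoc[symmetric])
    finally show "b2 x \<otimes> t = b1 x" .
  qed
  moreover have "b x [^] n = P x" if "x \<in> ?S" for x
    using b1(2)[of x] b2(2)[of x] b2G[of x] t that PG[OF that] by (simp add: b_def pow_mult_distrib m_comm)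
  ultimately show thesis by (rule that)
qed

end

section \<open>Equivariant isomorphisms\<close>

text \<open>Euler's theorem on the rotation axis. Multiplying the transpose of A - 1 by A gives -(A
  - 1); since det A = 1 and the dimension is odd, det (A - 1) equals its own negative. A kernel
  vector is then normalised.\<close>

lemma SO3_fixed_point:
  assumes "A \<in> carrier SO3"
  obtains x :: "real^3" where "norm x = 1" "A *v x = x"
proof -
  have A: "orthogonal_matrix A" "det A = 1" using assms by (auto simp: SO3_def rotation_matrix_def)
  let ?M = "A - mat 1"
  have neg: "det (- M) = - det M" for M :: "real^3^3" by (simp add: det_3 algebra_simps)
  have "A ** (transpose A - mat 1) = - ?M"
  proof -
    have "A ** (transpose A - mat 1) = A ** transpose A - A ** mat 1"
      by (simp add: matrix_matrix_mult_def vec_eq_iff sum_subtractf right_diff_distrib)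
    then show ?thesis using A(1) by (simp add: orthogonal_matrix_def)
  qed
  moreover have "transpose ?M = transpose A - mat 1" by (simp add: transpose_def mat_def vec_eq_iff)
  ultimately have "A ** transpose ?M = - ?M" by simp
  then have "det A * det (transpose ?M) = - det ?M" using neg by (metis det_mul)
  then have "det ?M = 0" using A(2) by (simp add: det_transpose)
  then have "\<not> invertible ?M" by (simp add: invertible_det_nz)
  then obtain y where y: "?M *v y = 0" "y \<noteq> 0"
    unfolding invertible_left_inverse matrix_left_invertible_ker by blast
  then have "A *v y = y" by (simp add: matrix_vector_mult_diff_rdistrib)
  then have "A *v sgn y = sgn y" by (simp add: sgn_div_norm matrix_vector_mult_scaleR)
  moreover have "norm (sgn y) = 1" using y(2) by (simp add: norm_sgn)
  ultimately show thesis using that by blast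
qed


lemma continuous_map_finprod:
  assumes "topological_group G" "comm_group G" "finite A"
    and "\<And>i. i \<in> A \<Longrightarrow> continuous_map X (gtop G) (f i)"
  shows "continuous_map X (gtop G) (\<lambda>x. finprod G (\<lambda>i. f i x) A)"
proof -
  interpret top_group G by (rule top_group.intro) fact
  interpret comm_group G by fact
  show ?thesis
    using assms(3,4)
  proof induction
    case (insert i A)
    have "continuous_map X (gtop G) (\<lambda>x. f i x \<otimes>\<^bsub>G\<^esub> finprod G (\<lambda>i. f i x) A)"
      using insert by (intro continuous_map_mult) auto
    then show ?case
    proof (rule continuous_map_eq)
      fix x assume x: "x \<in> topspace X"
      have "f j x \<in> carrier G" if "j \<in> insert i A" for j
        using continuous_map_closed[OF insert.prems[OF that] x] .
      then show "f i x \<otimes>\<^bsub>G\<^esub> finprod G (\<lambda>i. f i x) A = finprod G (\<lambda>i. f i x) (insert i A)"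
        using insert.hyps by (subst finprod_insert) auto
    qed
  qed simp
qed

text \<open>The cohomological part, valid over any connected base on which continuous maps to G have
  n-th roots and every group element has a fixed point. The geometry of the sphere enters only
  through these assumptions.\<close>

lemma equivariantly_isomorphic_if_bundle_map:
  fixes \<xi>1 :: "('e1, 'x, 'g, 'c, 'n1) equivariant_bundle_scheme"
    and \<xi>2 :: "('e2, 'x, 'g, 'c, 'n2) equivariant_bundle_scheme"
  assumes 1: "equivariant_principal_bundle G \<Gamma> X a \<xi>1" and 2: "equivariant_principal_bundle G \<Gamma> X a \<xi>2"
    and comm: "comm_group G" and fin: "finite (carrier \<Gamma>)" and conn: "connected_space X"
    and iso: "same_isotropy_representations G \<Gamma> X a \<xi>1 \<xi>2"
    and \<Phi>: "bundle_map G \<xi>1 \<xi>2 (\<lambda>x. x) \<Phi>"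
    and W: "openin (gtop G) W" "\<one>\<^bsub>G\<^esub> \<in> W"
      "\<forall>g\<in>W. g [^]\<^bsub>G\<^esub> card (carrier \<Gamma>) = \<one>\<^bsub>G\<^esub> \<longrightarrow> g = \<one>\<^bsub>G\<^esub>"
    and root: "\<And>P. continuous_map X (gtop G) P \<Longrightarrow>
      \<exists>b. continuous_map X (gtop G) b \<and> (\<forall>x\<in>topspace X. b x [^]\<^bsub>G\<^esub> card (carrier \<Gamma>) = P x)"
    and fixpt: "\<And>\<gamma>. \<gamma> \<in> carrier \<Gamma> \<Longrightarrow> \<exists>x\<in>topspace X. a \<gamma> x = x"
  shows "equivariantly_isomorphic G \<Gamma> \<xi>1 \<xi>2"
proof -
  have pb: "principal_bundle G X \<xi>1" "principal_bundle G X \<xi>2"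
    using 1 2 by (auto simp: equivariant_principal_bundle_def)
  interpret P1: principal G X \<xi>1 by (rule principal.intro) fact
  interpret P2: principal G X \<xi>2 by (rule principal.intro) fact
  interpret comm_group G by fact
  have left: "left_space \<Gamma> X a" "left_space \<Gamma> (total \<xi>1) (lact \<xi>1)" "left_space \<Gamma> (total \<xi>2) (lact \<xi>2)"
    using 1 2 by (auto simp: equivariant_principal_bundle_def)
  interpret \<Gamma>: group \<Gamma> using left(1) by (simp add: left_space_def)
  let ?n = "card (carrier \<Gamma>)"
  define L1 where "L1 = lact \<xi>1"
  define L2 where "L2 = lact \<xi>2"
  define p where "p = proj \<xi>1"
  have ca: "continuous_map X X (a \<gamma>)" and cL1: "continuous_map (total \<xi>1) (total \<xi>1) (L1 \<gamma>)"
    and cL2: "continuous_map (total \<xi>2) (total \<xi>2) (L2 \<gamma>)" if "\<gamma> \<in> carrier \<Gamma>" for \<gamma>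
    using left that by (auto simp: left_space_def L1_def L2_def)
  have aX: "a \<gamma> x \<in> topspace X" if "\<gamma> \<in> carrier \<Gamma>" "x \<in> topspace X" for \<gamma> x
    using continuous_map_image_subset_topspace[OF ca[OF that(1)]] that(2) by auto
  have L1E: "L1 \<gamma> e \<in> P1.E" if "\<gamma> \<in> carrier \<Gamma>" "e \<in> P1.E" for \<gamma> e
    using continuous_map_image_subset_topspace[OF cL1[OF that(1)]] that(2) by auto
  have L2E: "L2 \<gamma> e \<in> P2.E" if "\<gamma> \<in> carrier \<Gamma>" "e \<in> P2.E" for \<gamma> e
    using continuous_map_image_subset_topspace[OF cL2[OF that(1)]] that(2) by auto
  have L1m: "L1 (\<gamma> \<otimes>\<^bsub>\<Gamma>\<^esub> \<delta>) e = L1 \<gamma> (L1 \<delta> e)" if "\<gamma> \<in> carrier \<Gamma>" "\<delta> \<in> carrier \<Gamma>" "e \<in> P1.E" for \<gamma> \<delta> e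
    using left(2) that by (simp add: left_space_def L1_def)
  have L2m: "L2 (\<gamma> \<otimes>\<^bsub>\<Gamma>\<^esub> \<delta>) e = L2 \<gamma> (L2 \<delta> e)" if "\<gamma> \<in> carrier \<Gamma>" "\<delta> \<in> carrier \<Gamma>" "e \<in> P2.E" for \<gamma> \<delta> e
    using left(3) that by (simp add: left_space_def L2_def)
  have pL1: "p (L1 \<gamma> e) = a \<gamma> (p e)" if "\<gamma> \<in> carrier \<Gamma>" "e \<in> P1.E" for \<gamma> e
    using 1 that by (simp add: equivariant_principal_bundle_def L1_def p_def)
  have pL2: "proj \<xi>2 (L2 \<gamma> e) = a \<gamma> (proj \<xi>2 e)" if "\<gamma> \<in> carrier \<Gamma>" "e \<in> P2.E" for \<gamma> e
    using 2 that by (simp add: equivariant_principal_bundle_def L2_def)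
  have L1g: "L1 \<gamma> (ract \<xi>1 e g) = ract \<xi>1 (L1 \<gamma> e) g" if "\<gamma> \<in> carrier \<Gamma>" "g \<in> carrier G" "e \<in> P1.E" for \<gamma> g e
    using 1 that by (simp add: equivariant_principal_bundle_def L1_def)
  have L2g: "L2 \<gamma> (ract \<xi>2 e g) = ract \<xi>2 (L2 \<gamma> e) g" if "\<gamma> \<in> carrier \<Gamma>" "g \<in> carrier G" "e \<in> P2.E" for \<gamma> g e
    using 2 that by (simp add: equivariant_principal_bundle_def L2_def)
  have c\<Phi>: "continuous_map (total \<xi>1) (total \<xi>2) \<Phi>"
    and p\<Phi>: "\<And>e. e \<in> P1.E \<Longrightarrow> proj \<xi>2 (\<Phi> e) = p e"
    and \<Phi>g: "\<And>e g. e \<in> P1.E \<Longrightarrow> g \<in> carrier G \<Longrightarrow> \<Phi> (ract \<xi>1 e g) = ract \<xi>2 (\<Phi> e) g"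
    using \<Phi> by (auto simp: bundle_map_def p_def)
  have \<Phi>E: "\<Phi> e \<in> P2.E" if "e \<in> P1.E" for e using bundle_map_closed[OF \<Phi> that] .
  define u where "u \<gamma> e = P2.translation (L2 \<gamma> (\<Phi> e)) (\<Phi> (L1 \<gamma> e))" for \<gamma> e
  have u: "u \<gamma> e \<in> carrier G" "ract \<xi>2 (L2 \<gamma> (\<Phi> e)) (u \<gamma> e) = \<Phi> (L1 \<gamma> e)"
    if "\<gamma> \<in> carrier \<Gamma>" "e \<in> P1.E" for \<gamma> e
    using P2.translation[of "L2 \<gamma> (\<Phi> e)" "\<Phi> (L1 \<gamma> e)"] that
    by (simp_all add: u_def L2E L1E \<Phi>E pL2 p\<Phi> pL1)
  have u_eqI: "u \<gamma> e = g" if "\<gamma> \<in> carrier \<Gamma>" "e \<in> P1.E" "g \<in> carrier G" "ract \<xi>2 (L2 \<gamma> (\<Phi> e)) g = \<Phi> (L1 \<gamma> e)" for \<gamma> e g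
    using P2.translation_ract[OF L2E[OF that(1) \<Phi>E[OF that(2)]] that(3)] that(4) by (simp add: u_def)
  \<comment> \<open>Moving \<open>e\<close> by \<open>g\<close> conjugates the defect by
    \<open>g\<close>, which is invisible in an abelian group; so the defect descends to the
    base.\<close>
  have ug: "u \<gamma> (ract \<xi>1 e g) = u \<gamma> e" if "\<gamma> \<in> carrier \<Gamma>" "e \<in> P1.E" "g \<in> carrier G" for \<gamma> e g
  proof (rule u_eqI)
    have E: "L2 \<gamma> (\<Phi> e) \<in> P2.E" using that by (simp add: L2E \<Phi>E)
    have "ract \<xi>2 (L2 \<gamma> (\<Phi> (ract \<xi>1 e g))) (u \<gamma> e) = ract \<xi>2 (L2 \<gamma> (\<Phi> e)) (g \<otimes>\<^bsub>G\<^esub> u \<gamma> e)"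
      using that u(1) by (simp add: \<Phi>g L2g \<Phi>E P2.ract_mult[OF E])
    also have "\<dots> = ract \<xi>2 (ract \<xi>2 (L2 \<gamma> (\<Phi> e)) (u \<gamma> e)) g"
      using that u(1) by (simp add: m_comm[of g] P2.ract_mult[OF E])
    also have "\<dots> = \<Phi> (L1 \<gamma> (ract \<xi>1 e g))" using that by (simp add: u(2) L1g \<Phi>g L1E)
    finally show "ract \<xi>2 (L2 \<gamma> (\<Phi> (ract \<xi>1 e g))) (u \<gamma> e) = \<Phi> (L1 \<gamma> (ract \<xi>1 e g))" .
  qed (use that u(1) P1.ract_closed in auto)
  define c where "c \<gamma> x = u \<gamma> (SOME e. e \<in> P1.E \<and> p e = x)" for \<gamma> x
  have cu: "c \<gamma> (p e) = u \<gamma> e" if \<gamma>: "\<gamma> \<in> carrier \<Gamma>" and e: "e \<in> P1.E" for \<gamma> e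
  proof -
    define e' where "e' = (SOME e'. e' \<in> P1.E \<and> p e' = p e)"
    have e': "e' \<in> P1.E \<and> p e' = p e" unfolding e'_def by (rule someI[of _ e]) (use e in simp)
    then obtain g where "g \<in> carrier G" "e' = ract \<xi>1 e g"
      using P1.translation[of e e'] e unfolding p_def by metis
    then show ?thesis using ug[OF \<gamma> e] by (simp add: c_def e'_def[symmetric])
  qed
  have cG: "c \<gamma> x \<in> carrier G" if "\<gamma> \<in> carrier \<Gamma>" "x \<in> topspace X" for \<gamma> x
    using P1.fibre_nonempty[OF that(2)] cu[OF that(1)] u(1)[OF that(1)] unfolding p_def by metis
  have cont_c: "continuous_map X (gtop G) (c \<gamma>)" if \<gamma>: "\<gamma> \<in> carrier \<Gamma>" for \<gamma>
  proof (rule continuous_map_locally_eq)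
    fix x assume "x \<in> topspace X"
    then obtain U s \<kappa> where U: "x \<in> U" "local_triv G X \<xi>1 U s \<kappa>"
      using P1.local_triv_exists by blast
    have s: "continuous_map (subtopology X U) (total \<xi>1) s" and o: "openin X U"
      and ps: "\<And>y. y \<in> U \<Longrightarrow> p (s y) = y"
      using U by (auto simp: local_triv_def p_def)
    have sE: "s y \<in> P1.E" if "y \<in> U" for y using local_triv_closed(1)[OF U(2) that] .
    have "continuous_map (subtopology X U) (gtop G) (\<lambda>y. u \<gamma> (s y))"
      unfolding u_def
    proof (rule P2.continuous_map_translation)
      show "continuous_map (subtopology X U) (total \<xi>2) (\<lambda>y. L2 \<gamma> (\<Phi> (s y)))"
        by (rule continuous_map_comp[OF continuous_map_comp[OF s c\<Phi>] cL2[OF \<gamma>]])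
      show "continuous_map (subtopology X U) (total \<xi>2) (\<lambda>y. \<Phi> (L1 \<gamma> (s y)))"
        by (rule continuous_map_comp[OF continuous_map_comp[OF s cL1[OF \<gamma>]] c\<Phi>])
    qed (use sE \<gamma> in \<open>simp add: pL2 p\<Phi> pL1 L1E \<Phi>E\<close>)
    moreover have "\<forall>y\<in>U. c \<gamma> y = u \<gamma> (s y)" using cu[OF \<gamma> sE] ps by simp
    ultimately show "\<exists>U g. openin X U \<and> x \<in> U \<and> continuous_map (subtopology X U) (gtop G) g \<and> (\<forall>z\<in>U. c \<gamma> z = g z)"
      using o U(1) by blast
  qed
  \<comment> \<open>The defects along e, \<delta>e, \<gamma>\<delta>e multiply, the second being
    taken over the translated point \<open>a \<delta> x\<close>.\<close>
  have cocycle: "c (\<gamma> \<otimes>\<^bsub>\<Gamma>\<^esub> \<delta>) x = c \<delta> x \<otimes>\<^bsub>G\<^esub> c \<gamma> (a \<delta> x)"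
    if \<gamma>: "\<gamma> \<in> carrier \<Gamma>" and \<delta>: "\<delta> \<in> carrier \<Gamma>" and x: "x \<in> topspace X" for \<gamma> \<delta> x
  proof -
    obtain e where e: "e \<in> P1.E" "p e = x" using P1.fibre_nonempty[OF x] unfolding p_def .
    have E: "L2 \<gamma> (L2 \<delta> (\<Phi> e)) \<in> P2.E" using \<gamma> \<delta> e by (simp add: L2E \<Phi>E)
    have "u (\<gamma> \<otimes>\<^bsub>\<Gamma>\<^esub> \<delta>) e = u \<delta> e \<otimes>\<^bsub>G\<^esub> u \<gamma> (L1 \<delta> e)"
    proof (rule u_eqI)
      have "ract \<xi>2 (L2 (\<gamma> \<otimes>\<^bsub>\<Gamma>\<^esub> \<delta>) (\<Phi> e)) (u \<delta> e \<otimes>\<^bsub>G\<^esub> u \<gamma> (L1 \<delta> e)) =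
          ract \<xi>2 (ract \<xi>2 (L2 \<gamma> (L2 \<delta> (\<Phi> e))) (u \<delta> e)) (u \<gamma> (L1 \<delta> e))"
        using \<gamma> \<delta> e u(1) L1E by (simp add: L2m \<Phi>E P2.ract_mult[OF E])
      also have "\<dots> = ract \<xi>2 (L2 \<gamma> (\<Phi> (L1 \<delta> e))) (u \<gamma> (L1 \<delta> e))"
        using \<gamma> \<delta> e u by (simp add: L2g[symmetric] L2E \<Phi>E)
      also have "\<dots> = \<Phi> (L1 (\<gamma> \<otimes>\<^bsub>\<Gamma>\<^esub> \<delta>) e)" using \<gamma> \<delta> e by (simp add: u(2) L1E L1m)
      finally show "ract \<xi>2 (L2 (\<gamma> \<otimes>\<^bsub>\<Gamma>\<^esub> \<delta>) (\<Phi> e)) (u \<delta> e \<otimes>\<^bsub>G\<^esub> u \<gamma> (L1 \<delta> e)) = \<Phi> (L1 (\<gamma> \<otimes>\<^bsub>\<Gamma>\<^esub> \<delta>) e)" .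
    qed (use \<gamma> \<delta> e u(1) L1E in auto)
    then show ?thesis
      using cu[OF \<Gamma>.m_closed[OF \<gamma> \<delta>] e(1)] cu[OF \<delta> e(1)] cu[OF \<gamma> L1E[OF \<delta> e(1)]] e(2) pL1[OF \<delta> e(1)] by simp
  qed
  define P where "P x = finprod G (\<lambda>\<gamma>. c \<gamma> x) (carrier \<Gamma>)" for x
  have PG: "P x \<in> carrier G" if "x \<in> topspace X" for x
    unfolding P_def using cG that by (intro finprod_closed) auto
  have "continuous_map X (gtop G) P"
    unfolding P_def by (rule continuous_map_finprod[OF P1.topological_group comm fin cont_c])
  then obtain b where b: "continuous_map X (gtop G) b" "\<And>x. x \<in> topspace X \<Longrightarrow> b x [^]\<^bsub>G\<^esub> ?n = P x"
    using root by blast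
  have bG: "b x \<in> carrier G" if "x \<in> topspace X" for x using P1.continuous_map_closed[OF b(1) that] .
  \<comment> \<open>Right multiplication by \<open>\<delta>\<close> permutes the group. Reindexing
    the product and applying the cocycle identity to each factor splits off n copies of
    \<open>c \<delta> x\<close>.\<close>
  have P: "P x = c \<delta> x [^]\<^bsub>G\<^esub> ?n \<otimes>\<^bsub>G\<^esub> P (a \<delta> x)" if \<delta>: "\<delta> \<in> carrier \<Gamma>" and x: "x \<in> topspace X" for \<delta> x
  proof -
    have "(\<lambda>\<gamma>. \<gamma> \<otimes>\<^bsub>\<Gamma>\<^esub> \<delta>) ` carrier \<Gamma> = carrier \<Gamma>"
    proof (intro subset_antisym subsetI)
      fix \<gamma> assume "\<gamma> \<in> carrier \<Gamma>"
      then show "\<gamma> \<in> (\<lambda>\<gamma>. \<gamma> \<otimes>\<^bsub>\<Gamma>\<^esub> \<delta>) ` carrier \<Gamma>"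
        using \<delta> by (intro image_eqI[of _ _ "\<gamma> \<otimes>\<^bsub>\<Gamma>\<^esub> inv\<^bsub>\<Gamma>\<^esub> \<delta>"]) (auto simp: \<Gamma>.m_assoc)
    qed (use \<delta> in auto)
    moreover have "inj_on (\<lambda>\<gamma>. \<gamma> \<otimes>\<^bsub>\<Gamma>\<^esub> \<delta>) (carrier \<Gamma>)" using \<delta> by (auto simp: inj_on_def)
    ultimately have "P x = finprod G (\<lambda>\<gamma>. c (\<gamma> \<otimes>\<^bsub>\<Gamma>\<^esub> \<delta>) x) (carrier \<Gamma>)"
      unfolding P_def using finprod_reindex[of "\<lambda>\<gamma>. c \<gamma> x" "\<lambda>\<gamma>. \<gamma> \<otimes>\<^bsub>\<Gamma>\<^esub> \<delta>" "carrier \<Gamma>"] cG x by simp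
    also have "\<dots> = finprod G (\<lambda>\<gamma>. c \<delta> x \<otimes>\<^bsub>G\<^esub> c \<gamma> (a \<delta> x)) (carrier \<Gamma>)"
      using cocycle[OF _ \<delta> x] cG \<delta> x aX by (intro finprod_cong') auto
    also have "\<dots> = finprod G (\<lambda>\<gamma>. c \<delta> x) (carrier \<Gamma>) \<otimes>\<^bsub>G\<^esub> P (a \<delta> x)"
      unfolding P_def using cG \<delta> x aX by (intro finprod_multf) auto
    also have "finprod G (\<lambda>\<gamma>. c \<delta> x) (carrier \<Gamma>) = c \<delta> x [^]\<^bsub>G\<^esub> ?n"
      by (rule finprod_const[OF cG[OF \<delta> x]])
    finally show ?thesis .
  qed
  \<comment> \<open>Conjugate homomorphisms into an abelian group coincide, so
    \<open>\<delta>\<close> moves \<open>e1\<close> and \<open>e2\<close> by the same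
    \<open>\<alpha>\<close>. The element \<open>h\<close> from \<open>\<Phi> e1\<close> to
    \<open>e2\<close> commutes with \<open>\<alpha>\<close>, hence \<open>\<delta>\<close> moves
    \<open>\<Phi> e1\<close> by \<open>\<alpha>\<close> too, exactly as \<open>\<Phi>\<close>
    predicts.\<close>
  have c_fixed: "c \<delta> x = \<one>\<^bsub>G\<^esub>" if \<delta>: "\<delta> \<in> carrier \<Gamma>" and x: "x \<in> topspace X" "a \<delta> x = x" for \<delta> x
  proof -
    obtain e1 e2 g where e: "e1 \<in> P1.E" "e2 \<in> P2.E" "p e1 = x" "proj \<xi>2 e2 = x" and g: "g \<in> carrier G"
      and rep: "\<And>\<gamma>. \<gamma> \<in> stabilizer \<Gamma> a x \<Longrightarrow>
        isotropy_rep G \<xi>2 e2 \<gamma> = g \<otimes>\<^bsub>G\<^esub> isotropy_rep G \<xi>1 e1 \<gamma> \<otimes>\<^bsub>G\<^esub> inv\<^bsub>G\<^esub> g"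
      using iso x(1) unfolding same_isotropy_representations_def p_def by blast
    define \<alpha> where "\<alpha> = P1.translation e1 (L1 \<delta> e1)"
    have \<alpha>: "\<alpha> \<in> carrier G" "ract \<xi>1 e1 \<alpha> = L1 \<delta> e1"
      using P1.translation[OF e(1) L1E[OF \<delta> e(1)]] pL1[OF \<delta> e(1)] e(3) x(2) by (auto simp: \<alpha>_def p_def)
    define \<beta> where "\<beta> = P2.translation e2 (L2 \<delta> e2)"
    have \<beta>: "\<beta> \<in> carrier G" "ract \<xi>2 e2 \<beta> = L2 \<delta> e2"
      using P2.translation[OF e(2) L2E[OF \<delta> e(2)]] pL2[OF \<delta> e(2)] e(4) x(2) by (auto simp: \<beta>_def)
    have "isotropy_rep G \<xi>1 e1 \<delta> = \<alpha>" "isotropy_rep G \<xi>2 e2 \<delta> = \<beta>"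
      unfolding isotropy_rep_def \<alpha>_def \<beta>_def P1.translation_def P2.translation_def L1_def L2_def
      by (simp_all add: eq_commute)
    moreover have "\<delta> \<in> stabilizer \<Gamma> a x" using \<delta> x(2) by (simp add: stabilizer_def)
    ultimately have "\<beta> = g \<otimes>\<^bsub>G\<^esub> \<alpha> \<otimes>\<^bsub>G\<^esub> inv\<^bsub>G\<^esub> g" using rep by metis
    then have "\<beta> = \<alpha>" using g \<alpha>(1) by (simp add: m_comm[of g] P1.m_assoc)
    define h where "h = P2.translation (\<Phi> e1) e2"
    have h: "h \<in> carrier G" "ract \<xi>2 (\<Phi> e1) h = e2"
      using P2.translation[OF \<Phi>E[OF e(1)] e(2)] p\<Phi>[OF e(1)] e by (auto simp: h_def)
    have F: "\<Phi> e1 \<in> P2.E" using \<Phi>E[OF e(1)] .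
    have LF: "L2 \<delta> (\<Phi> e1) \<in> P2.E" using L2E[OF \<delta> F] .
    have "ract \<xi>2 (L2 \<delta> (\<Phi> e1)) h = ract \<xi>2 (ract \<xi>2 (\<Phi> e1) \<alpha>) h"
    proof -
      have "ract \<xi>2 (L2 \<delta> (\<Phi> e1)) h = L2 \<delta> e2" using L2g[OF \<delta> h(1) F] h(2) by simp
      also have "\<dots> = ract \<xi>2 (ract \<xi>2 (\<Phi> e1) h) \<alpha>" using \<beta>(2) \<open>\<beta> = \<alpha>\<close> h(2) by simp
      also have "\<dots> = ract \<xi>2 (ract \<xi>2 (\<Phi> e1) \<alpha>) h"
        using P2.ract_mult[OF F h(1) \<alpha>(1)] P2.ract_mult[OF F \<alpha>(1) h(1)] m_comm[OF h(1) \<alpha>(1)] by simp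
      finally show ?thesis .
    qed
    then have "ract \<xi>2 (ract \<xi>2 (L2 \<delta> (\<Phi> e1)) h) (inv\<^bsub>G\<^esub> h) = ract \<xi>2 (ract \<xi>2 (ract \<xi>2 (\<Phi> e1) \<alpha>) h) (inv\<^bsub>G\<^esub> h)"
      by simp
    then have "L2 \<delta> (\<Phi> e1) = ract \<xi>2 (\<Phi> e1) \<alpha>"
      using h(1) LF P2.ract_closed[OF F \<alpha>(1)] by (simp add: P2.ract_mult[symmetric] P2.ract_one)
    then have "ract \<xi>2 (L2 \<delta> (\<Phi> e1)) \<one>\<^bsub>G\<^esub> = \<Phi> (L1 \<delta> e1)"
      using \<alpha> \<Phi>g[OF e(1) \<alpha>(1)] LF by (simp add: P2.ract_one)
    then have "u \<delta> e1 = \<one>\<^bsub>G\<^esub>" by (intro u_eqI \<delta> e(1)) auto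
    then show ?thesis using cu[OF \<delta> e(1)] e(3) by simp
  qed
  have cb: "c \<delta> x \<otimes>\<^bsub>G\<^esub> b (a \<delta> x) = b x" if \<delta>: "\<delta> \<in> carrier \<Gamma>" and x: "x \<in> topspace X" for \<delta> x
  proof -
    \<comment> \<open>The failure of \<open>b\<close> to split the cocycle at
      \<open>\<delta>\<close>. Both \<open>b x\<close> and the product it is compared with are n-th
      roots of \<open>P x\<close>, so \<open>w\<close> is n-torsion valued and hence constant; at a
      fixed point of \<open>\<delta>\<close> it is 1.\<close>
    define w where "w x = b x \<otimes>\<^bsub>G\<^esub> inv\<^bsub>G\<^esub> (c \<delta> x \<otimes>\<^bsub>G\<^esub> b (a \<delta> x))" for x
    have "continuous_map X (gtop G) w"
      unfolding w_def
      by (intro P1.continuous_map_mult P1.continuous_map_inv b(1) cont_c[OF \<delta>] continuous_map_comp[OF ca[OF \<delta>] b(1)])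
    moreover have "w y [^]\<^bsub>G\<^esub> ?n = \<one>\<^bsub>G\<^esub>" if y: "y \<in> topspace X" for y
    proof -
      have "(c \<delta> y \<otimes>\<^bsub>G\<^esub> b (a \<delta> y)) [^]\<^bsub>G\<^esub> ?n = P y"
        using cG[OF \<delta> y] bG[OF aX[OF \<delta> y]] b(2)[OF aX[OF \<delta> y]] P[OF \<delta> y] by (simp add: P1.pow_mult_distrib m_comm)
      then show ?thesis
        unfolding w_def using bG[OF y] cG[OF \<delta> y] bG[OF aX[OF \<delta> y]] b(2)[OF y] PG[OF y]
        by (simp add: P1.pow_mult_distrib m_comm P1.nat_pow_inv del: P1.inv_mult_group inv_mult)
    qed
    moreover obtain x0 where x0: "x0 \<in> topspace X" "a \<delta> x0 = x0" using fixpt[OF \<delta>] by blast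
    ultimately have "w x = w x0"
      using P1.torsion_valued_constant[OF W comm conn _ _ x x0(1)] by blast
    moreover have "w x0 = \<one>\<^bsub>G\<^esub>" using c_fixed[OF \<delta> x0] x0 bG[OF x0(1)] by (simp add: w_def)
    ultimately have "b x \<otimes>\<^bsub>G\<^esub> inv\<^bsub>G\<^esub> (c \<delta> x \<otimes>\<^bsub>G\<^esub> b (a \<delta> x)) = \<one>\<^bsub>G\<^esub>" by (simp add: w_def)
    then have "b x = inv\<^bsub>G\<^esub> (inv\<^bsub>G\<^esub> (c \<delta> x \<otimes>\<^bsub>G\<^esub> b (a \<delta> x)))"
      using bG[OF x] cG[OF \<delta> x] bG[OF aX[OF \<delta> x]] by (intro P1.inv_equality[symmetric]) (auto simp del: P1.inv_inv)
    then show ?thesis using cG[OF \<delta> x] bG[OF aX[OF \<delta> x]] by simp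
  qed
  \<comment> \<open>Multiplying \<open>\<Phi>\<close> by \<open>b\<close> changes the cocycle by the
    coboundary of \<open>b\<close>. Commutativity keeps the new map equivariant for G.\<close>
  define F where "F e = ract \<xi>2 (\<Phi> e) (b (p e))" for e
  have pX: "p e \<in> topspace X" if "e \<in> P1.E" for e using P1.proj_closed[OF that] by (simp add: p_def)
  have "continuous_map (total \<xi>1) (total \<xi>2) F"
    unfolding F_def p_def
    by (intro P2.continuous_map_ract c\<Phi> continuous_map_comp[OF P1.continuous_map_proj b(1)])
  moreover have "proj \<xi>2 (F e) = proj \<xi>1 e" if "e \<in> P1.E" for e
    using P2.proj_ract[OF \<Phi>E[OF that] bG[OF pX[OF that]]] p\<Phi>[OF that] by (simp add: F_def p_def)
  moreover have "F (ract \<xi>1 e g) = ract \<xi>2 (F e) g" if e: "e \<in> P1.E" and g: "g \<in> carrier G" for e g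
    using P2.ract_mult[OF \<Phi>E[OF e] g bG[OF pX[OF e]]] P2.ract_mult[OF \<Phi>E[OF e] bG[OF pX[OF e]] g]
      m_comm[OF g bG[OF pX[OF e]]] P1.proj_ract[OF e g] \<Phi>g[OF e g]
    by (simp add: F_def p_def)
  ultimately have "bundle_map G \<xi>1 \<xi>2 (\<lambda>x. x) F" by (simp add: bundle_map_def)
  then have "principal_bundle_iso G \<xi>1 \<xi>2 F" by (rule bundle_map_imp_iso[OF pb])
  moreover have "F (L1 \<delta> e) = L2 \<delta> (F e)" if \<delta>: "\<delta> \<in> carrier \<Gamma>" and e: "e \<in> P1.E" for \<delta> e
  proof -
    let ?x = "p e"
    have LF: "L2 \<delta> (\<Phi> e) \<in> P2.E" using L2E[OF \<delta> \<Phi>E[OF e]] .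
    have "F (L1 \<delta> e) = ract \<xi>2 (ract \<xi>2 (L2 \<delta> (\<Phi> e)) (c \<delta> ?x)) (b (a \<delta> ?x))"
      using u(2)[OF \<delta> e] cu[OF \<delta> e] pL1[OF \<delta> e] by (simp add: F_def)
    also have "\<dots> = ract \<xi>2 (L2 \<delta> (\<Phi> e)) (b ?x)"
      using P2.ract_mult[OF LF cG[OF \<delta> pX[OF e]] bG[OF aX[OF \<delta> pX[OF e]]]] cb[OF \<delta> pX[OF e]] by simp
    also have "\<dots> = L2 \<delta> (F e)" using L2g[OF \<delta> bG[OF pX[OF e]] \<Phi>E[OF e]] by (simp add: F_def)
    finally show ?thesis .
  qed
  ultimately show ?thesis unfolding equivariantly_isomorphic_def L1_def L2_def by blast
qed

theorem theorem1p1: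
  fixes G :: "('g, 'v::real_inner) lie_group"
    and \<Gamma> :: "(real^3^3) set"
    and \<xi>1 :: "('e1, real^3, 'g, real^3^3) equivariant_bundle"
    and \<xi>2 :: "('e2, real^3, 'g, real^3^3) equivariant_bundle"
  assumes "lie_group G" and "compact_space (gtop G)" and "connected_space (gtop G)"
    and "comm_group G"
    and "subgroup \<Gamma> SO3" and "finite \<Gamma>"
    and "equivariant_principal_bundle G (SO3\<lparr>carrier := \<Gamma>\<rparr>) S2 (*v) \<xi>1"
    and "equivariant_principal_bundle G (SO3\<lparr>carrier := \<Gamma>\<rparr>) S2 (*v) \<xi>2"
    and "same_isotropy_representations G (SO3\<lparr>carrier := \<Gamma>\<rparr>) S2 (*v) \<xi>1 \<xi>2"
    and "chern_class G S2 \<xi>1 = chern_class G S2 \<xi>2"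
  shows "equivariantly_isomorphic G (SO3\<lparr>carrier := \<Gamma>\<rparr>) \<xi>1 \<xi>2"
proof -
  interpret top_group G by (rule top_group.intro) (use assms(1) in \<open>simp add: lie_group_def\<close>)
  have pb: "principal_bundle G S2 \<xi>1" "principal_bundle G S2 \<xi>2"
    using assms(7,8) by (auto simp: equivariant_principal_bundle_def)
  obtain \<Phi> where \<Phi>: "bundle_map G \<xi>1 \<xi>2 (\<lambda>x. x) \<Phi>"
    using chern_class_eq_imp_bundle_map[OF pb compact_sphere assms(10)] .
  \<comment> \<open>The exponent is the order of the group, which is positive because the group
    contains the identity.\<close>
  have card: "card \<Gamma> > 0" using assms(5,6) subgroup.one_closed card_gt_0_iff by blast
  obtain V \<sigma> W where V: "openin (gtop G) V" "\<one>\<^bsub>G\<^esub> \<in> V" "continuous_map (subtopology (gtop G) V) (gtop G) \<sigma>"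
    "\<forall>u\<in>V. \<sigma> u [^]\<^bsub>G\<^esub> card \<Gamma> = u"
    and W: "openin (gtop G) W" "\<one>\<^bsub>G\<^esub> \<in> W" "\<forall>g\<in>W. g [^]\<^bsub>G\<^esub> card \<Gamma> = \<one>\<^bsub>G\<^esub> \<longrightarrow> g = \<one>\<^bsub>G\<^esub>"
    using lie_group_local_root[OF assms(1) card] .
  show ?thesis
  proof (rule equivariantly_isomorphic_if_bundle_map[OF assms(7,8,4) _ _ assms(9) \<Phi> W(1,2)])
    show "connected_space S2" using connected_sphere[of "0 :: real^3" 1] by (simp flip: connectedin_iff_connected add: connectedin_def)
    show "\<exists>b. continuous_map S2 (gtop G) b \<and>
        (\<forall>x\<in>topspace S2. b x [^]\<^bsub>G\<^esub> card (carrier (SO3\<lparr>carrier := \<Gamma>\<rparr>)) = P x)"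
      if P: "continuous_map S2 (gtop G) P" for P
    proof -
      obtain b where "continuous_map S2 (gtop G) b" "\<And>x. x \<in> sphere 0 1 \<Longrightarrow> b x [^]\<^bsub>G\<^esub> card \<Gamma> = P x"
        using sphere_root[OF V W assms(4,3) P] by blast
      then show ?thesis by auto
    qed
    show "\<exists>x\<in>topspace S2. \<gamma> *v x = x" if "\<gamma> \<in> carrier (SO3\<lparr>carrier := \<Gamma>\<rparr>)" for \<gamma>
    proof -
      have "\<gamma> \<in> carrier SO3" using that assms(5) subgroup.subset by fastforce
      then obtain x where "norm x = 1" "\<gamma> *v x = x" by (rule SO3_fixed_point)
      then show ?thesis by (intro bexI[of _ x]) auto
    qed
  qed (use assms(6) W(3) in auto)
qed

end
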